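(* Let $H,\Xi,K$ be real separable Hilbert spaces. Let $A$ generate a $C_0$-semigroup $(e^{tA})_{t\ge0}$ on $H$, with $M\ge1$, $\omega\in\mathbb{R}$ such that $|e^{tA}|_{\mathcal{L}(H)}\le Me^{\omega t}$ for all $t\ge0$. Let $\sigma\in\mathcal{L}(\Xi,H)$ be such that $e^{sA}\sigma\sigma^*e^{sA^*}$ is trace class for all $s>0$ and $\int_0^t\mathrm{Tr}[e^{sA}\sigma\sigma^*e^{sA^*}]ds<\infty$ for all $t\ge0$, and put $Q_t=\int_0^te^{sA}\sigma\sigma^*e^{sA^*}ds$. Let $G:\mathcal{D}(G)\subseteq K\to H$ be a closed densely defined (possibly unbounded) linear operator such that, for every $t>0$, $e^{tA}G$ extends to an operator $\overline{e^{tA}G}\in\mathcal{L}(K,H)$ (if $G$ is bounded this is just $e^{tA}G$) with $$\overline{e^{tA}G}(K)\subseteq Q_t^{1/2}(H)\qquad\forall t>0,$$ and let $\Gamma_G(t):=Q_t^{-1/2}\,\overline{e^{tA}G}\in\mathcal{L}(K,H)$, $t>0$. For $\phi\in B_m(H)$ let $R_t[\phi](x)=\int_H\phi(e^{tA}x+y)\,\mathcal{N}_{Q_t}(dy)$. Then, for every $m\ge0$, the following hold. (i) For every $\phi\in B_m(H)$ and $t>0$, the function $R_t[\phi]:H\to\mathbb{R}$ is $G$-Fréchet differentiable on $H$ and $$\langle D^GR_t[\phi](x),k\rangle_K=\int_H\phi(y+e^{tA}x)\,\big\langle\Gamma_G(t)k,Q_t^{-1/2}y\big\rangle_H\,\mathcal{N}_{Q_t}(dy)\qquad\forall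 x\in H,\ \forall k\in K.$$ (ii) There exists a constant $\kappa_G>0$ such that, for all $\phi\in B_m(H)$, $t>0$, $x\in H$, $$|D^GR_t[\phi](x)|_K\le\kappa_G|\Gamma_G(t)|_{\mathcal{L}(K,H)}(1+|x|^m)e^{m\omega t}|\phi|_{B_m(H)}\quad\text{if }\omega>0,$$ $$|D^GR_t[\phi](x)|_K\le\kappa_G|\Gamma_G(t)|_{\mathcal{L}(K,H)}(1+|x|^m)(1+t^{m/2})|\phi|_{B_m(H)}\quad\text{if }\omega=0,$$ $$|D^GR_t[\phi](x)|_K\le\kappa_G|\Gamma_G(t)|_{\mathcal{L}(K,H)}(1+|x|^m)|\phi|_{B_m(H)}\quad\text{if }\omega<0.$$ (iii) If $\phi\in C_m(H)$, then $D^GR_t[\phi]\in C_m(H,K)$ for all $t>0$. (iv) If $\phi\in C_m^1(H)$, then $$\langle D^GR_t[\phi](x),k\rangle_K=\int_H\big\langle D\phi(y+e^{tA}x),\overline{e^{tA}G}\,k\big\rangle_H\,\mathcal{N}_{Q_t}(dy)\qquad\forall t>0,\ \forall x\in H,\ \forall k\in K.$$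
   Context: $\mathcal{N}_{Q}$ is the centered Gaussian measure on $H$ with (trace class, nonnegative self-adjoint) covariance $Q$. $(R_t)_{t\geq 0}$ is the Ornstein–Uhlenbeck transition semigroup of $dX=AX\,ds+\sigma\,dW$, with $W$ a cylindrical Wiener process in $\Xi$. $Q_t^{-1/2}$ is the pseudoinverse of $Q_t^{1/2}$: for $h\in Q_t^{1/2}(H)$, $Q_t^{-1/2}h$ is the unique element of minimal norm in $\{u\in H:Q_t^{1/2}u=h\}$. The vector $\Gamma_G(t)k$ lies in $\overline{Q_t^{1/2}(H)}$; for $h\in\overline{Q_t^{1/2}(H)}$, the expression $\langle h,Q_t^{-1/2}y\rangle_H$, as a function of $y$, denotes the element of $L^2(H,\mathcal{N}_{Q_t})$ given by the isometric extension to $\overline{Q_t^{1/2}(H)}$ of the map $Q_t^{1/2}(H)\ni h\mapsto\langle Q_t^{-1/2}h,\cdot\rangle_H\in L^2(H,\mathcal{N}_{Q_t})$. $B_m(H)$ (resp. $C_m(H,V)$) is the set of Borel measurable $\phi:H\to\mathbb{R}$ (resp. continuous $\phi:H\to V$) with $|\phi|_{B_m}$ (resp. $|\phi|_{C_m}$) $:=\sup_x\frac{|\phi(x)|}{1+|x|^m}<\infty$; $C_m(H)=C_m(H,\mathbb{R})$. $C_m^1(H)$ is the set of Fréchet differentiable $\phi\in C_m(H)$ with $D\phi\in C_m(H,H)$. $G$-derivatives: for $f:H\to\mathbb{R}$, $x\in H$, $z\in\mathcal{D}(G)$, put $\nabla^Gf(x;z)=\lim_{s\to0}\frac{f(x+sGz)-f(x)}{s}$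 if the limit exists. $f$ is $G$-Fréchet differentiable at $x$ if $\nabla^Gf(x;z)$ exists for all $z\in\mathcal{D}(G)$, there is an element $D^Gf(x)\in K$ with $\nabla^Gf(x;z)=\langle D^Gf(x),z\rangle_K$ for all $z\in\mathcal{D}(G)$, and the limit is uniform in $z\in\mathcal{D}(G)$ with $|z|_K\le1$. *)

theory Defs
  imports "HOL-Probability.Probability"
begin

text \<open>
  Real separable Hilbert spaces are types of sort
  \<open>{real_inner, banach, second_countable_topology}\<close>; bounded operators are the type of
  \<^theory>\<open>HOL-Analysis.Bounded_Linear_Function\<close>.  Unbounded operators are given by a domain
  and a function whose values outside the domain are irrelevant.
\<close>

definition adj ::
  "('a::real_inner \<Rightarrow>\<^sub>L 'b::real_inner) \<Rightarrow> ('b \<Rightarrow>\<^sub>L 'a)" where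
  "adj T = Blinfun (adjoint (blinfun_apply T))"

definition nonneg_selfadjoint :: "('a::real_inner \<Rightarrow>\<^sub>L 'a) \<Rightarrow> bool" where
  "nonneg_selfadjoint T \<longleftrightarrow>
     (\<forall>x y. inner (T x) y = inner x (T y)) \<and> (\<forall>x. 0 \<le> inner (T x) x)"

text \<open>The nonnegative square root is unique, so the choice below is immaterial.\<close>

definition sqrt_op :: "('a::real_inner \<Rightarrow>\<^sub>L 'a) \<Rightarrow> ('a \<Rightarrow>\<^sub>L 'a)" where
  "sqrt_op T = (SOME R. nonneg_selfadjoint R \<and> R o\<^sub>L R = T)"

text \<open>The element of minimal norm in \<open>{u. T u = h}\<close>; meaningful for \<open>h\<close> in the range of \<open>T\<close>.\<close>

definition pinv ::
  "('a::real_normed_vector \<Rightarrow>\<^sub>L 'b::real_normed_vector) \<Rightarrow> 'b \<Rightarrow> 'a" where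
  "pinv T h = (ARG_MIN norm u. T u = h)"

definition orthonormal_basis :: "'a::real_inner set \<Rightarrow> bool" where
  "orthonormal_basis B \<longleftrightarrow>
     pairwise orthogonal B \<and> (\<forall>b\<in>B. norm b = 1) \<and> closure (span B) = UNIV"

definition trace_class :: "('a::real_inner \<Rightarrow>\<^sub>L 'a) \<Rightarrow> bool" where
  "trace_class T \<longleftrightarrow>
     (\<exists>a b :: nat \<Rightarrow> 'a. summable (\<lambda>n. norm (a n) * norm (b n)) \<and>
        (\<forall>x. (\<lambda>n. inner (a n) x *\<^sub>R b n) sums T x))"

text \<open>For trace class operators the trace does not depend on the chosen basis.\<close>

definition trace_op :: "('a::real_inner \<Rightarrow>\<^sub>L 'a) \<Rightarrow> real" where
  "trace_op T = infsum (\<lambda>b. inner (T b) b) (SOME B. orthonormal_basis B)"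

definition closed_densely_defined ::
  "'k::real_normed_vector set \<Rightarrow> ('k \<Rightarrow> 'h::real_normed_vector) \<Rightarrow> bool" where
  "closed_densely_defined D G \<longleftrightarrow>
     subspace D \<and> closure D = UNIV \<and>
     (\<forall>x\<in>D. \<forall>y\<in>D. G (x + y) = G x + G y) \<and>
     (\<forall>c. \<forall>x\<in>D. G (c *\<^sub>R x) = c *\<^sub>R G x) \<and>
     closed {(z, G z) | z. z \<in> D}"

text \<open>Only the values of \<open>S\<close> at nonnegative times are meaningful.\<close>

definition C0_semigroup :: "(real \<Rightarrow> 'h::real_normed_vector \<Rightarrow>\<^sub>L 'h) \<Rightarrow> bool" where
  "C0_semigroup S \<longleftrightarrow>
     S 0 = id_blinfun \<and>
     (\<forall>s\<ge>0. \<forall>t\<ge>0. S (s + t) = S s o\<^sub>L S t) \<and>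
     (\<forall>x. ((\<lambda>t. S t x) \<longlongrightarrow> x) (at_right 0))"

definition generates_C0_semigroup ::
  "'h::real_normed_vector set \<Rightarrow> ('h \<Rightarrow> 'h) \<Rightarrow> (real \<Rightarrow> 'h \<Rightarrow>\<^sub>L 'h) \<Rightarrow> bool" where
  "generates_C0_semigroup D A S \<longleftrightarrow>
     C0_semigroup S \<and>
     (\<forall>x y. (x \<in> D \<and> A x = y) \<longleftrightarrow>
        ((\<lambda>t. (S t x - x) /\<^sub>R t) \<longlongrightarrow> y) (at_right 0))"

text \<open>The operator \<open>e\<^sup>s\<^sup>A \<sigma> \<sigma>\<^sup>* e\<^sup>s\<^sup>A\<^sup>*\<close>, where the semigroup of the adjoint generator is the adjoint
  semigroup.\<close>

definition cov_density ::
  "(real \<Rightarrow> 'h::real_inner \<Rightarrow>\<^sub>L 'h) \<Rightarrow> ('x::real_inner \<Rightarrow>\<^sub>L 'h) \<Rightarrow> real \<Rightarrow> 'h \<Rightarrow>\<^sub>L 'h" where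
  "cov_density S \<sigma> s = S s o\<^sub>L \<sigma> o\<^sub>L adj \<sigma> o\<^sub>L adj (S s)"

text \<open>The integral of operators is taken in the strong sense: the integrand need not be
  measurable for the operator norm topology of all bounded operators.\<close>

definition cov_op ::
  "(real \<Rightarrow> 'h::{real_inner, banach, second_countable_topology} \<Rightarrow>\<^sub>L 'h) \<Rightarrow>
   ('x::real_inner \<Rightarrow>\<^sub>L 'h) \<Rightarrow> real \<Rightarrow> 'h \<Rightarrow>\<^sub>L 'h" where
  "cov_op S \<sigma> t = Blinfun (\<lambda>h. LINT s:{0..t}|lborel. cov_density S \<sigma> s h)"

definition centered_gaussian_measure ::
  "('h::{real_inner, banach, second_countable_topology} \<Rightarrow>\<^sub>L 'h) \<Rightarrow> 'h measure \<Rightarrow> bool" where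
  "centered_gaussian_measure Q \<mu> \<longleftrightarrow>
     prob_space \<mu> \<and> sets \<mu> = sets borel \<and>
     (\<forall>h. (\<integral>y. iexp (inner h y) \<partial>\<mu>) = exp (- complex_of_real (inner (Q h) h) / 2))"

text \<open>A Borel probability measure on a separable Hilbert space is determined by its Fourier
  transform, so the choice below is immaterial.\<close>

definition gaussian ::
  "('h::{real_inner, banach, second_countable_topology} \<Rightarrow>\<^sub>L 'h) \<Rightarrow> 'h measure" where
  "gaussian Q = (SOME \<mu>. centered_gaussian_measure Q \<mu>)"

text \<open>
  The function \<open>y \<mapsto> \<langle>h, Q\<^sup>-\<^sup>1\<^sup>/\<^sup>2 y\<rangle>\<close>, for \<open>h\<close> in the closure of the range of \<open>Q\<^sup>1\<^sup>/\<^sup>2\<close>: a representative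
  of the value at \<open>h\<close> of the continuous extension of the isometry
  \<open>g \<mapsto> \<langle>Q\<^sup>-\<^sup>1\<^sup>/\<^sup>2 g, \<cdot>\<rangle>\<close> from the range of \<open>Q\<^sup>1\<^sup>/\<^sup>2\<close> into \<open>L\<^sup>2\<close> of the Gaussian measure.  It is unique up to
  null sets.
\<close>

definition gaussian_functional ::
  "('h::{real_inner, banach, second_countable_topology} \<Rightarrow>\<^sub>L 'h) \<Rightarrow> 'h \<Rightarrow> 'h \<Rightarrow> real" where
  "gaussian_functional Q h = (SOME W.
     W \<in> borel_measurable (gaussian Q) \<and> integrable (gaussian Q) (\<lambda>y. (W y)\<^sup>2) \<and>
     (\<exists>g :: nat \<Rightarrow> 'h. range g \<subseteq> range (sqrt_op Q) \<and> g \<longlonglongrightarrow> h \<and>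
        (\<lambda>n. \<integral>\<^sup>+ y. ennreal ((inner (pinv (sqrt_op Q) (g n)) y - W y)\<^sup>2) \<partial>gaussian Q)
          \<longlonglongrightarrow> 0))"

definition OU ::
  "(real \<Rightarrow> 'h::{real_inner, banach, second_countable_topology} \<Rightarrow>\<^sub>L 'h) \<Rightarrow>
   ('x::real_inner \<Rightarrow>\<^sub>L 'h) \<Rightarrow> real \<Rightarrow> ('h \<Rightarrow> real) \<Rightarrow> 'h \<Rightarrow> real" where
  "OU S \<sigma> t \<phi> x = (\<integral>y. \<phi> (S t x + y) \<partial>gaussian (cov_op S \<sigma> t))"

definition Gamma_op ::
  "(real \<Rightarrow> 'h::{real_inner, banach, second_countable_topology} \<Rightarrow>\<^sub>L 'h) \<Rightarrow>
   ('x::real_inner \<Rightarrow>\<^sub>L 'h) \<Rightarrow> (real \<Rightarrow> 'k::real_normed_vector \<Rightarrow>\<^sub>L 'h) \<Rightarrow>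
   real \<Rightarrow> 'k \<Rightarrow>\<^sub>L 'h" where
  "Gamma_op S \<sigma> E t = Blinfun (\<lambda>k. pinv (sqrt_op (cov_op S \<sigma> t)) (E t k))"

text \<open>The convention \<open>0\<^sup>0 = 1\<close>, in contrast to \<open>0 powr 0 = 0\<close>.\<close>

definition weight :: "real \<Rightarrow> 'h::real_normed_vector \<Rightarrow> real" where
  "weight m x = 1 + (if m = 0 then 1 else norm x powr m)"

definition wnorm ::
  "real \<Rightarrow> ('h::real_normed_vector \<Rightarrow> 'v::real_normed_vector) \<Rightarrow> real" where
  "wnorm m \<phi> = (SUP x. norm (\<phi> x) / weight m x)"

definition Bm :: "real \<Rightarrow> ('h::real_normed_vector \<Rightarrow> real) set" where
  "Bm m = {\<phi> \<in> borel_measurable borel. bdd_above (range (\<lambda>x. norm (\<phi> x) / weight m x))}"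

definition Cm :: "real \<Rightarrow> ('h::real_normed_vector \<Rightarrow> 'v::real_normed_vector) set" where
  "Cm m = {\<phi>. continuous_on UNIV \<phi> \<and> bdd_above (range (\<lambda>x. norm (\<phi> x) / weight m x))}"

text \<open>The gradient represents the derivative through the Riesz isomorphism.\<close>

definition gradient :: "('h::real_inner \<Rightarrow> real) \<Rightarrow> 'h \<Rightarrow> 'h" where
  "gradient \<phi> x = (THE d. GDERIV \<phi> x :> d)"

definition C1m :: "real \<Rightarrow> ('h::real_inner \<Rightarrow> real) set" where
  "C1m m = {\<phi> \<in> Cm m. (\<forall>x. \<phi> differentiable at x) \<and> gradient \<phi> \<in> Cm m}"

definition G_quotient ::
  "('k \<Rightarrow> 'h::real_normed_vector) \<Rightarrow> ('h \<Rightarrow> real) \<Rightarrow> 'h \<Rightarrow> real \<Rightarrow> 'k \<Rightarrow> real" where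
  "G_quotient G f x s z = (f (x + s *\<^sub>R G z) - f x) / s"

definition has_G_gradient ::
  "'k::real_inner set \<Rightarrow> ('k \<Rightarrow> 'h::real_normed_vector) \<Rightarrow> ('h \<Rightarrow> real) \<Rightarrow> 'h \<Rightarrow> 'k \<Rightarrow> bool" where
  "has_G_gradient D G f x d \<longleftrightarrow>
     (\<forall>z\<in>D. ((\<lambda>s. G_quotient G f x s z) \<longlongrightarrow> inner d z) (at 0)) \<and>
     uniform_limit {z \<in> D. norm z \<le> 1} (G_quotient G f x) (\<lambda>z. inner d z) (at 0)"

definition G_differentiable ::
  "'k::real_inner set \<Rightarrow> ('k \<Rightarrow> 'h::real_normed_vector) \<Rightarrow> ('h \<Rightarrow> real) \<Rightarrow> 'h \<Rightarrow> bool" where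
  "G_differentiable D G f x \<longleftrightarrow> (\<exists>d. has_G_gradient D G f x d)"

definition G_gradient ::
  "'k::real_inner set \<Rightarrow> ('k \<Rightarrow> 'h::real_normed_vector) \<Rightarrow> ('h \<Rightarrow> real) \<Rightarrow> 'h \<Rightarrow> 'k" where
  "G_gradient D G f x = (THE d. has_G_gradient D G f x d)"

end

theory Submission
  imports Defs
begin

text \<open>
  Write \<open>R = Q\<^sub>t\<^sup>1\<^sup>/\<^sup>2\<close>, \<open>\<mu> = N(0, Q\<^sub>t)\<close> and \<open>u = \<Gamma>(t) z\<close>, so that the shift of \<open>e\<^sup>t\<^sup>A x\<close> caused by
  moving \<open>x\<close> by \<open>s G z\<close> is \<open>s R u\<close>.  By the Cameron--Martin formula this shift of \<open>\<mu>\<close> has the density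
  \<open>\<rho>\<^sub>s = exp (s W - s\<^sup>2 |u|\<^sup>2 / 2)\<close>, where \<open>W = \<langle>u, R\<^sup>-\<^sup>1 y\<rangle>\<close> is normal with variance \<open>|u|\<^sup>2\<close>.  Hence the error of the
  difference quotient is at most \<open>|\<phi>|\<close> in \<open>L\<^sup>2\<close> times the \<open>L\<^sup>2\<close> norm of \<open>(\<rho>\<^sub>s - 1) / s - W\<close>, whose square is
  \<open>(exp (s\<^sup>2 |u|\<^sup>2) - 1 - s\<^sup>2 |u|\<^sup>2) / s\<^sup>2\<close>; this depends only on \<open>|u|\<close>, so the limit is uniform.  The gradient is
  then bounded by \<open>|\<Gamma>(t)|\<close> times an \<open>L\<^sup>2\<close> norm of \<open>\<phi>\<close>, and the growth in \<open>t\<close> comes from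
  \<open>E |y|\<^sup>2\<^sup>m \<le> C (Tr Q\<^sub>t)\<^sup>m\<close> and \<open>Tr Q\<^sub>n\<^sub>+\<^sub>1 - Tr Q\<^sub>n \<le> |e\<^sup>n\<^sup>A|\<^sup>2 Tr Q\<^sub>1\<close>.
\<close>

section \<open>Hilbert spaces\<close>

text \<open>In (i) nothing but measurability and growth of \<open>\<phi>\<close> is available, so
  the derivative has to fall on the measure, and \<open>\<phi>\<close> enters only through its
  square integrability under every shift. The objects \<open>sqrt_op\<close>,
  \<open>gaussian\<close> and \<open>gaussian_functional\<close> are choices: existence must be
  established before any property of them can be used, which accounts for the operator iteration,
  the random series and the \<open>L\<^sup>2\<close> completion below. The direction
  \<open>\<Gamma> k\<close> lies only in the closure of the range, so its \<open>W\<close> need not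
  be a continuous functional. It is known up to a null set, separately for each \<open>k\<close>,
  and no pointwise gradient vector can be read off; the gradient is the Riesz vector of the
  integrals of \<open>\<phi>\<close> against \<open>W\<close>. For the same reason the shift formula
  is proved with a random substitution that preserves the measure, and recognising the law after the
  substitution requires that a measure be determined by its Fourier transform. In (ii) one constant
  must serve all times: the moment constants depend on \<open>m\<close> alone, and time enters
  through the trace, the growth bound of the semigroup and \<open>\<Gamma>\<close>.\<close>

lemma min_norm_orthogonal:
  fixes w v :: "'a::real_inner"
  assumes "\<And>t. norm w \<le> norm (w + t *\<^sub>R v)"
  shows "inner w v = 0"
proof (cases "v = 0")
  case False
  \<comment> \<open>The minimiser of the quadratic polynomial
    \<open>t \<mapsto> (norm (w + t *\<^sub>R v))\<^sup>2\<close>.\<close>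
  define t where "t = - inner w v / (norm v)\<^sup>2"
  have v: "(norm v)\<^sup>2 > 0" using False by simp
  have "(norm w)\<^sup>2 \<le> (norm (w + t *\<^sub>R v))\<^sup>2"
    using assms by (intro power_mono) auto
  also have "\<dots> = (norm w)\<^sup>2 + 2 * t * inner w v + t\<^sup>2 * (norm v)\<^sup>2"
    by (simp only: power2_norm_eq_inner inner_simps) (simp add: inner_commute power2_eq_square algebra_simps)
  also have "\<dots> = (norm w)\<^sup>2 - (inner w v)\<^sup>2 / (norm v)\<^sup>2"
    using v by (simp add: t_def field_simps power2_eq_square)
  finally have "(inner w v)\<^sup>2 / (norm v)\<^sup>2 \<le> 0" by simp
  then have "(inner w v)\<^sup>2 \<le> 0" using v by (simp add: divide_le_0_iff)
  then show ?thesis by simp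
qed simp

text \<open>A minimising sequence is Cauchy by the parallelogram law: midpoints stay in
  \<open>C\<close>, so their squared norms cannot fall below the infimum \<open>q\<close>, which
  forces the differences to be small.\<close>

lemma closed_convex_min_norm:
  fixes C :: "'a::{real_inner,banach} set"
  assumes "closed C" "convex C" "C \<noteq> {}"
  shows "\<exists>x\<in>C. \<forall>y\<in>C. norm x \<le> norm y"
proof -
  define q where "q = (INF y\<in>C. (norm y)\<^sup>2)"
  have bdd: "bdd_below ((\<lambda>y. (norm y)\<^sup>2) ` C)" by (rule bdd_belowI[of _ 0]) auto
  have q: "q \<le> (norm y)\<^sup>2" if "y \<in> C" for y
    unfolding q_def using that bdd by (rule cINF_lower[rotated])
  have "\<exists>y\<in>C. (norm y)\<^sup>2 < q + 1 / (real n + 1)" for n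
    using cINF_less_iff[OF assms(3) bdd, of "q + 1 / (real n + 1)"] unfolding q_def by auto
  then obtain x where x: "\<And>n. x n \<in> C" "\<And>n. (norm (x n))\<^sup>2 < q + 1 / (real n + 1)"
    by metis
  have par: "(norm (x n - x k))\<^sup>2 < 2 / (real n + 1) + 2 / (real k + 1)" for n k
  proof -
    have "(1/2) *\<^sub>R x n + (1/2) *\<^sub>R x k \<in> C"
      using assms(2) x(1) by (intro convexD) auto
    then have "q \<le> (norm ((1/2) *\<^sub>R x n + (1/2) *\<^sub>R x k))\<^sup>2" by (rule q)
    moreover have "(norm (x n - x k))\<^sup>2 = 2 * (norm (x n))\<^sup>2 + 2 * (norm (x k))\<^sup>2
        - 4 * (norm ((1/2) *\<^sub>R x n + (1/2) *\<^sub>R x k))\<^sup>2"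
      by (simp only: power2_norm_eq_inner inner_simps) (simp add: inner_commute field_simps)
    ultimately show ?thesis using x(2)[of n] x(2)[of k] by simp
  qed
  have "Cauchy x"
  proof (rule metric_CauchyI)
    fix e :: real assume e: "e > 0"
    obtain N where N: "4 / e\<^sup>2 < real N" using reals_Archimedean2 by blast
    show "\<exists>N. \<forall>n\<ge>N. \<forall>k\<ge>N. dist (x n) (x k) < e"
    proof (intro exI[of _ N] allI impI)
      fix n k assume nk: "n \<ge> N" "k \<ge> N"
      have "(norm (x n - x k))\<^sup>2 < 2 / (real n + 1) + 2 / (real k + 1)" by (rule par)
      also have "\<dots> \<le> 2 / (real N + 1) + 2 / (real N + 1)"
        using nk by (intro add_mono divide_left_mono) auto
      also have "\<dots> = 4 / (real N + 1)" by simp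
      also have "\<dots> < e\<^sup>2" using N e by (simp add: field_simps) (smt (verit) zero_less_power)
      finally show "dist (x n) (x k) < e"
        using e by (simp add: dist_norm power_less_imp_less_base)
    qed
  qed
  then obtain l where l: "x \<longlonglongrightarrow> l" using Cauchy_convergent convergent_def by blast
  have lC: "l \<in> C" using closed_sequentially[OF assms(1)] x(1) l by blast
  have lim2: "(\<lambda>n. q + 1 / (real n + 1)) \<longlonglongrightarrow> q + 0"
    using LIMSEQ_inverse_real_of_nat
    by (intro tendsto_add tendsto_const) (simp only: inverse_eq_divide of_nat_Suc add.commute)
  have "(norm l)\<^sup>2 \<le> q + 0"
  proof (rule LIMSEQ_le[OF _ lim2])
    show "(\<lambda>n. (norm (x n))\<^sup>2) \<longlonglongrightarrow> (norm l)\<^sup>2" by (intro tendsto_intros l)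
    show "\<exists>N. \<forall>n\<ge>N. (norm (x n))\<^sup>2 \<le> q + 1 / (real n + 1)" using x(2) less_imp_le by blast
  qed
  then have "norm l \<le> norm y" if "y \<in> C" for y
    using order_trans[OF _ q[OF that], of "(norm l)\<^sup>2"]
    by (intro power2_le_imp_le[OF _ norm_ge_zero]) simp
  with lC show ?thesis by blast
qed

text \<open>The translate of \<open>V\<close> by \<open>x\<close> has a point of minimal norm
  \<open>x + p\<close>. Minimality makes it orthogonal to \<open>V\<close>, so the projection is the
  vector called \<open>- p\<close> in the proof.\<close>

lemma closed_subspace_projection:
  fixes V :: "'a::{real_inner,banach} set"
  assumes "closed V" "subspace V"
  obtains p where "p \<in> V" "\<And>v. v \<in> V \<Longrightarrow> inner (x - p) v = 0"
proof -
  have "closed ((+) x ` V)" "convex ((+) x ` V)" "(+) x ` V \<noteq> {}"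
    using assms subspace_0
    by (auto intro!: closed_translation convex_translation subspace_imp_convex)
  from closed_convex_min_norm[OF this] obtain p where
    p: "p \<in> V" "\<And>v. v \<in> V \<Longrightarrow> norm (x + p) \<le> norm (x + v)" by auto
  have "inner (x - (- p)) v = 0" if v: "v \<in> V" for v
  proof (rule min_norm_orthogonal)
    fix t :: real
    have "p + t *\<^sub>R v \<in> V" using p(1) v assms(2) by (simp add: subspace_add subspace_scale)
    from p(2)[OF this] show "norm (x - - p) \<le> norm (x - - p + t *\<^sub>R v)"
      by (simp add: algebra_simps)
  qed
  moreover have "- p \<in> V" using p(1) assms(2) by (simp add: subspace_neg)
  ultimately show ?thesis using that by blast
qed

lemma subspace_closure:
  fixes V :: "'a::real_normed_vector set"
  assumes "subspace V"
  shows "subspace (closure V)"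
  unfolding subspace_def
proof (intro conjI ballI allI)
  show "0 \<in> closure V" using assms closure_subset subspace_0 by blast
  fix x assume "x \<in> closure V"
  then obtain f where f: "\<And>n. f n \<in> V" "f \<longlonglongrightarrow> x" by (auto simp: closure_sequential)
  show "c *\<^sub>R x \<in> closure V" for c
    using f assms by (auto simp: closure_sequential subspace_scale
        intro!: exI[of _ "\<lambda>n. c *\<^sub>R f n"] tendsto_intros)
  fix y assume "y \<in> closure V"
  then obtain g where g: "\<And>n. g n \<in> V" "g \<longlonglongrightarrow> y" by (auto simp: closure_sequential)
  show "x + y \<in> closure V"
    using f g assms by (auto simp: closure_sequential subspace_add
        intro!: exI[of _ "\<lambda>n. f n + g n"] tendsto_intros)
qed

text \<open>The kernel has codimension one, so the residual \<open>w\<close> of \<open>x\<close>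
  after projection onto it spans the complement; the factor \<open>f w / (norm w)\<^sup>2\<close>
  fixes the value at \<open>w\<close>.\<close>

lemma riesz_representation:
  fixes f :: "'a::{real_inner,banach} \<Rightarrow> real"
  assumes "bounded_linear f"
  obtains d where "\<And>x. f x = inner d x"
proof (cases "\<exists>x. f x \<noteq> 0")
  case True
  then obtain x where x: "f x \<noteq> 0" by blast
  interpret f: bounded_linear f by fact
  have "closed {v. f v = 0}"
    by (intro closed_Collect_eq continuous_on_const linear_continuous_on assms)
  moreover have "subspace {v. f v = 0}"
    by (auto simp: subspace_def f.zero f.add f.scaleR)
  ultimately obtain p where p: "f p = 0" "\<And>v. f v = 0 \<Longrightarrow> inner (x - p) v = 0"
    using closed_subspace_projection[of "{v. f v = 0}" x] by auto
  define w where "w = x - p"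
  have fw: "f w = f x" using p(1) by (simp add: w_def f.diff)
  with x have w: "w \<noteq> 0" using f.zero by auto
  have "f y = inner ((f w / (norm w)\<^sup>2) *\<^sub>R w) y" for y
  proof -
    have "f (y - (f y / f w) *\<^sub>R w) = 0" using x fw by (simp add: f.diff f.scaleR)
    from p(2)[OF this] have "inner w y = (f y / f w) * inner w w"
      by (simp add: w_def[symmetric] inner_diff_right)
    then show ?thesis using w x fw by (simp add: power2_norm_eq_inner field_simps)
  qed
  then show ?thesis by (rule that)
next
  case False
  then show ?thesis using that[of 0] by simp
qed

section \<open>Adjoints of bounded operators\<close>

lemma square_le_mult_imp_le: "x * x \<le> x * y \<Longrightarrow> 0 \<le> y \<Longrightarrow> x \<le> y" for x y :: real
  by (cases "x \<le> 0") auto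

text \<open>Both layers of \<open>adj\<close> have to be justified: \<open>adjoint\<close> is a
  choice, legitimate by Riesz representation, and \<open>Blinfun\<close> is meaningful only for a
  bounded linear map.\<close>

lemma inner_adj:
  fixes T :: "'a::{real_inner,banach} \<Rightarrow>\<^sub>L 'b::real_inner"
  shows "inner (adj T y) x = inner y (T x)"
proof -
  have "\<exists>d. \<forall>x. inner y (T x) = inner d x" for y
    by (rule riesz_representation[OF bounded_linear_inner_right_comp[OF blinfun.bounded_linear_right]])
      blast
  then obtain f where f: "\<And>y x. inner y (T x) = inner (f y) x" by metis
  then have "\<exists>f'. \<forall>x y. inner (T x) y = inner x (f' y)" by (metis inner_commute)
  then have ad: "inner (T x) y = inner x (adjoint (blinfun_apply T) y)" for x y
    unfolding adjoint_def by (rule someI2_ex) blast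
  have "bounded_linear (adjoint (blinfun_apply T))"
  proof (rule bounded_linear_intro[where K = "norm T"])
    fix y z :: 'b and r :: real
    show "adjoint (blinfun_apply T) (y + z) = adjoint (blinfun_apply T) y + adjoint (blinfun_apply T) z"
      by (rule vector_eq_ldot[THEN iffD1]) (auto simp: ad[symmetric] inner_add_right)
    show "adjoint (blinfun_apply T) (r *\<^sub>R y) = r *\<^sub>R adjoint (blinfun_apply T) y"
      by (rule vector_eq_ldot[THEN iffD1]) (auto simp: ad[symmetric])
    let ?a = "adjoint (blinfun_apply T) y"
    have "(norm ?a)\<^sup>2 = inner (T ?a) y" by (simp add: power2_norm_eq_inner ad)
    also have "\<dots> \<le> norm (T ?a) * norm y" by (rule norm_cauchy_schwarz)
    also have "\<dots> \<le> (norm T * norm ?a) * norm y" by (intro mult_right_mono norm_blinfun) auto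
    finally have "norm ?a * norm ?a \<le> norm ?a * (norm y * norm T)"
      by (simp add: power2_eq_square mult_ac)
    then show "norm ?a \<le> norm y * norm T"
      by (rule square_le_mult_imp_le) simp
  qed
  then have "adj T y = adjoint (blinfun_apply T) y"
    unfolding adj_def by (simp add: bounded_linear_Blinfun_apply)
  then show ?thesis by (metis ad inner_commute)
qed

lemma adj_compose_apply:
  fixes T :: "'a::{real_inner,banach} \<Rightarrow>\<^sub>L 'b::{real_inner,banach}" and U :: "'b \<Rightarrow>\<^sub>L 'c::real_inner"
  shows "adj (U o\<^sub>L T) y = adj T (adj U y)"
  by (rule vector_eq_rdot[THEN iffD1]) (auto simp: inner_adj)

lemma norm_adj_le:
  fixes T :: "'a::{real_inner,banach} \<Rightarrow>\<^sub>L 'b::real_inner"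
  shows "norm (adj T) \<le> norm T"
proof (rule norm_blinfun_bound)
  fix y
  let ?a = "adj T y"
  have "(norm ?a)\<^sup>2 = inner y (T ?a)" by (simp add: power2_norm_eq_inner inner_adj)
  also have "\<dots> \<le> norm y * norm (T ?a)" by (rule norm_cauchy_schwarz)
  also have "\<dots> \<le> norm y * (norm T * norm ?a)" by (intro mult_left_mono norm_blinfun) auto
  finally have "norm ?a * norm ?a \<le> norm ?a * (norm T * norm y)"
    by (simp add: power2_eq_square mult_ac)
  then show "norm ?a \<le> norm T * norm y"
    by (rule square_le_mult_imp_le) simp
qed simp

section \<open>Square roots of nonnegative operators\<close>

lemma nonneg_selfadjoint_norm_le_1:
  fixes B :: "'a::real_inner \<Rightarrow>\<^sub>L 'a"
  assumes B: "nonneg_selfadjoint B" and le: "\<And>x. inner (B x) x \<le> (norm x)\<^sup>2"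
  shows "norm B \<le> 1"
proof (rule norm_blinfun_bound)
  fix x
  let ?y = "B x"
  have sym: "inner (B u) v = inner u (B v)" and pos: "0 \<le> inner (B u) u" for u v
    using B by (auto simp: nonneg_selfadjoint_def)
  have quad: "0 \<le> inner (B x) x + 2 * t * inner (B x) ?y + t\<^sup>2 * inner (B ?y) ?y" for t
  proof -
    have "inner (B (x + t *\<^sub>R ?y)) (x + t *\<^sub>R ?y) =
        inner (B x) x + 2 * t * inner (B x) ?y + t\<^sup>2 * inner (B ?y) ?y"
      using sym[of ?y x]
      by (simp add: blinfun.bilinear_simps inner_simps power2_eq_square inner_commute algebra_simps)
    with pos[of "x + t *\<^sub>R ?y"] show ?thesis by simp
  qed
  \<comment> \<open>At \<open>t = -1\<close> the mixed term is
    \<open>- 2 * (norm ?y)\<^sup>2\<close>, while the two outer terms are at most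
    \<open>(norm x)\<^sup>2\<close> and \<open>(norm ?y)\<^sup>2\<close>.\<close>
  have "0 \<le> (norm x)\<^sup>2 - (norm ?y)\<^sup>2"
    using quad[of "-1"] le[of x] le[of ?y] by (simp add: power2_norm_eq_inner)
  then show "norm (B x) \<le> 1 * norm x" by (auto intro: power2_le_imp_le)
qed simp

text \<open>With \<open>B = id_blinfun - T\<close> and \<open>R = id_blinfun - Z\<close>, the
  equation for the root becomes the fixed point equation \<open>Z = (B + Z\<^sup>2) / 2\<close>. Its
  iteration need not contract strictly, since \<open>norm B\<close> may be 1; it is instead
  dominated, increment by increment, by the scalar iteration \<open>y\<close> started at 0, which is
  increasing and bounded by 1 and hence Cauchy.\<close>

lemma sqrt_op_exists_contraction:
  fixes T :: "'a::{real_inner,banach} \<Rightarrow>\<^sub>L 'a"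
  assumes T: "nonneg_selfadjoint T" and le: "\<And>x. inner (T x) x \<le> (norm x)\<^sup>2"
  shows "\<exists>R. nonneg_selfadjoint R \<and> R o\<^sub>L R = T"
proof -
  define B where "B = id_blinfun - T"
  have symT: "inner (T u) v = inner u (T v)" and posT: "0 \<le> inner (T u) u" for u v
    using T by (auto simp: nonneg_selfadjoint_def)
  have symB: "inner (B u) v = inner u (B v)" for u v
    by (simp add: B_def blinfun.bilinear_simps inner_simps symT)
  have "norm B \<le> 1"
  proof (rule nonneg_selfadjoint_norm_le_1)
    show "nonneg_selfadjoint B"
      unfolding nonneg_selfadjoint_def using le
      by (auto simp: symB) (simp add: B_def blinfun.bilinear_simps inner_simps power2_norm_eq_inner inner_commute)
    show "inner (B x) x \<le> (norm x)\<^sup>2" for x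
      using posT[of x] by (simp add: B_def blinfun.bilinear_simps inner_simps power2_norm_eq_inner)
  qed
  define Y where "Y = rec_nat 0 (\<lambda>_ Z. (1/2) *\<^sub>R (B + (Z o\<^sub>L Z)))"
  define y :: "nat \<Rightarrow> real" where "y = rec_nat 0 (\<lambda>_ z. (1 + z\<^sup>2) / 2)"
  have Y0: "Y 0 = 0" and YS: "Y (Suc n) = (1/2) *\<^sub>R (B + (Y n o\<^sub>L Y n))" for n
    by (simp_all add: Y_def)
  have y0: "y 0 = 0" and yS: "y (Suc n) = (1 + (y n)\<^sup>2) / 2" for n by (simp_all add: y_def)
  have yb: "0 \<le> y n \<and> y n \<le> 1" for n
    by (induction n) (auto simp: y0 yS power_le_one)
  have Yb: "norm (Y n) \<le> y n" for n
  proof (induction n)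
    case (Suc n)
    have "norm (Y n o\<^sub>L Y n) \<le> (y n)\<^sup>2"
      using norm_blinfun_compose[of "Y n" "Y n"] Suc mult_mono[OF Suc Suc]
      by (auto simp: power2_eq_square yb intro: order_trans)
    then have "norm (B + (Y n o\<^sub>L Y n)) \<le> 1 + (y n)\<^sup>2"
      using \<open>norm B \<le> 1\<close> by (intro norm_triangle_le) auto
    then show ?case by (simp add: YS yS)
  qed (simp add: Y0 y0)
  have step: "norm (Y (Suc n) - Y n) \<le> y (Suc n) - y n" for n
  proof (induction n)
    case 0
    then show ?case using \<open>norm B \<le> 1\<close> by (simp add: YS yS Y0 y0)
  next
    case (Suc n)
    let ?Z = "Y (Suc n)" and ?W = "Y n"
    \<comment> \<open>The difference of the two squares is telescoped as
      \<open>Z (Z - W) + (Z - W) W\<close>, an identity valid for noncommuting operators.\<close>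
    have "Y (Suc (Suc n)) - ?Z = (1/2) *\<^sub>R ((?Z o\<^sub>L (?Z - ?W)) + ((?Z - ?W) o\<^sub>L ?W))"
      by (rule blinfun_eqI) (simp add: YS[of "Suc n"] YS[of n] blinfun.bilinear_simps algebra_simps)
    also have "norm \<dots> \<le> (1/2) * (norm ?Z * norm (?Z - ?W) + norm (?Z - ?W) * norm ?W)"
      by (simp, rule norm_triangle_le) (intro add_mono norm_blinfun_compose)
    also have "\<dots> \<le> (1/2) * (y (Suc n) * (y (Suc n) - y n) + (y (Suc n) - y n) * y n)"
      using Suc yb order_trans[OF norm_ge_zero Suc]
      by (intro mult_left_mono add_mono mult_mono Yb) auto
    also have "\<dots> = y (Suc (Suc n)) - y (Suc n)"
      by (simp add: yS[of "Suc n"] yS[of n] power2_eq_square field_simps)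
    finally show ?case .
  qed
  have "incseq y" 
    by (intro incseq_SucI) (metis step norm_ge_zero order_trans diff_ge_0_iff_ge)
  then have "convergent y"
    using yb by (intro Bseq_mono_convergent BseqI'[of _ 1]) (auto simp: incseq_def)
  then have "Cauchy y" by (rule convergent_Cauchy)
  have diff: "norm (Y (n + k) - Y n) \<le> y (n + k) - y n" for n k
  proof (induction k)
    case (Suc k)
    have "norm (Y (n + Suc k) - Y n) \<le> norm (Y (Suc (n + k)) - Y (n + k)) + norm (Y (n + k) - Y n)"
      using norm_triangle_ineq[of "Y (Suc (n + k)) - Y (n + k)" "Y (n + k) - Y n"] by simp
    with Suc step[of "n + k"] show ?case by simp
  qed simp
  have "Cauchy Y"
  proof (rule CauchyI')
    fix e :: real assume "e > 0"
    with \<open>Cauchy y\<close> obtain N where N: "\<And>m n. m \<ge> N \<Longrightarrow> n \<ge> N \<Longrightarrow> norm (y m - y n) < e"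
      unfolding Cauchy_iff by blast
    have "norm (Y m - Y n) < e" if "m \<ge> N" "n > m" for m n
      using diff[of m "n - m"] N[of n m] that by (simp add: norm_minus_commute)
    then show "\<exists>M. \<forall>m\<ge>M. \<forall>n>m. dist (Y m) (Y n) < e" by (auto simp: dist_norm)
  qed
  then obtain Z where Z: "Y \<longlonglongrightarrow> Z" using Cauchy_convergent convergent_def by blast
  have "(\<lambda>n. (1/2) *\<^sub>R (B + (Y n o\<^sub>L Y n))) \<longlonglongrightarrow> (1/2) *\<^sub>R (B + (Z o\<^sub>L Z))"
    by (intro tendsto_intros bounded_bilinear.tendsto[OF bounded_bilinear_blinfun_compose] Z)
  moreover have "(\<lambda>n. Y (Suc n)) \<longlonglongrightarrow> Z" using Z by (rule LIMSEQ_Suc)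
  ultimately have Zeq: "Z = (1/2) *\<^sub>R (B + (Z o\<^sub>L Z))"
    by (simp add: YS LIMSEQ_unique)
  have symY: "inner (Y n u) v = inner u (Y n v)" for n u v
    by (induction n arbitrary: u v)
      (auto simp: Y0 YS blinfun.bilinear_simps inner_simps symB)
  have apZ: "(\<lambda>n. Y n u) \<longlonglongrightarrow> Z u" for u by (intro tendsto_intros Z)
  have symZ: "inner (Z u) v = inner u (Z v)" for u v
    by (rule LIMSEQ_unique[of "\<lambda>n. inner (Y n u) v"])
      (simp_all add: tendsto_inner apZ, simp add: symY tendsto_inner apZ)
  have nZ: "norm Z \<le> 1"
    by (rule LIMSEQ_le_const2[OF tendsto_norm[OF Z]]) (use Yb yb order_trans in blast)
  have "nonneg_selfadjoint (id_blinfun - Z)"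
    unfolding nonneg_selfadjoint_def
  proof (intro conjI allI)
    fix u v
    show "inner ((id_blinfun - Z) u) v = inner u ((id_blinfun - Z) v)"
      by (simp add: blinfun.bilinear_simps inner_simps symZ)
    have "inner (Z u) u \<le> norm (Z u) * norm u" by (rule norm_cauchy_schwarz)
    also have "\<dots> \<le> (1 * norm u) * norm u"
      by (intro mult_right_mono order_trans[OF norm_blinfun] nZ) auto
    finally show "0 \<le> inner ((id_blinfun - Z) u) u"
      by (simp add: blinfun.bilinear_simps inner_simps power2_norm_eq_inner[symmetric] power2_eq_square)
  qed
  moreover have "(id_blinfun - Z) o\<^sub>L (id_blinfun - Z) = T"
  proof (rule blinfun_eqI)
    fix u
    have "2 *\<^sub>R Z u = 2 *\<^sub>R ((1/2) *\<^sub>R (B + (Z o\<^sub>L Z))) u" using Zeq by metis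
    then have "2 *\<^sub>R Z u = u - T u + Z (Z u)"
      by (simp add: blinfun.bilinear_simps B_def)
    then show "((id_blinfun - Z) o\<^sub>L (id_blinfun - Z)) u = T u"
      by (simp add: blinfun.bilinear_simps scaleR_2 algebra_simps)
  qed
  ultimately show ?thesis by blast
qed

lemma sqrt_op:
  fixes T :: "'a::{real_inner,banach} \<Rightarrow>\<^sub>L 'a"
  assumes T: "nonneg_selfadjoint T"
  shows "nonneg_selfadjoint (sqrt_op T)" "sqrt_op T o\<^sub>L sqrt_op T = T"
proof -
  \<comment> \<open>Adding 1 keeps the scaling factor positive for \<open>T = 0\<close>.\<close>
  define c where "c = norm T + 1"
  have c: "c > 0" by (simp add: c_def add_nonneg_pos)
  have "\<exists>R. nonneg_selfadjoint R \<and> R o\<^sub>L R = (1/c) *\<^sub>R T"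
  proof (rule sqrt_op_exists_contraction)
    show "nonneg_selfadjoint ((1 / c) *\<^sub>R T)"
      using T c by (auto simp: nonneg_selfadjoint_def blinfun.bilinear_simps)
    fix x
    have "inner (T x) x \<le> norm (T x) * norm x" by (rule norm_cauchy_schwarz)
    also have "\<dots> \<le> (norm T * norm x) * norm x" by (intro mult_right_mono norm_blinfun) auto
    also have "\<dots> \<le> c * (norm x)\<^sup>2"
      by (simp add: c_def power2_eq_square algebra_simps)
    finally show "inner (((1 / c) *\<^sub>R T) x) x \<le> (norm x)\<^sup>2"
      using c by (simp add: blinfun.bilinear_simps field_simps)
  qed
  then obtain R where R: "nonneg_selfadjoint R" "R o\<^sub>L R = (1/c) *\<^sub>R T" by blast
  have "nonneg_selfadjoint (sqrt c *\<^sub>R R) \<and> (sqrt c *\<^sub>R R) o\<^sub>L (sqrt c *\<^sub>R R) = T"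
  proof
    show "nonneg_selfadjoint (sqrt c *\<^sub>R R)"
      using R(1) c by (auto simp: nonneg_selfadjoint_def blinfun.bilinear_simps)
    have "(sqrt c *\<^sub>R R) o\<^sub>L (sqrt c *\<^sub>R R) = c *\<^sub>R (R o\<^sub>L R)"
      using c by (intro blinfun_eqI) (simp add: blinfun.bilinear_simps)
    then show "(sqrt c *\<^sub>R R) o\<^sub>L (sqrt c *\<^sub>R R) = T" using R(2) c by simp
  qed
  then have "nonneg_selfadjoint (sqrt_op T) \<and> sqrt_op T o\<^sub>L sqrt_op T = T"
    unfolding sqrt_op_def by (rule someI)
  then show "nonneg_selfadjoint (sqrt_op T)" "sqrt_op T o\<^sub>L sqrt_op T = T" by auto
qed

section \<open>Pseudoinverses of selfadjoint operators\<close>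

lemma nonneg_selfadjoint_inner:
  "nonneg_selfadjoint R \<Longrightarrow> inner (blinfun_apply R u) v = inner u (R v)"
  by (simp add: nonneg_selfadjoint_def)

text \<open>The solution set is a closed affine space, so the minimum behind \<open>pinv\<close> is
  attained; varying the minimiser along the kernel of \<open>T\<close> gives the
  orthogonality.\<close>

lemma pinv:
  fixes T :: "'a::{real_inner,banach} \<Rightarrow>\<^sub>L 'b::real_normed_vector"
  assumes "h \<in> range T"
  shows "T (pinv T h) = h" "T v = 0 \<Longrightarrow> inner (pinv T h) v = 0"
proof -
  have "closed {u. T u = h}"
    by (intro closed_Collect_eq continuous_intros)
  moreover have "convex {u. T u = h}"
    by (auto simp: convex_def blinfun.bilinear_simps scaleR_add_left[symmetric])
  moreover have "{u. T u = h} \<noteq> {}" using assms by auto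
  ultimately have "\<exists>x\<in>{u. T u = h}. \<forall>y\<in>{u. T u = h}. norm x \<le> norm y"
    by (rule closed_convex_min_norm)
  then obtain u where "T u = h" "\<And>v. T v = h \<Longrightarrow> norm u \<le> norm v" by auto
  then have "is_arg_min norm (\<lambda>u. T u = h) u" by (simp add: is_arg_min_linorder)
  then have "is_arg_min norm (\<lambda>u. T u = h) (pinv T h)"
    unfolding pinv_def arg_min_def by (rule someI)
  then have *: "T (pinv T h) = h" "\<And>v. T v = h \<Longrightarrow> norm (pinv T h) \<le> norm v"
    by (auto simp: is_arg_min_linorder)
  show "T (pinv T h) = h" by fact
  show "inner (pinv T h) v = 0" if "T v = 0"
    by (rule min_norm_orthogonal) (rule *(2), simp add: blinfun.bilinear_simps that *(1))
qed

text \<open>The kernel of a selfadjoint operator is orthogonal to its range, so the operator is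
  injective on the closure of the range.\<close>

lemma closure_range_eqI:
  fixes R :: "'a::real_inner \<Rightarrow>\<^sub>L 'a"
  assumes R: "nonneg_selfadjoint R"
    and "u \<in> closure (range R)" "v \<in> closure (range R)" "R u = R v"
  shows "u = v"
proof -
  have "subspace (range R)" by (intro subspace_UNIV linear_subspace_image bounded_linear.linear blinfun.bounded_linear_right)
  then have "u - v \<in> closure (range R)"
    using assms subspace_closure by (blast intro: subspace_diff)
  moreover have "closed {w. inner (u - v) w = 0}"
    by (intro closed_Collect_eq continuous_intros)
  moreover have "range R \<subseteq> {w. inner (u - v) w = 0}"
    using assms by (auto simp: nonneg_selfadjoint_inner[OF R, symmetric] blinfun.bilinear_simps)
  ultimately have "inner (u - v) (u - v) = 0" using closure_minimal by blast
  then show ?thesis by simp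
qed

text \<open>Let \<open>p\<close> be the projection of the minimal solution to the closed range. The
  residual is killed by \<open>R\<close>, hence orthogonal to the minimal solution as well as to
  \<open>p\<close>, hence to itself.\<close>

lemma pinv_in_closure_range:
  fixes R :: "'a::{real_inner,banach} \<Rightarrow>\<^sub>L 'a"
  assumes R: "nonneg_selfadjoint R" and h: "h \<in> range R"
  shows "pinv R h \<in> closure (range R)"
proof -
  have "subspace (closure (range R))"
    by (intro subspace_closure subspace_UNIV linear_subspace_image bounded_linear.linear blinfun.bounded_linear_right)
  then obtain p where p: "p \<in> closure (range R)"
    "\<And>v. v \<in> closure (range R) \<Longrightarrow> inner (pinv R h - p) v = 0"
    using closed_subspace_projection[OF closed_closure] by blast
  have "inner (R (pinv R h - p)) v = 0" for v
    using p(2)[of "R v"] closure_subset[of "range R"] by (auto simp: nonneg_selfadjoint_inner[OF R])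
  then have "R (pinv R h - p) = 0" using inner_eq_zero_iff by blast
  with h have "inner (pinv R h) (pinv R h - p) = 0" by (rule pinv(2))
  moreover have "inner p (pinv R h - p) = 0" using p by (simp add: inner_commute)
  ultimately have "inner (pinv R h - p) (pinv R h - p) = 0" by (simp only: inner_diff_left)
  with p(1) show ?thesis by simp
qed

lemma baire_interior:
  fixes C :: "nat \<Rightarrow> 'a::banach set"
  assumes "\<And>n. closed (C n)" "(\<Union>n. C n) = UNIV"
  obtains n where "interior (C n) \<noteq> {}"
proof (rule ccontr)
  assume "\<not> thesis"
  with that have "interior (C n) = {}" for n by blast
  then have "Met_TC.mtopology interior_of (\<Union>(range C)) = {}"
    using assms(1) by (intro Met_TC.metric_Baire_category_alt)
      (auto simp: Met_TC.mcomplete_def Cauchy_convergent_iff convergent_def)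
  then show False by (simp add: assms(2))
qed

text \<open>Uniform boundedness: the sets \<open>C n\<close> below are the sublevel sets of
  \<open>k \<mapsto> norm (pinv R (E k))\<close>, written so that they are visibly closed.\<close>

lemma bounded_linear_pinv_compose:
  fixes R :: "'a::{real_inner,banach} \<Rightarrow>\<^sub>L 'a" and E :: "'k::banach \<Rightarrow>\<^sub>L 'a"
  assumes R: "nonneg_selfadjoint R" and E: "range E \<subseteq> range R"
  shows "bounded_linear (\<lambda>k. pinv R (E k))"
proof -
  define \<Gamma> where "\<Gamma> k = pinv R (E k)" for k
  have Er: "E k \<in> range R" for k using E by blast
  have RG: "R (\<Gamma> k) = E k" and Gc: "\<Gamma> k \<in> closure (range R)" for k
    by (simp_all add: \<Gamma>_def pinv(1)[OF Er] pinv_in_closure_range[OF R Er])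
  have sub: "subspace (closure (range R))"
    by (intro subspace_closure subspace_UNIV linear_subspace_image bounded_linear.linear blinfun.bounded_linear_right)
  \<comment> \<open>Both sides lie in the closure of the range, where \<open>R\<close> is injective,
    so additivity is inherited from \<open>E\<close>.\<close>
  have add: "\<Gamma> (x + y) = \<Gamma> x + \<Gamma> y" for x y
    by (rule closure_range_eqI[OF R Gc subspace_add[OF sub Gc Gc]]) (simp add: RG blinfun.bilinear_simps)
  have scale: "\<Gamma> (c *\<^sub>R x) = c *\<^sub>R \<Gamma> x" for c x
    by (rule closure_range_eqI[OF R Gc subspace_scale[OF sub Gc]]) (simp add: RG blinfun.bilinear_simps)
  define C where "C n = {k. \<forall>g. \<bar>inner (E k) g\<bar> \<le> real n * norm (R g)}" for n :: nat
  have closed: "closed (C n)" for n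
    unfolding C_def by (intro closed_Collect_all closed_Collect_le continuous_intros)
  have CI: "k \<in> C n" if "norm (\<Gamma> k) \<le> real n" for k n
    unfolding C_def
  proof (intro CollectI allI)
    fix g
    have "\<bar>inner (E k) g\<bar> = \<bar>inner (\<Gamma> k) (R g)\<bar>"
      by (simp add: RG[symmetric] nonneg_selfadjoint_inner[OF R])
    also have "\<dots> \<le> norm (\<Gamma> k) * norm (R g)" by (rule Cauchy_Schwarz_ineq2)
    also have "\<dots> \<le> real n * norm (R g)" using that by (intro mult_right_mono) auto
    finally show "\<bar>inner (E k) g\<bar> \<le> real n * norm (R g)" .
  qed
  have CD: "norm (\<Gamma> k) \<le> real n" if k: "k \<in> C n" for k n
  proof -
    \<comment> \<open>The estimate is known for \<open>w\<close> in the range of \<open>R\<close>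
      and passes to its closure, which contains \<open>\<Gamma> k\<close> itself; testing with
      \<open>w = \<Gamma> k\<close> bounds its norm.\<close>
    have "closed {w. \<bar>inner (\<Gamma> k) w\<bar> \<le> real n * norm w}"
      by (intro closed_Collect_le continuous_intros)
    moreover have "range R \<subseteq> {w. \<bar>inner (\<Gamma> k) w\<bar> \<le> real n * norm w}"
      using k by (auto simp: C_def nonneg_selfadjoint_inner[OF R, symmetric] RG)
    ultimately have "\<bar>inner (\<Gamma> k) (\<Gamma> k)\<bar> \<le> real n * norm (\<Gamma> k)"
      using closure_minimal Gc by blast
    then have "norm (\<Gamma> k) * norm (\<Gamma> k) \<le> norm (\<Gamma> k) * real n"
      by (simp add: power2_norm_eq_inner[symmetric] power2_eq_square mult.commute)
    then show ?thesis by (rule square_le_mult_imp_le) simp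
  qed
  have "k \<in> (\<Union>n. C n)" for k
    using CI real_arch_simple[of "norm (\<Gamma> k)"] by blast
  then have "(\<Union>n. C n) = UNIV" by blast
  from baire_interior[OF closed this] obtain n where "interior (C n) \<noteq> {}" .
  then obtain k\<^sub>0 r where r: "r > 0" "ball k\<^sub>0 r \<subseteq> C n"
    by (metis all_not_in_conv mem_interior)
  \<comment> \<open>The ball supplied by the Baire argument need not be centred at 0; subtracting
    the value at its centre costs the factor 2.\<close>
  have unif: "norm (\<Gamma> k) \<le> 2 * real n" if "norm k < r" for k
  proof -
    have "k\<^sub>0 + k \<in> C n" "k\<^sub>0 \<in> C n" using r that by (auto simp: dist_norm)
    then have "norm (\<Gamma> (k\<^sub>0 + k)) \<le> n" "norm (\<Gamma> k\<^sub>0) \<le> n" using CD by auto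
    moreover have "\<Gamma> k = \<Gamma> (k\<^sub>0 + k) - \<Gamma> k\<^sub>0" by (simp add: add)
    ultimately show ?thesis using norm_triangle_ineq4[of "\<Gamma> (k\<^sub>0 + k)" "\<Gamma> k\<^sub>0"] by simp
  qed
  have "norm (\<Gamma> k) \<le> norm k * (4 * real n / r)" for k
  proof (cases "k = 0")
    case True
    then show ?thesis using scale[of 0 0] by simp
  next
    case False
    define c where "c = r / (2 * norm k)"
    have c: "c > 0" using False r by (simp add: c_def)
    have "norm (\<Gamma> (c *\<^sub>R k)) \<le> 2 * real n" using False r by (intro unif) (simp add: c_def)
    then have "c * norm (\<Gamma> k) \<le> 2 * real n" using c by (simp add: scale)
    then have "norm (\<Gamma> k) \<le> 2 * real n / c" using c by (simp add: field_simps)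
    then show ?thesis by (simp add: c_def mult_ac)
  qed
  then have "bounded_linear \<Gamma>"
    by (intro bounded_linear_intro[where K = "4 * real n / r"] add scale)
  then show ?thesis by (simp add: \<Gamma>_def[abs_def])
qed

section \<open>Orthonormal bases and Parseval's identity\<close>

definition orthonormal :: "'a::real_inner set \<Rightarrow> bool" where
  "orthonormal B \<longleftrightarrow> pairwise orthogonal B \<and> (\<forall>b\<in>B. norm b = 1)"

text \<open>A maximal orthonormal set is total: a point outside the closed span would leave a
  nonzero residual after projection, and its normalisation would enlarge the set.\<close>

lemma orthonormal_basis_exists:
  "\<exists>B. orthonormal_basis (B :: 'a::{real_inner,banach} set)"
proof -
  have "\<exists>B\<in>{B::'a set. orthonormal B}. \<forall>X\<in>{B. orthonormal B}. B \<subseteq> X \<longrightarrow> X = B"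
  proof (rule subset_Zorn')
    fix C :: "'a set set" assume C: "subset.chain {B. orthonormal B} C"
    have on: "orthonormal X" if "X \<in> C" for X using C that by (auto simp: subset.chain_def)
    have "orthogonal b c" if "X \<in> C" "Y \<in> C" "b \<in> X" "c \<in> Y" "b \<noteq> c" for b c X Y
    proof -
      have "X \<subseteq> Y \<or> Y \<subseteq> X" using C that(1,2) by (auto simp: subset.chain_def)
      then show ?thesis using on that unfolding orthonormal_def pairwise_def by blast
    qed
    then have "orthonormal (\<Union>C)"
      using on by (auto simp: orthonormal_def pairwise_def)
    then show "\<Union>C \<in> {B. orthonormal B}" by simp
  qed
  then obtain B :: "'a set" where B: "orthonormal B" "\<And>X. orthonormal X \<Longrightarrow> B \<subseteq> X \<Longrightarrow> X = B" by blast
  have "x \<in> closure (span B)" for x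
  proof -
    obtain p where p: "p \<in> closure (span B)"
      "\<And>v. v \<in> closure (span B) \<Longrightarrow> inner (x - p) v = 0"
      using closed_subspace_projection[OF closed_closure subspace_closure[OF subspace_span]] by blast
    show ?thesis
    proof (rule ccontr)
      assume "x \<notin> closure (span B)"
      with p have w: "x - p \<noteq> 0" by auto
      define e where "e = (1 / norm (x - p)) *\<^sub>R (x - p)"
      have eB: "inner e b = 0" if "b \<in> B" for b
        using that p(2)[of b] closure_subset[of "span B"] span_base[of b B] by (auto simp: e_def)
      have "orthonormal (insert e B)"
        using B(1) w eB
        by (auto simp: orthonormal_def pairwise_insert orthogonal_def inner_commute e_def)
      with B(2) have "e \<in> B" by blast
      with eB have "inner e e = 0" by blast
      with w show False by (simp add: e_def)
    qed
  qed
  with B(1) show ?thesis unfolding orthonormal_basis_def orthonormal_def by blast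
qed

text \<open>Weaker than being an orthonormal basis: zero vectors may occur, so spaces of finite
  dimension have such a sequence too.\<close>

definition parseval :: "(nat \<Rightarrow> 'a::real_inner) \<Rightarrow> bool" where
  "parseval e \<longleftrightarrow> (\<forall>x. (\<lambda>n. (inner x (e n))\<^sup>2) sums (norm x)\<^sup>2)"

text \<open>The partial sum \<open>s n\<close> is the best approximation of \<open>x\<close> from
  the span of the first \<open>n\<close> vectors, so density drives the residual to 0; by
  orthogonality its squared norm is the defect in Parseval's identity.\<close>

lemma parseval_orthogonal_sequence:
  fixes e :: "nat \<Rightarrow> 'a::real_inner"
  assumes orth: "\<And>i j. i \<noteq> j \<Longrightarrow> inner (e i) (e j) = 0" and one: "\<And>i. e i = 0 \<or> norm (e i) = 1"
    and dense: "closure (span (range e)) = UNIV"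
  shows "parseval e"
  unfolding parseval_def
proof
  fix x
  define s where "s n = (\<Sum>i<n. inner x (e i) *\<^sub>R e i)" for n :: nat
  have inn: "inner (s n) (e i) = (if i < n then inner x (e i) else 0)" for n i
  proof -
    have "inner (s n) (e i) = (\<Sum>j<n. if j = i then inner x (e i) * (norm (e i))\<^sup>2 else 0)"
      unfolding s_def inner_sum_left
      by (intro sum.cong) (auto simp: orth power2_norm_eq_inner)
    also have "\<dots> = (if i < n then inner x (e i) else 0)"
      using one[of i] by auto
    finally show ?thesis .
  qed
  have perp: "inner (x - s n) y = 0" if "y \<in> span (e ` {..<n})" for y n
    using that by (induction rule: span_induct_alt) (auto simp: inner_simps inn)
  have s_span: "s n \<in> span (e ` {..<n})" for n
    unfolding s_def by (intro span_sum span_scale span_base) auto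
  have norm_s: "(norm (x - s n))\<^sup>2 = (norm x)\<^sup>2 - (\<Sum>i<n. (inner x (e i))\<^sup>2)" for n
  proof -
    have "inner (x - s n) (s n) = 0" by (rule perp[OF s_span])
    then have "(norm (x - s n))\<^sup>2 = inner (x - s n) x"
      by (simp add: power2_norm_eq_inner inner_diff_right)
    also have "\<dots> = inner x x - inner x (s n)"
      by (simp only: inner_diff_left inner_commute[of "s n" x])
    also have "inner x (s n) = (\<Sum>i<n. (inner x (e i))\<^sup>2)"
      by (simp add: s_def inner_sum_right power2_eq_square)
    finally show ?thesis by (simp add: power2_norm_eq_inner)
  qed
  have best: "norm (x - s n) \<le> norm (x - y)" if "y \<in> span (e ` {..<n})" for y n
  proof -
    have "inner (x - s n) (s n - y) = 0" by (intro perp span_diff s_span that)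
    then have "(norm (x - y))\<^sup>2 = (norm (x - s n))\<^sup>2 + (norm (s n - y))\<^sup>2"
      using norm_add_Pythagorean[of "x - s n" "s n - y"] by (simp add: orthogonal_def)
    then have "(norm (x - s n))\<^sup>2 \<le> (norm (x - y))\<^sup>2" by simp
    then show ?thesis by (rule power2_le_imp_le) simp
  qed
  have "(\<lambda>n. norm (x - s n)) \<longlonglongrightarrow> 0"
  proof (rule LIMSEQ_I)
    fix r :: real assume "r > 0"
    moreover have "x \<in> closure (span (range e))" using dense by simp
    ultimately obtain y where y: "y \<in> span (range e)" "dist y x < r"
      unfolding closure_approachable by blast
    have "\<exists>N. y \<in> span (e ` {..<N})" using y(1)
    proof (induction rule: span_induct_alt)
      case base
      show ?case using span_zero by blast
    next
      case (step c a z)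
      then obtain N k where N: "z \<in> span (e ` {..<N})" "a = e k" by blast
      then have "z \<in> span (e ` {..<max N (Suc k)})" "a \<in> span (e ` {..<max N (Suc k)})"
        using span_mono[OF image_mono[of "{..<N}" "{..<max N (Suc k)}" e]]
        by (auto intro: span_base)
      then show ?case by (blast intro: span_add span_scale)
    qed
    then obtain N where N: "y \<in> span (e ` {..<N})" by blast
    have "norm (norm (x - s n) - 0) < r" if "n \<ge> N" for n
    proof -
      have "y \<in> span (e ` {..<n})" using N that by (auto intro: span_mono[THEN subsetD, rotated])
      from best[OF this] y(2) show ?thesis by (simp add: dist_norm norm_minus_commute)
    qed
    then show "\<exists>N. \<forall>n\<ge>N. norm (norm (x - s n) - 0) < r" by blast
  qed
  then have "(\<lambda>n. (norm x)\<^sup>2 - (norm (x - s n))\<^sup>2) \<longlonglongrightarrow> (norm x)\<^sup>2 - 0\<^sup>2"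
    by (intro tendsto_intros)
  then show "(\<lambda>n. (inner x (e n))\<^sup>2) sums (norm x)\<^sup>2"
    by (simp add: sums_def norm_s)
qed

text \<open>Distinct basis vectors are at distance \<open>sqrt 2\<close>, so balls of radius 1/2
  about them are disjoint, and a second countable space has only countably many disjoint nonempty
  open sets.\<close>

lemma countable_orthonormal_basis:
  fixes B :: "'a::{real_inner,second_countable_topology} set"
  assumes "orthonormal_basis B"
  shows "countable B"
proof -
  have B: "norm b = 1" "c \<in> B \<Longrightarrow> b \<noteq> c \<Longrightarrow> inner b c = 0" if "b \<in> B" for b c
    using assms that by (auto simp: orthonormal_basis_def pairwise_def orthogonal_def)
  have far: "dist b c > 1" if "b \<in> B" "c \<in> B" "b \<noteq> c" for b c
  proof -
    have "orthogonal b (- c)" using B that by (simp add: orthogonal_def)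
    from norm_add_Pythagorean[OF this] have "(dist b c)\<^sup>2 = 2"
      using B that by (simp add: dist_norm)
    then show ?thesis by (intro power_less_imp_less_base[of 1 2]) auto
  qed
  have "inj_on (\<lambda>b. ball b (1/2)) B"
  proof (rule inj_onI, rule ccontr)
    fix b c assume bc: "b \<in> B" "c \<in> B" "ball b (1/2) = ball c (1/2)" "b \<noteq> c"
    then have "b \<in> ball c (1/2)" by (metis centre_in_ball half_gt_zero_iff zero_less_one)
    with far[of c b] bc show False by auto
  qed
  moreover have "countable ((\<lambda>b. ball b (1/2)) ` B)"
  proof (rule countable_disjoint_open_subsets)
    show "pairwise disjnt ((\<lambda>b. ball b (1/2)) ` B)"
    proof (intro pairwise_imageI)
      fix b c assume "b \<in> B" "c \<in> B" "b \<noteq> c"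
      with far[of b c] show "disjnt (ball b (1/2)) (ball c (1/2))"
        by (auto simp: disjnt_iff) (smt (verit) dist_triangle dist_commute field_sum_of_halves)
    qed
  qed auto
  ultimately show ?thesis by (rule countable_image_inj_on[rotated])
qed

lemma orthonormal_basis_sequence:
  fixes B :: "'a::{real_inner,second_countable_topology} set"
  assumes B: "orthonormal_basis B"
  obtains e where "parseval e"
    "\<And>f s. f 0 = (0::real) \<Longrightarrow> (f has_sum s) B \<Longrightarrow> (\<lambda>n. f (e n)) sums s"
proof -
  have cB: "countable B" by (rule countable_orthonormal_basis[OF B])
  define I where "I = to_nat_on B ` B"
  define e where "e n = (if n \<in> I then from_nat_into B n else 0)" for n
  have eI: "e (to_nat_on B b) = b" if "b \<in> B" for b
    using that cB by (simp add: e_def I_def)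
  have eB: "e n \<in> B" "to_nat_on B (e n) = n" if "n \<in> I" for n
    using that eI by (auto simp: I_def)
  have BD: "norm b = 1" "c \<in> B \<Longrightarrow> b \<noteq> c \<Longrightarrow> inner b c = 0" if "b \<in> B" for b c
    using B that by (auto simp: orthonormal_basis_def pairwise_def orthogonal_def)
  have "parseval e"
  proof (rule parseval_orthogonal_sequence)
    show "inner (e i) (e j) = 0" if "i \<noteq> j" for i j
    proof (cases "i \<in> I \<and> j \<in> I")
      case True
      then show ?thesis using eB[of i] eB[of j] that BD(2)[of "e i" "e j"] by metis
    qed (auto simp: e_def)
    show "e i = 0 \<or> norm (e i) = 1" for i
      using eB[of i] BD(1) by (cases "i \<in> I") (auto simp: e_def)
    have "B \<subseteq> range e" using eI by (metis rangeI subsetI)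
    then have "closure (span B) \<subseteq> closure (span (range e))" by (intro closure_mono span_mono)
    then show "closure (span (range e)) = UNIV" using B by (auto simp: orthonormal_basis_def)
  qed
  moreover have "(\<lambda>n. f (e n)) sums s" if "f 0 = (0::real)" "(f has_sum s) B" for f s
  proof -
    have "bij_betw e I B"
      by (rule bij_betwI[where g = "to_nat_on B"]) (use eB eI in \<open>auto simp: I_def\<close>)
    then have "((\<lambda>n. f (e n)) has_sum s) I"
      using that(2) by (simp add: has_sum_reindex_bij_betw)
    then have "((\<lambda>n. f (e n)) has_sum s) UNIV"
      by (rule has_sum_cong_neutral[THEN iffD1, rotated -1]) (auto simp: e_def that)
    then show ?thesis by (rule has_sum_imp_sums)
  qed
  ultimately show ?thesis by (rule that)
qed

lemma parseval_exists: "\<exists>e :: nat \<Rightarrow> 'a::{real_inner,banach,second_countable_topology}. parseval e"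
  using orthonormal_basis_exists orthonormal_basis_sequence by metis

section \<open>Fourier transforms of measures on a Hilbert space\<close>

abbreviation std_normal_sequence :: "(nat \<Rightarrow> real) measure" where
  "std_normal_sequence \<equiv> \<Pi>\<^sub>M i\<in>UNIV. std_normal_distribution"

lemma prob_space_std_normal: "prob_space std_normal_distribution"
  by (rule prob_space_normal_density) simp

lemma prob_space_std_normal_sequence: "prob_space std_normal_sequence"
  by (intro prob_space_PiM prob_space_std_normal)

lemma measurable_std_normal_sequence[measurable]:
  "(\<lambda>\<omega>. \<omega> i) \<in> borel_measurable std_normal_sequence"
  using measurable_component_singleton[of i UNIV "\<lambda>_. std_normal_distribution"] by simp

lemma std_normal_iexp:
  "(\<integral>x. iexp (a * x) \<partial>std_normal_distribution) = exp (- complex_of_real (a\<^sup>2) / 2)"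
  using char_std_normal_distribution[THEN fun_cong, of a]
  by (simp add: char_def of_real_exp)

lemma std_normal_sequence_iexp:
  "(\<integral>\<omega>. iexp (\<Sum>i<n. a i * \<omega> i) \<partial>std_normal_sequence) = exp (- complex_of_real (\<Sum>i<n. (a i)\<^sup>2) / 2)"
proof -
  interpret prob_space std_normal_sequence by (rule prob_space_std_normal_sequence)
  have distr: "distr std_normal_sequence std_normal_distribution (\<lambda>\<omega>. \<omega> i) = std_normal_distribution" for i
    by (rule distr_PiM_component) (auto intro: prob_space_std_normal)
  have "indep_vars (\<lambda>_. std_normal_distribution) (\<lambda>i \<omega>. \<omega> i) UNIV"
    by (subst indep_vars_iff_distr_eq_PiM') (auto simp: distr intro!: distr_id2 simp: restrict_UNIV)
  then have "indep_vars (\<lambda>_. borel) (\<lambda>i \<omega>. a i * \<omega> i) UNIV"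
    by (rule indep_vars_compose2) simp
  then have indep: "indep_vars (\<lambda>_. borel) (\<lambda>i \<omega>. a i * \<omega> i) {..<n}"
    by (rule indep_vars_subset) simp
  have "char (distr std_normal_sequence borel (\<lambda>\<omega>. a i * \<omega> i)) 1 = exp (- complex_of_real ((a i)\<^sup>2) / 2)" for i
  proof -
    have "char (distr std_normal_sequence borel (\<lambda>\<omega>. a i * \<omega> i)) 1
        = (\<integral>\<omega>. iexp (a i * \<omega> i) \<partial>std_normal_sequence)"
      by (simp add: char_def integral_distr)
    also have "\<dots> = (\<integral>x. iexp (a i * x) \<partial>distr std_normal_sequence std_normal_distribution (\<lambda>\<omega>. \<omega> i))"
      by (subst integral_distr) auto
    finally show ?thesis unfolding distr std_normal_iexp .
  qed
  with char_distr_sum[OF indep, of 1]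
  have "char (distr std_normal_sequence borel (\<lambda>\<omega>. \<Sum>i<n. a i * \<omega> i)) 1
      = exp (- complex_of_real (\<Sum>i<n. (a i)\<^sup>2) / 2)"
    by (simp add: exp_sum[symmetric] sum_divide_distrib sum_negf)
  then show ?thesis by (simp add: char_def integral_distr)
qed

lemma open_countable_Union_balls:
  fixes S :: "'a::{metric_space,second_countable_topology} set"
  assumes "open S"
  obtains a r where "S = (\<Union>i::nat. ball (a i) (r i))"
proof -
  define F where "F = insert {} {ball a r | a r. ball a r \<subseteq> S}"
  have F: "\<Union>F = S"
  proof
    show "S \<subseteq> \<Union>F"
    proof
      fix x assume "x \<in> S"
      with assms obtain r where r: "r > 0" "ball x r \<subseteq> S" by (meson open_contains_ball)
      have "ball x r \<in> F"
        unfolding F_def by (rule insertI2, rule CollectI, rule exI[of _ x], rule exI[of _ r], simp add: r(2))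
      moreover have "x \<in> ball x r" using r by simp
      ultimately show "x \<in> \<Union>F" by (rule UnionI)
    qed
  qed (auto simp: F_def)
  obtain F' where F': "F' \<subseteq> F" "countable F'" "\<Union>F' = \<Union>F"
    by (rule Lindelof[of F]) (auto simp: F_def)
  \<comment> \<open>\<open>from_nat_into\<close> needs a nonempty set, hence the inserted empty set,
    which is later written as a ball of radius 0.\<close>
  define F'' where "F'' = insert {} F'"
  have F'': "countable F''" "F'' \<noteq> {}" "\<Union>F'' = S" "F'' \<subseteq> F"
    using F' F by (auto simp: F''_def F_def)
  have "\<exists>a r. from_nat_into F'' i = ball a r" for i
  proof -
    have "from_nat_into F'' i \<in> F" by (rule subsetD[OF F''(4) from_nat_into[OF F''(2)]])
    then consider "from_nat_into F'' i = {}" | a r where "from_nat_into F'' i = ball a r"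
      unfolding F_def by auto
    then show ?thesis
    proof cases
      case 1
      then have "from_nat_into F'' i = ball undefined 0" by simp
      then show ?thesis by blast
    qed blast
  qed
  then obtain a r where ar: "\<And>i. from_nat_into F'' i = ball (a i) (r i)" by metis
  have "S = (\<Union>i. from_nat_into F'' i)" using F'' by (metis range_from_nat_into)
  then show ?thesis using that ar by auto
qed

text \<open>Pettis' theorem: by Parseval, distances are measurable, and so are preimages of balls.\<close>

lemma borel_measurable_hilbertI:
  fixes f :: "'x \<Rightarrow> 'a::{real_inner,banach,second_countable_topology}"
  assumes "\<And>y. (\<lambda>x. inner (f x) y) \<in> borel_measurable M"
  shows "f \<in> borel_measurable M"
proof (rule borel_measurableI)
  obtain e :: "nat \<Rightarrow> 'a" where e: "parseval e" using parseval_exists by blast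
  have [measurable]: "(\<lambda>x. norm (f x - a)) \<in> borel_measurable M" for a
  proof -
    have "norm (f x - a) = sqrt (\<Sum>n. (inner (f x) (e n) - inner a (e n))\<^sup>2)" for x
      using e by (simp add: parseval_def sums_iff inner_diff_left[symmetric])
    then show ?thesis using assms by simp
  qed
  fix S :: "'a set" assume "open S"
  then obtain a r where S: "S = (\<Union>i::nat. ball (a i) (r i))" by (rule open_countable_Union_balls)
  have "f -` S \<inter> space M = (\<Union>i. {x \<in> space M. norm (f x - a i) < r i})"
    by (auto simp: S dist_norm norm_minus_commute)
  also have "\<dots> \<in> sets M" by measurable
  finally show "f -` S \<inter> space M \<in> sets M" .
qed

section \<open>Measures with equal Fourier transforms coincide\<close>

definition bump :: "real \<Rightarrow> 'a::real_normed_vector \<Rightarrow> 'a \<Rightarrow> real" where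
  "bump s a y = exp (- (s * norm (y - a))\<^sup>2 / 2)"

lemma bump_bounds: "0 < bump s a y" "bump s a y \<le> 1"
  by (auto simp: bump_def)

lemma borel_measurable_bump[measurable]: "bump s a \<in> borel_measurable borel"
  unfolding bump_def[abs_def] by (intro borel_measurable_continuous_onI continuous_intros) auto

text \<open>Completing the square: the new centre is the mean of the old ones with weights
  \<open>s\<^sup>2\<close> and \<open>s'\<^sup>2\<close>. Up to constants the bumps are thus closed
  under products. Two flat bumps are separate, as their total weight vanishes.\<close>

lemma bump_mult:
  fixes a a' :: "'a::real_inner"
  obtains K s'' a'' where "\<And>y. bump s a y * bump s' a' y = K * bump s'' a'' y"
proof (cases "s = 0 \<and> s' = 0")
  case True
  then show ?thesis using that[of 1 0 0] by (simp add: bump_def)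
next
  case False
  define q where "q = s\<^sup>2 + s'\<^sup>2"
  define a'' where "a'' = (1 / q) *\<^sub>R (s\<^sup>2 *\<^sub>R a + s'\<^sup>2 *\<^sub>R a')"
  have q: "q > 0" using False by (auto simp: q_def sum_power2_gt_zero_iff)
  have qa: "q * inner y a'' = s\<^sup>2 * inner y a + s'\<^sup>2 * inner y a'" for y
    using q by (simp add: a''_def inner_add_right)
  define K where "K = s\<^sup>2 * inner a a + s'\<^sup>2 * inner a' a' - q * inner a'' a''"
  have sq: "(c * norm (y - b))\<^sup>2 = c\<^sup>2 * inner y y - 2 * (c\<^sup>2 * inner y b) + c\<^sup>2 * inner b b"
    for c and y b :: 'a
    by (simp add: power_mult_distrib power2_norm_eq_inner inner_diff_left inner_diff_right
        inner_commute algebra_simps)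
  have "(s * norm (y - a))\<^sup>2 + (s' * norm (y - a'))\<^sup>2 = K + (sqrt q * norm (y - a''))\<^sup>2" for y
    using q unfolding sq K_def by (simp add: qa) (simp add: q_def algebra_simps)
  then have "- (s * norm (y - a))\<^sup>2 / 2 + - (s' * norm (y - a'))\<^sup>2 / 2
      = - K / 2 + - (sqrt q * norm (y - a''))\<^sup>2 / 2" for y
    by (simp only: add_divide_distrib[symmetric] minus_add_distrib[symmetric])
  then have "bump s a y * bump s' a' y = exp (- K / 2) * bump (sqrt q) a'' y" for y
    unfolding bump_def exp_add[symmetric] by simp
  then show ?thesis by (rule that)
qed

text \<open>A bump is a superposition of characters: integrate \<open>iexp (\<Sum>k<n. s * inner (y - a) (e k) * \<omega> k)\<close>
  over a Gaussian sequence \<open>\<omega>\<close>, use Fubini, and let \<open>n\<close> tend to infinity.\<close>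

lemma integral_bump_eq:
  fixes M N :: "'a::{real_inner,banach,second_countable_topology} measure"
  assumes M: "prob_space M" "sets M = sets borel" and N: "prob_space N" "sets N = sets borel"
    and eq: "\<And>h. (\<integral>y. iexp (inner h y) \<partial>M) = (\<integral>y. iexp (inner h y) \<partial>N)"
  shows "(\<integral>y. bump s a y \<partial>M) = (\<integral>y. bump s a y \<partial>N)"
proof -
  obtain e :: "nat \<Rightarrow> 'a" where e: "parseval e" using parseval_exists by blast
  define p where "p n y = (\<Sum>k<n. (s * inner (y - a) (e k))\<^sup>2)" for n y
  define h where "h n \<omega> = (\<Sum>k<n. (s * \<omega> k) *\<^sub>R e k)" for n and \<omega> :: "nat \<Rightarrow> real"
  have fub: "complex_of_real (\<integral>y. exp (- p n y / 2) \<partial>L) =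
      (\<integral>\<omega>. iexp (- inner (h n \<omega>) a) * (\<integral>y. iexp (inner (h n \<omega>) y) \<partial>L) \<partial>std_normal_sequence)"
    if L: "prob_space L" "sets L = sets borel" for L n
  proof -
    interpret L: prob_space L by fact
    interpret G: prob_space std_normal_sequence by (rule prob_space_std_normal_sequence)
    interpret pair_prob_space L std_normal_sequence ..
    note L(2)[measurable_cong]
    define f where "f y \<omega> = iexp (\<Sum>k<n. s * inner (y - a) (e k) * \<omega> k)" for y and \<omega> :: "nat \<Rightarrow> real"
    have f: "f y \<omega> = iexp (- inner (h n \<omega>) a) * iexp (inner (h n \<omega>) y)" for y \<omega>
    proof -
      have hz: "inner (h n \<omega>) z = (\<Sum>k<n. s * inner z (e k) * \<omega> k)" for z
        unfolding h_def inner_sum_left by (intro sum.cong) (auto simp: inner_commute)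
      have "(\<Sum>k<n. s * inner (y - a) (e k) * \<omega> k) = - inner (h n \<omega>) a + inner (h n \<omega>) y"
        unfolding hz by (simp add: sum_subtractf[symmetric] inner_diff_left algebra_simps)
      then show ?thesis by (simp only: f_def exp_add[symmetric] of_real_add distrib_left)
    qed
    have int: "integrable (L \<Otimes>\<^sub>M std_normal_sequence) (\<lambda>(y, \<omega>). f y \<omega>)"
      unfolding f_def by (rule P.integrable_const_bound[where B = 1]) auto
    have "complex_of_real (\<integral>y. exp (- p n y / 2) \<partial>L) = (\<integral>y. complex_of_real (exp (- p n y / 2)) \<partial>L)"
      by simp
    also have "\<dots> = (\<integral>y. (\<integral>\<omega>. f y \<omega> \<partial>std_normal_sequence) \<partial>L)"
      unfolding f_def std_normal_sequence_iexp by (simp add: p_def of_real_exp)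
    also have "\<dots> = (\<integral>\<omega>. (\<integral>y. f y \<omega> \<partial>L) \<partial>std_normal_sequence)"
      using Fubini_integral[OF int] by simp
    finally show ?thesis by (simp add: f)
  qed
  have lim: "(\<lambda>n. \<integral>y. exp (- p n y / 2) \<partial>L) \<longlonglongrightarrow> (\<integral>y. bump s a y \<partial>L)"
    if L: "prob_space L" "sets L = sets borel" for L
  proof -
    interpret L: prob_space L by fact
    note L(2)[measurable_cong]
    show ?thesis
    proof (rule integral_dominated_convergence[where w = "\<lambda>_. 1"])
      show "(\<lambda>y. exp (- p n y / 2)) \<in> borel_measurable L" for n unfolding p_def by measurable
      have "(\<lambda>n. p n y) \<longlonglongrightarrow> (s * norm (y - a))\<^sup>2" for y
        using sums_mult[OF e[unfolded parseval_def, rule_format, of "y - a"], of "s\<^sup>2"]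
        by (simp add: sums_def p_def power_mult_distrib)
      then show "AE y in L. (\<lambda>n. exp (- p n y / 2)) \<longlonglongrightarrow> bump s a y"
        unfolding bump_def by (intro AE_I2 tendsto_intros) auto
      show "AE y in L. norm (exp (- p n y / 2)) \<le> 1" for n
        by (auto simp: p_def sum_nonneg)
    qed auto
  qed
  have "(\<integral>y. exp (- p n y / 2) \<partial>M) = (\<integral>y. exp (- p n y / 2) \<partial>N)" for n
  proof -
    have "complex_of_real (\<integral>y. exp (- p n y / 2) \<partial>M) = complex_of_real (\<integral>y. exp (- p n y / 2) \<partial>N)"
      unfolding fub[OF M] fub[OF N] eq ..
    then show ?thesis by (simp only: of_real_eq_iff)
  qed
  then show ?thesis using lim[OF M] lim[OF N] LIMSEQ_unique by simp
qed

locale equal_char_functionals =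
  fixes M N :: "'a::{real_inner,banach,second_countable_topology} measure"
  assumes M: "prob_space M" "sets M = sets borel" and N: "prob_space N" "sets N = sets borel"
    and eq: "\<And>h. (\<integral>y. iexp (inner h y) \<partial>M) = (\<integral>y. iexp (inner h y) \<partial>N)"
begin

text \<open>Testing against all bumps, instead of merely comparing the integrals of
  \<open>f\<close>, makes the class stable under multiplication by a bump, and so by polynomials in
  a bump.\<close>

definition good :: "('a \<Rightarrow> real) \<Rightarrow> bool" where
  "good f \<longleftrightarrow> f \<in> borel_measurable borel \<and> (\<exists>C. \<forall>y. \<bar>f y\<bar> \<le> C) \<and>
    (\<forall>s a. (\<integral>y. f y * bump s a y \<partial>M) = (\<integral>y. f y * bump s a y \<partial>N))"

sublocale M: prob_space M by (rule M)
sublocale N: prob_space N by (rule N)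

lemmas [measurable_cong] = M(2) N(2)

lemma bump_integrable:
  assumes [measurable]: "f \<in> borel_measurable borel" and "\<And>y. \<bar>f y\<bar> \<le> C"
  shows "integrable M (\<lambda>y. f y * bump s a y)" "integrable N (\<lambda>y. f y * bump s a y)"
proof -
  have *: "\<bar>f y * bump s a y\<bar> \<le> C" for y
    unfolding abs_mult using assms(2)[of y] bump_bounds[of s a y]
    by (intro order_trans[OF mult_left_le]) auto
  show "integrable M (\<lambda>y. f y * bump s a y)"
    by (rule M.integrable_const_bound[where B = C]) (auto simp: *)
  show "integrable N (\<lambda>y. f y * bump s a y)"
    by (rule N.integrable_const_bound[where B = C]) (auto simp: *)
qed

lemma good_1: "good (\<lambda>_. 1)"
  using integral_bump_eq[OF M N eq] by (auto simp: good_def)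

lemma good_bump: "good f \<Longrightarrow> good (\<lambda>y. f y * bump s a y)"
  unfolding good_def
proof (elim conjE exE, intro conjI allI)
  fix C assume [measurable]: "f \<in> borel_measurable borel" and C: "\<forall>y. \<bar>f y\<bar> \<le> C"
    and eq: "\<forall>s a. (\<integral>y. f y * bump s a y \<partial>M) = (\<integral>y. f y * bump s a y \<partial>N)"
  show "(\<lambda>y. f y * bump s a y) \<in> borel_measurable borel" by measurable
  have "\<bar>f y * bump s a y\<bar> \<le> C" for y
    unfolding abs_mult using C[rule_format, of y] bump_bounds[of s a y]
    by (intro order_trans[OF mult_left_le]) auto
  then show "\<exists>C. \<forall>y. \<bar>f y * bump s a y\<bar> \<le> C" by blast
  fix s' a'
  obtain K s'' a'' where K: "\<And>y. bump s a y * bump s' a' y = K * bump s'' a'' y"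
    using bump_mult by blast
  have *: "f y * bump s a y * bump s' a' y = K * (f y * bump s'' a'' y)" for y
    using K[of y] by (metis mult.assoc mult.left_commute)
  show "(\<integral>y. f y * bump s a y * bump s' a' y \<partial>M) = (\<integral>y. f y * bump s a y * bump s' a' y \<partial>N)"
    unfolding * using eq by simp
qed

lemma good_cmult: "good f \<Longrightarrow> good (\<lambda>y. c * f y)"
  unfolding good_def
proof (elim conjE exE, intro conjI allI)
  fix C s a assume [measurable]: "f \<in> borel_measurable borel" and C: "\<forall>y. \<bar>f y\<bar> \<le> C"
    and eq: "\<forall>s a. (\<integral>y. f y * bump s a y \<partial>M) = (\<integral>y. f y * bump s a y \<partial>N)"
  show "(\<lambda>y. c * f y) \<in> borel_measurable borel" by measurable
  have "\<bar>c * f y\<bar> \<le> \<bar>c\<bar> * C" for y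
    unfolding abs_mult using C by (intro mult_left_mono) auto
  then show "\<exists>C. \<forall>y. \<bar>c * f y\<bar> \<le> C" by blast
  show "(\<integral>y. c * f y * bump s a y \<partial>M) = (\<integral>y. c * f y * bump s a y \<partial>N)"
    using eq by (simp add: mult.assoc)
qed

lemma good_add:
  assumes f: "good f" and g: "good g"
  shows "good (\<lambda>y. f y + g y)"
  unfolding good_def
proof (intro conjI allI)
  from f g obtain C D where [measurable]: "f \<in> borel_measurable borel" "g \<in> borel_measurable borel"
    and C: "\<And>y. \<bar>f y\<bar> \<le> C" and D: "\<And>y. \<bar>g y\<bar> \<le> D"
    by (auto simp: good_def)
  show "(\<lambda>y. f y + g y) \<in> borel_measurable borel" by measurable
  have "\<bar>f y + g y\<bar> \<le> C + D" for y using C[of y] D[of y] by linarith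
  then show "\<exists>C. \<forall>y. \<bar>f y + g y\<bar> \<le> C" by blast
  show "(\<integral>y. (f y + g y) * bump s a y \<partial>M) = (\<integral>y. (f y + g y) * bump s a y \<partial>N)" for s a
    using f g bump_integrable[of f C s a] bump_integrable[of g D s a] C D
    by (simp add: distrib_right good_def)
qed

lemma good_sum: "(\<And>i. i \<in> I \<Longrightarrow> good (f i)) \<Longrightarrow> good (\<lambda>y. \<Sum>i\<in>I. f i y)"
proof (induction I rule: infinite_finite_induct)
  case empty
  show ?case using good_cmult[OF good_1, of 0] by simp
next
  case infinite
  then show ?case using good_cmult[OF good_1, of 0] by simp
next
  case (insert i I)
  then show ?case using good_add[of "f i"] by simp
qed

lemma good_minus: "good f \<Longrightarrow> good g \<Longrightarrow> good (\<lambda>y. f y - g y)"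
  using good_add[of f "\<lambda>y. - 1 * g y"] good_cmult[of g "- 1"] by simp

lemma good_lim:
  assumes good: "\<And>n. good (f n)" and C: "\<And>n y. \<bar>f n y\<bar> \<le> C" and lim: "\<And>y. (\<lambda>n. f n y) \<longlonglongrightarrow> g y"
  shows "good g"
  unfolding good_def
proof (intro conjI allI)
  have [measurable]: "f n \<in> borel_measurable borel" for n using good by (simp add: good_def)
  show gm[measurable]: "g \<in> borel_measurable borel"
    by (rule borel_measurable_LIMSEQ_real[OF lim]) auto
  have gC: "\<bar>g y\<bar> \<le> C" for y
    by (rule LIMSEQ_le_const2[OF tendsto_rabs[OF lim]]) (use C in blast)
  then show "\<exists>C. \<forall>y. \<bar>g y\<bar> \<le> C" by blast
  fix s a
  have *: "\<bar>f n y * bump s a y\<bar> \<le> C" for n y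
    unfolding abs_mult using C[of n y] bump_bounds[of s a y]
    by (intro order_trans[OF mult_left_le]) auto
  have "(\<lambda>n. \<integral>y. f n y * bump s a y \<partial>M) \<longlonglongrightarrow> (\<integral>y. g y * bump s a y \<partial>M)"
    by (rule integral_dominated_convergence[where w = "\<lambda>_. C"])
      (auto simp: * intro!: tendsto_intros lim)
  moreover have "(\<lambda>n. \<integral>y. f n y * bump s a y \<partial>N) \<longlonglongrightarrow> (\<integral>y. g y * bump s a y \<partial>N)"
    by (rule integral_dominated_convergence[where w = "\<lambda>_. C"])
      (auto simp: * intro!: tendsto_intros lim)
  moreover have "(\<integral>y. f n y * bump s a y \<partial>M) = (\<integral>y. f n y * bump s a y \<partial>N)" for n
    using good by (simp add: good_def)
  ultimately show "(\<integral>y. g y * bump s a y \<partial>M) = (\<integral>y. g y * bump s a y \<partial>N)"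
    using LIMSEQ_unique by simp
qed

lemma good_bounded: "good f \<Longrightarrow> \<exists>C\<ge>0. \<forall>y. \<bar>f y\<bar> \<le> C"
  unfolding good_def by (meson abs_ge_zero order_trans)

text \<open>A bump takes values in the unit interval, where Bernstein polynomials approximate
  \<open>\<psi>\<close> uniformly; polynomials in a bump preserve goodness, and bounded pointwise
  limits do as well.\<close>

lemma good_continuous_bump:
  assumes f: "good f" and \<psi>: "continuous_on {0..1} \<psi>"
  shows "good (\<lambda>y. f y * \<psi> (bump s a y))"
proof -
  have pow: "good (\<lambda>y. f y * bump s a y ^ k * (1 - bump s a y) ^ l)" for k l
  proof -
    have k: "good (\<lambda>y. f y * bump s a y ^ k)" for k
    proof (induction k)
      case (Suc k)
      from good_bump[OF this, of s a] show ?case by (simp add: mult_ac)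
    qed (simp add: f)
    show ?thesis
    proof (induction l)
      case (Suc l)
      from good_minus[OF this good_bump[OF this, of s a]] show ?case by (simp add: algebra_simps)
    qed (simp add: k)
  qed
  have bern: "good (\<lambda>y. f y * (\<Sum>k\<le>n. \<psi> (k/n) * Bernstein n k (bump s a y)))" for n
  proof -
    have "good (\<lambda>y. \<Sum>k\<le>n. (\<psi> (k/n) * (n choose k)) * (f y * bump s a y ^ k * (1 - bump s a y) ^ (n - k)))"
      by (intro good_sum good_cmult pow)
    then show ?thesis by (simp add: Bernstein_def sum_distrib_left mult_ac)
  qed
  have "\<exists>n. \<forall>x\<in>{0..1}. \<bar>\<psi> x - (\<Sum>k\<le>n. \<psi> (k/n) * Bernstein n k x)\<bar> < 1 / (real j + 1)" for j
    using Bernstein_Weierstrass[OF \<psi>, of "1 / (real j + 1)"] by fastforce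
  then have "\<forall>j. \<exists>n. \<forall>x\<in>{0..1}. \<bar>\<psi> x - (\<Sum>k\<le>n. \<psi> (k/n) * Bernstein n k x)\<bar> < 1 / (real j + 1)"
    by (rule allI)
  from choice[OF this] obtain n where n0: "\<forall>j. \<forall>x\<in>{0..1}.
      \<bar>\<psi> x - (\<Sum>k\<le>n j. \<psi> (k/n j) * Bernstein (n j) k x)\<bar> < 1 / (real j + 1)" by (rule exE)
  have n: "\<bar>\<psi> x - (\<Sum>k\<le>n j. \<psi> (k/n j) * Bernstein (n j) k x)\<bar> < 1 / (real j + 1)"
    if "x \<in> {0..1}" for x j using bspec[OF spec[OF n0] that] .
  have "bounded (\<psi> ` {0..1})"
    using \<psi> compact_continuous_image compact_imp_bounded by blast
  then obtain D where D: "\<And>x. x \<in> {0..1} \<Longrightarrow> \<bar>\<psi> x\<bar> \<le> D" by (force simp: bounded_iff)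
  obtain C where C: "C \<ge> 0" "\<And>y. \<bar>f y\<bar> \<le> C" using good_bounded[OF f] by blast
  have mem: "bump s a y \<in> {0..1}" for y using bump_bounds[of s a y] by auto
  show ?thesis
  proof (rule good_lim[OF bern])
    fix j y
    have "1 / (real j + 1) \<le> 1" by simp
    then have "\<bar>\<Sum>k\<le>n j. \<psi> (k/n j) * Bernstein (n j) k (bump s a y)\<bar> \<le> D + 1"
      using n[OF mem[of y], of j] D[OF mem[of y]] by linarith
    then show "\<bar>f y * (\<Sum>k\<le>n j. \<psi> (k/n j) * Bernstein (n j) k (bump s a y))\<bar> \<le> C * (D + 1)"
      unfolding abs_mult using C by (intro mult_mono) auto
  next
    fix y
    have "(\<lambda>j. \<psi> (bump s a y) - (\<Sum>k\<le>n j. \<psi> (k/n j) * Bernstein (n j) k (bump s a y))) \<longlonglongrightarrow> 0"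
    proof (rule LIMSEQ_norm_0)
      show "norm (\<psi> (bump s a y) - (\<Sum>k\<le>n j. \<psi> (k/n j) * Bernstein (n j) k (bump s a y))) < 1 / real (Suc j)" for j
        using n[OF mem[of y], of j] by (simp add: add.commute)
    qed
    then have "(\<lambda>j. \<psi> (bump s a y) - (\<psi> (bump s a y) - (\<Sum>k\<le>n j. \<psi> (k/n j) * Bernstein (n j) k (bump s a y))))
        \<longlonglongrightarrow> \<psi> (bump s a y) - 0"
      by (intro tendsto_diff tendsto_const)
    then have "(\<lambda>j. \<Sum>k\<le>n j. \<psi> (k/n j) * Bernstein (n j) k (bump s a y)) \<longlonglongrightarrow> \<psi> (bump s a y)" by simp
    then show "(\<lambda>j. f y * (\<Sum>k\<le>n j. \<psi> (k/n j) * Bernstein (n j) k (bump s a y)))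
        \<longlonglongrightarrow> f y * \<psi> (bump s a y)"
      by (intro tendsto_mult tendsto_const)
  qed
qed

lemma good_ball:
  assumes f: "good f"
  shows "good (\<lambda>y. f y * indicator (ball a r) y)"
proof (cases "r > 0")
  case False
  then have "ball a r = {}" by simp
  show ?thesis unfolding \<open>ball a r = {}\<close> using good_cmult[OF f, of 0] by simp
next
  case True
  \<comment> \<open>The ball is the superlevel set of a bump at its value \<open>\<theta>\<close> on
    the sphere; the ramps \<open>\<psi> j\<close> vanish up to \<open>\<theta>\<close> and converge
    to the indicator of what lies above, so openness of the ball is respected.\<close>
  define \<theta> where "\<theta> = exp (- r\<^sup>2 / 2)"
  define \<psi> where "\<psi> j x = min 1 (max 0 (real j * (x - \<theta>)))" for j x
  obtain C where C: "C \<ge> 0" "\<And>y. \<bar>f y\<bar> \<le> C" using good_bounded[OF f] by blast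
  have ball: "y \<in> ball a r \<longleftrightarrow> bump 1 a y > \<theta>" for y
  proof -
    have "bump 1 a y > \<theta> \<longleftrightarrow> (norm (y - a))\<^sup>2 < r\<^sup>2" by (simp add: bump_def \<theta>_def)
    also have "\<dots> \<longleftrightarrow> norm (y - a) < r"
      using True by (metis norm_ge_zero less_eq_real_def power2_less_imp_less power_strict_mono pos2)
    finally show ?thesis by (simp add: dist_norm norm_minus_commute)
  qed
  show ?thesis
  proof (rule good_lim[where f = "\<lambda>j y. f y * \<psi> j (bump 1 a y)"])
    show "good (\<lambda>y. f y * \<psi> j (bump 1 a y))" for j
      unfolding \<psi>_def by (intro good_continuous_bump f continuous_intros)
    show "\<bar>f y * \<psi> j (bump 1 a y)\<bar> \<le> C * 1" for j y
      unfolding abs_mult using C by (intro mult_mono) (auto simp: \<psi>_def)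
    fix y
    have "(\<lambda>j. \<psi> j (bump 1 a y)) \<longlonglongrightarrow> indicator (ball a r) y"
    proof (cases "bump 1 a y > \<theta>")
      case True
      then obtain J where J: "1 / (bump 1 a y - \<theta>) < real J" using reals_Archimedean2 by blast
      have "\<psi> j (bump 1 a y) = 1" if "j \<ge> J" for j
      proof -
        have "1 / (bump 1 a y - \<theta>) \<le> real j" using J that by linarith
        then have "1 \<le> real j * (bump 1 a y - \<theta>)" using True by (simp add: field_simps)
        then show ?thesis by (simp add: \<psi>_def)
      qed
      then have "(\<lambda>j. \<psi> j (bump 1 a y)) \<longlonglongrightarrow> 1"
        by (intro tendsto_eventually) (auto simp: eventually_sequentially)
      then show ?thesis using True ball[of y] by simp
    next
      case False
      then have "\<psi> j (bump 1 a y) = 0" for j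
        by (simp add: \<psi>_def mult_nonneg_nonpos)
      then show ?thesis using False ball[of y] by simp
    qed
    then show "(\<lambda>j. f y * \<psi> j (bump 1 a y)) \<longlonglongrightarrow> f y * indicator (ball a r) y"
      by (intro tendsto_intros)
  qed
qed

text \<open>Phrased as a multiplier, so that intersections amount to multiplying twice. With
  complements and countable unions the good sets form a sigma-algebra containing the balls.\<close>

definition good_set :: "'a set \<Rightarrow> bool" where
  "good_set A \<longleftrightarrow> (\<forall>f. good f \<longrightarrow> good (\<lambda>y. f y * indicator A y))"

lemma good_set_Compl: "good_set A \<Longrightarrow> good_set (- A)"
  unfolding good_set_def
proof (intro allI impI)
  fix f assume "\<forall>f. good f \<longrightarrow> good (\<lambda>y. f y * indicator A y)" "good f"
  then have "good (\<lambda>y. f y - f y * indicator A y)" by (intro good_minus) auto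
  then show "good (\<lambda>y. f y * indicator (- A) y)" by (simp add: indicator_compl algebra_simps)
qed

lemma good_set_Int: "good_set A \<Longrightarrow> good_set B \<Longrightarrow> good_set (A \<inter> B)"
  unfolding good_set_def by (simp add: indicator_inter_arith mult.assoc[symmetric])

lemma good_set_Un: "good_set A \<Longrightarrow> good_set B \<Longrightarrow> good_set (A \<union> B)"
  using good_set_Compl[OF good_set_Int[OF good_set_Compl good_set_Compl], of A B] by simp

lemma good_set_UN:
  assumes "\<And>i::nat. good_set (A i)"
  shows "good_set (\<Union>i. A i)"
  unfolding good_set_def
proof (intro allI impI)
  fix f assume f: "good f"
  obtain C where C: "C \<ge> 0" "\<And>y. \<bar>f y\<bar> \<le> C" using good_bounded[OF f] by blast
  have fin: "good_set (\<Union>i<n. A i)" for n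
  proof (induction n)
    case 0
    have "good (\<lambda>y. f y * indicator {} y)" if "good f" for f
      using good_cmult[OF that, of 0] by simp
    then show ?case by (simp add: good_set_def)
  next
    case (Suc n)
    then show ?case using good_set_Un[OF assms[of n]] by (simp add: lessThan_Suc)
  qed
  show "good (\<lambda>y. f y * indicator (\<Union>i. A i) y)"
  proof (rule good_lim[where f = "\<lambda>n y. f y * indicator (\<Union>i<n. A i) y"])
    show "good (\<lambda>y. f y * indicator (\<Union>i<n. A i) y)" for n
      using fin f by (simp add: good_set_def)
    show "\<bar>f y * indicator (\<Union>i<n. A i) y\<bar> \<le> C" for n y
      using C by (auto simp: indicator_def)
    show "(\<lambda>n. f y * indicator (\<Union>i<n. A i) y) \<longlonglongrightarrow> f y * indicator (\<Union>i. A i) y" for y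
      by (intro tendsto_mult tendsto_const LIMSEQ_indicator_UN)
  qed
qed

lemma good_set_borel:
  assumes "A \<in> sets borel"
  shows "good_set A"
  using assms[unfolded sets_borel]
proof (induction rule: sigma_sets.induct)
  case (Basic S)
  then obtain a r where S: "S = (\<Union>i::nat. ball (a i) (r i))"
    using open_countable_Union_balls by blast
  have "good_set (ball (a i) (r i))" for i using good_ball by (simp add: good_set_def)
  then show ?case unfolding S by (rule good_set_UN)
next
  case Empty
  show ?case using good_set_UN[of "\<lambda>_. {}"] good_ball[of _ 0 0] by (simp add: good_set_def)
next
  case (Compl A)
  then show ?case using good_set_Compl by (simp add: Compl_eq_Diff_UNIV[symmetric])
next
  case (Union A)
  then show ?case by (intro good_set_UN)
qed

lemma measures_eq: "M = N"
proof (rule measure_eqI)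
  show "sets M = sets N" by (simp add: M N)
  fix A assume "A \<in> sets M"
  then have A[measurable]: "A \<in> sets borel" by (simp add: M)
  have "good (\<lambda>y. 1 * indicator A y)"
    by (rule good_set_borel[OF A, unfolded good_set_def, rule_format, OF good_1])
  \<comment> \<open>With \<open>s = 0\<close> the bump is the constant 1, so goodness of the
    indicator says that both measures agree on \<open>A\<close>.\<close>
  then have "(\<integral>y. 1 * indicator A y * bump 0 0 y \<partial>M) = (\<integral>y. 1 * indicator A y * bump 0 0 y \<partial>N)"
    unfolding good_def by blast
  moreover have "space M = UNIV" "space N = UNIV"
    using sets_eq_imp_space_eq[OF M(2)] sets_eq_imp_space_eq[OF N(2)] by simp_all
  ultimately have "measure M A = measure N A" by (simp add: bump_def)
  then show "emeasure M A = emeasure N A"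
    by (simp add: M.emeasure_eq_measure N.emeasure_eq_measure)
qed

end

lemmas measure_eqI_char_functional = equal_char_functionals.measures_eq[OF equal_char_functionals.intro]

text \<open>The law is written as an image of the standard normal one rather than by a density, so
  that the point mass for \<open>c = 0\<close> is included. Levy's uniqueness theorem identifies
  it.\<close>

lemma normal_law:
  assumes M: "prob_space M" and [measurable]: "X \<in> borel_measurable M"
    and char: "\<And>t. (\<integral>x. iexp (t * X x) \<partial>M) = exp (- complex_of_real ((t * c)\<^sup>2) / 2)"
  shows "distr M borel X = distr std_normal_distribution borel (\<lambda>x. c * x)"
proof (rule Levy_uniqueness)
  interpret M: prob_space M by fact
  interpret G: prob_space std_normal_distribution by (rule prob_space_std_normal)
  show "real_distribution (distr M borel X)" by simp
  show "real_distribution (distr std_normal_distribution borel (\<lambda>x. c * x))"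
    by (rule G.real_distribution_distr) simp
  show "char (distr M borel X) = char (distr std_normal_distribution borel (\<lambda>x. c * x))"
  proof
    fix t
    have "char (distr M borel X) t = (\<integral>x. iexp (t * X x) \<partial>M)"
      by (simp add: char_def integral_distr)
    also have "\<dots> = (\<integral>x. iexp ((t * c) * x) \<partial>std_normal_distribution)"
      unfolding char std_normal_iexp ..
    also have "\<dots> = char (distr std_normal_distribution borel (\<lambda>x. c * x)) t"
      by (subst char_def, subst integral_distr) (auto simp: mult.assoc)
    finally show "char (distr M borel X) t = char (distr std_normal_distribution borel (\<lambda>x. c * x)) t" .
  qed
qed

lemma normal_law_nn_integral:
  assumes M: "prob_space M" and X[measurable]: "X \<in> borel_measurable M"
    and char: "\<And>t. (\<integral>x. iexp (t * X x) \<partial>M) = exp (- complex_of_real ((t * c)\<^sup>2) / 2)"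
    and [measurable]: "f \<in> borel_measurable borel"
  shows "(\<integral>\<^sup>+x. f (X x) \<partial>M) = (\<integral>\<^sup>+x. f (c * x) \<partial>std_normal_distribution)"
proof -
  have "(\<integral>\<^sup>+x. f (X x) \<partial>M) = (\<integral>\<^sup>+x. f x \<partial>distr M borel X)" by (simp add: nn_integral_distr)
  also have "\<dots> = (\<integral>\<^sup>+x. f (c * x) \<partial>std_normal_distribution)"
    unfolding normal_law[OF M X char] by (subst nn_integral_distr) auto
  finally show ?thesis .
qed

lemma std_normal_even_moment:
  "(\<integral>\<^sup>+x. ennreal ((c * x) ^ (2 * k)) \<partial>std_normal_distribution)
     = ennreal (fact (2 * k) / (2 ^ k * fact k) * c ^ (2 * k))"
proof -
  have "(\<integral>\<^sup>+x. ennreal ((c * x) ^ (2 * k)) \<partial>std_normal_distribution)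
      = ennreal (\<integral>x. (c * x) ^ (2 * k) \<partial>std_normal_distribution)"
    by (rule nn_integral_eq_integral)
      (auto simp: power_mult_distrib integrable_std_normal_distribution_moment)
  also have "(\<integral>x. (c * x) ^ (2 * k) \<partial>std_normal_distribution) = fact (2 * k) / (2 ^ k * fact k) * c ^ (2 * k)"
    by (simp only: power_mult_distrib integral_mult_right_zero std_normal_distribution_even_moments)
      (simp only: mult.commute)
  finally show ?thesis .
qed

section \<open>Limits in mean square\<close>

lemma power2_norm_add_le: "(norm (a + b))\<^sup>2 \<le> 2 * (norm a)\<^sup>2 + 2 * (norm b)\<^sup>2"
  for a b :: "'a::real_normed_vector"
proof -
  have "(norm (a + b))\<^sup>2 \<le> (norm a + norm b)\<^sup>2" by (intro power_mono norm_triangle_ineq) auto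
  also have "\<dots> \<le> 2 * (norm a)\<^sup>2 + 2 * (norm b)\<^sup>2"
    using sum_squares_bound[of "norm a" "norm b"] by (simp add: power2_eq_square algebra_simps)
  finally show ?thesis .
qed

lemma nn_integral_power2_norm_add_le:
  fixes f g :: "'x \<Rightarrow> 'a::{real_normed_vector,second_countable_topology}"
  assumes [measurable]: "f \<in> borel_measurable M" "g \<in> borel_measurable M"
  shows "(\<integral>\<^sup>+x. ennreal ((norm (f x + g x))\<^sup>2) \<partial>M) \<le>
    2 * (\<integral>\<^sup>+x. ennreal ((norm (f x))\<^sup>2) \<partial>M) + 2 * (\<integral>\<^sup>+x. ennreal ((norm (g x))\<^sup>2) \<partial>M)"
proof -
  have "(\<integral>\<^sup>+x. ennreal ((norm (f x + g x))\<^sup>2) \<partial>M)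
      \<le> (\<integral>\<^sup>+x. 2 * ennreal ((norm (f x))\<^sup>2) + 2 * ennreal ((norm (g x))\<^sup>2) \<partial>M)"
    using power2_norm_add_le
    by (intro nn_integral_mono)
      (simp add: ennreal_plus[symmetric] ennreal_mult'[symmetric] ennreal_numeral[symmetric]
        del: ennreal_plus ennreal_numeral)
  also have "\<dots> = 2 * (\<integral>\<^sup>+x. ennreal ((norm (f x))\<^sup>2) \<partial>M) + 2 * (\<integral>\<^sup>+x. ennreal ((norm (g x))\<^sup>2) \<partial>M)"
    by (simp add: nn_integral_add nn_integral_cmult)
  finally show ?thesis .
qed

text \<open>The exponents are chosen so that \<open>g \<le> 2\<^sup>-\<^sup>n + 2\<^sup>n g\<^sup>2\<close> turns the
  square estimates into a summable sequence of \<open>L\<^sup>1\<close> estimates.\<close>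

lemma rapid_L2_limit:
  fixes f :: "nat \<Rightarrow> 'x \<Rightarrow> 'a::{banach,second_countable_topology}"
  assumes M: "prob_space M" and [measurable]: "\<And>n. f n \<in> borel_measurable M"
    and rapid: "\<And>n. (\<integral>\<^sup>+x. ennreal ((norm (f (Suc n) x - f n x))\<^sup>2) \<partial>M) \<le> ennreal ((1/4) ^ n)"
  obtains F where "F \<in> borel_measurable M" "AE x in M. (\<lambda>n. f n x) \<longlonglongrightarrow> F x"
    "(\<lambda>n. \<integral>\<^sup>+x. ennreal ((norm (f n x - F x))\<^sup>2) \<partial>M) \<longlonglongrightarrow> 0"
proof -
  interpret prob_space M by fact
  define F where "F x = lim (\<lambda>n. f n x)" for x
  have Fm[measurable]: "F \<in> borel_measurable M" unfolding F_def[abs_def] by measurable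
  have L1: "(\<integral>\<^sup>+x. ennreal (norm (f (Suc n) x - f n x)) \<partial>M) \<le> ennreal (2 * (1/2) ^ n)" for n
  proof -
    have *: "r \<le> (1/2) ^ n + 2 ^ n * r\<^sup>2" if "r \<ge> 0" for r :: real
    proof -
      have "2 * ((1/2)^n * (2^n * r)) \<le> (1/2) ^ n * 1\<^sup>2 + (1/2)^n * (2 ^ n * r)\<^sup>2"
        using mult_left_mono[OF sum_squares_bound[of 1 "2^n * r"], of "(1/2)^n"]
        by (simp add: algebra_simps)
      moreover have "(1/2)^n * (2 ^ n * r)\<^sup>2 = 2 ^ n * r\<^sup>2" "(1/2)^n * (2^n * r) = r"
        by (simp_all add: power2_eq_square power_divide)
      ultimately show ?thesis using that by simp
    qed
    have "(\<integral>\<^sup>+x. ennreal (norm (f (Suc n) x - f n x)) \<partial>M)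
        \<le> (\<integral>\<^sup>+x. ennreal ((1/2) ^ n) + ennreal (2 ^ n) * ennreal ((norm (f (Suc n) x - f n x))\<^sup>2) \<partial>M)"
      by (intro nn_integral_mono)
        (simp add: ennreal_plus[symmetric] ennreal_mult'[symmetric] * del: ennreal_plus)
    also have "\<dots> = ennreal ((1/2) ^ n) + ennreal (2 ^ n) * (\<integral>\<^sup>+x. ennreal ((norm (f (Suc n) x - f n x))\<^sup>2) \<partial>M)"
      by (simp add: nn_integral_add nn_integral_cmult emeasure_space_1)
    also have "\<dots> \<le> ennreal ((1/2) ^ n) + ennreal (2 ^ n) * ennreal ((1/4) ^ n)"
      by (intro add_mono mult_left_mono rapid) auto
    also have "\<dots> = ennreal ((1/2) ^ n + 2 ^ n * (1/4) ^ n)"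
      by (simp add: ennreal_plus[symmetric] ennreal_mult'[symmetric] del: ennreal_plus)
    also have "(1/2) ^ n + 2 ^ n * (1/4) ^ n = 2 * (1/2 :: real) ^ n"
      by (simp add: power_mult_distrib[symmetric])
    finally show ?thesis .
  qed
  have sm: "summable (\<lambda>n. 2 * (1/2::real) ^ n)" by (intro summable_mult summable_geometric) simp
  have "(\<integral>\<^sup>+x. (\<Sum>n. ennreal (norm (f (Suc n) x - f n x))) \<partial>M)
      = (\<Sum>n. \<integral>\<^sup>+x. ennreal (norm (f (Suc n) x - f n x)) \<partial>M)"
    by (rule nn_integral_suminf) simp
  also have "\<dots> \<le> (\<Sum>n. ennreal (2 * (1/2) ^ n))"
    by (intro suminf_le L1) auto
  also have "\<dots> < \<infinity>"
    using sm by (subst suminf_ennreal2) (auto simp: less_top[symmetric])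
  finally have "AE x in M. (\<Sum>n. ennreal (norm (f (Suc n) x - f n x))) \<noteq> \<infinity>"
    by (intro nn_integral_PInf_AE) auto
  then have AE: "AE x in M. (\<lambda>n. f n x) \<longlonglongrightarrow> F x"
  proof eventually_elim
    case (elim x)
    then have "summable (\<lambda>n. norm (f (Suc n) x - f n x))"
      by (intro summable_suminf_not_top) (auto simp: top_unique)
    then have "summable (\<lambda>n. f (Suc n) x - f n x)" by (rule summable_norm_cancel)
    then have "convergent (\<lambda>n. \<Sum>i<n. f (Suc i) x - f i x)" by (simp add: summable_iff_convergent)
    then have "convergent (\<lambda>n. f n x - f 0 x)" by (simp only: sum_lessThan_telescope[of "\<lambda>i. f i x"])
    then have "convergent (\<lambda>n. f n x)" using convergent_add[OF _ convergent_const, of _ "f 0 x"] by fastforce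
    then show ?case unfolding F_def by (simp add: convergent_LIMSEQ_iff)
  qed
  \<comment> \<open>Splitting off the first increment doubles both squares, so the constant
    \<open>c\<close> must satisfy \<open>2 * (c / 4) + 2 = c\<close>, whence 4.\<close>
  have far: "(\<integral>\<^sup>+x. ennreal ((norm (f (n + k) x - f n x))\<^sup>2) \<partial>M) \<le> ennreal (4 * (1/4) ^ n)" for n k
  proof (induction k arbitrary: n)
    case (Suc k)
    have "(\<integral>\<^sup>+x. ennreal ((norm (f (n + Suc k) x - f n x))\<^sup>2) \<partial>M)
        = (\<integral>\<^sup>+x. ennreal ((norm ((f (Suc n + k) x - f (Suc n) x) + (f (Suc n) x - f n x)))\<^sup>2) \<partial>M)"
      by simp
    also have "\<dots> \<le> 2 * (\<integral>\<^sup>+x. ennreal ((norm (f (Suc n + k) x - f (Suc n) x))\<^sup>2) \<partial>M)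
        + 2 * (\<integral>\<^sup>+x. ennreal ((norm (f (Suc n) x - f n x))\<^sup>2) \<partial>M)"
      by (rule nn_integral_power2_norm_add_le) measurable
    also have "\<dots> \<le> 2 * ennreal (4 * (1/4) ^ Suc n) + 2 * ennreal ((1/4) ^ n)"
      by (intro add_mono mult_left_mono rapid Suc) auto
    also have "\<dots> = ennreal (4 * (1/4) ^ n)"
      by (simp add: ennreal_plus[symmetric] ennreal_mult'[symmetric] ennreal_numeral[symmetric]
          del: ennreal_plus ennreal_numeral)
    finally show ?case .
  qed simp
  have "(\<integral>\<^sup>+x. ennreal ((norm (f n x - F x))\<^sup>2) \<partial>M) \<le> ennreal (4 * (1/4) ^ n)" for n
  proof -
    \<comment> \<open>Fatou's lemma carries the bound, uniform in \<open>k\<close>, over to the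
      almost sure limit.\<close>
    have "(\<integral>\<^sup>+x. ennreal ((norm (f n x - F x))\<^sup>2) \<partial>M)
        = (\<integral>\<^sup>+x. liminf (\<lambda>k. ennreal ((norm (f (n + k) x - f n x))\<^sup>2)) \<partial>M)"
    proof (rule nn_integral_cong_AE)
      show "AE x in M. ennreal ((norm (f n x - F x))\<^sup>2) = liminf (\<lambda>k. ennreal ((norm (f (n + k) x - f n x))\<^sup>2))"
        using AE
      proof eventually_elim
        case (elim x)
        then have "(\<lambda>k. f (n + k) x) \<longlonglongrightarrow> F x"
          using LIMSEQ_ignore_initial_segment[of "\<lambda>n. f n x" "F x" n] by (simp add: add.commute)
        then have "(\<lambda>k. ennreal ((norm (f (n + k) x - f n x))\<^sup>2)) \<longlonglongrightarrow> ennreal ((norm (F x - f n x))\<^sup>2)"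
          by (intro tendsto_ennrealI tendsto_intros)
        from lim_imp_Liminf[OF _ this] show ?case by (simp add: norm_minus_commute)
      qed
    qed
    also have "\<dots> \<le> liminf (\<lambda>k. \<integral>\<^sup>+x. ennreal ((norm (f (n + k) x - f n x))\<^sup>2) \<partial>M)"
      by (rule nn_integral_liminf) measurable
    also have "\<dots> \<le> liminf (\<lambda>k::nat. ennreal (4 * (1/4) ^ n))"
      by (intro Liminf_mono always_eventually allI far)
    also have "\<dots> = ennreal (4 * (1/4) ^ n)" by (simp add: Liminf_const)
    finally show ?thesis .
  qed
  moreover have "(\<lambda>n. ennreal (4 * (1/4) ^ n)) \<longlonglongrightarrow> ennreal (4 * 0)"
    by (intro tendsto_ennrealI tendsto_intros LIMSEQ_power_zero) auto
  then have z: "(\<lambda>n. ennreal (4 * (1/4) ^ n)) \<longlonglongrightarrow> 0" by simp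
  ultimately have "(\<lambda>n. \<integral>\<^sup>+x. ennreal ((norm (f n x - F x))\<^sup>2) \<partial>M) \<longlonglongrightarrow> 0"
    by (intro tendsto_sandwich[OF _ _ tendsto_const z] always_eventually allI zero_le)
  with Fm AE show ?thesis by (rule that)
qed

section \<open>Gaussian measures and white noise\<close>

lemma ennreal_parseval:
  "parseval e \<Longrightarrow> ennreal ((norm x)\<^sup>2) = (\<Sum>k. ennreal ((inner x (e k))\<^sup>2))"
  unfolding parseval_def by (intro suminf_ennreal_eq[symmetric]) auto

lemma normal_law_L2:
  assumes "prob_space M" "X \<in> borel_measurable M"
    and "\<And>t. (\<integral>x. iexp (t * X x) \<partial>M) = exp (- complex_of_real ((t * c)\<^sup>2) / 2)"
  shows "(\<integral>\<^sup>+x. ennreal ((X x)\<^sup>2) \<partial>M) = ennreal (c\<^sup>2)"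
  using normal_law_nn_integral[OF assms, of "\<lambda>x. ennreal (x\<^sup>2)"] std_normal_even_moment[of c 1] by simp

text \<open>Parseval reduces to coordinates. Each coordinate is a finite combination of standard
  normals, whose variance is read off from its characteristic function; summing the variances
  restores the norms.\<close>

lemma std_normal_sequence_L2:
  fixes x :: "nat \<Rightarrow> 'a::{real_inner,banach,second_countable_topology}"
  shows "(\<integral>\<^sup>+\<omega>. ennreal ((norm (\<Sum>i<n. \<omega> i *\<^sub>R x i))\<^sup>2) \<partial>std_normal_sequence)
    = ennreal (\<Sum>i<n. (norm (x i))\<^sup>2)"
proof -
  obtain e :: "nat \<Rightarrow> 'a" where e: "parseval e" using parseval_exists by blast
  have "(\<integral>\<^sup>+\<omega>. ennreal ((norm (\<Sum>i<n. \<omega> i *\<^sub>R x i))\<^sup>2) \<partial>std_normal_sequence)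
      = (\<Sum>k. \<integral>\<^sup>+\<omega>. ennreal ((inner (\<Sum>i<n. \<omega> i *\<^sub>R x i) (e k))\<^sup>2) \<partial>std_normal_sequence)"
    unfolding ennreal_parseval[OF e] by (rule nn_integral_suminf) measurable
  also have "\<dots> = (\<Sum>k. ennreal (\<Sum>i<n. (inner (x i) (e k))\<^sup>2))"
  proof (intro suminf_cong)
    fix k
    have nonneg: "0 \<le> (\<Sum>i<n. (inner (x i) (e k))\<^sup>2)" by (intro sum_nonneg) auto
    have "(\<integral>\<^sup>+\<omega>. ennreal ((\<Sum>i<n. inner (x i) (e k) * \<omega> i)\<^sup>2) \<partial>std_normal_sequence)
        = ennreal ((sqrt (\<Sum>i<n. (inner (x i) (e k))\<^sup>2))\<^sup>2)"
    proof (rule normal_law_L2[OF prob_space_std_normal_sequence])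
      fix t :: real
      have "(t * sqrt (\<Sum>i<n. (inner (x i) (e k))\<^sup>2))\<^sup>2 = (\<Sum>i<n. (t * inner (x i) (e k))\<^sup>2)"
        using nonneg by (simp add: power_mult_distrib sum_distrib_left)
      then show "(\<integral>\<omega>. iexp (t * (\<Sum>i<n. inner (x i) (e k) * \<omega> i)) \<partial>std_normal_sequence)
          = exp (- complex_of_real ((t * sqrt (\<Sum>i<n. (inner (x i) (e k))\<^sup>2))\<^sup>2) / 2)"
        using std_normal_sequence_iexp[of "\<lambda>i. t * inner (x i) (e k)" n]
        by (simp only: sum_distrib_left mult.assoc)
    qed measurable
    then show "(\<integral>\<^sup>+\<omega>. ennreal ((inner (\<Sum>i<n. \<omega> i *\<^sub>R x i) (e k))\<^sup>2) \<partial>std_normal_sequence)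
        = ennreal (\<Sum>i<n. (inner (x i) (e k))\<^sup>2)"
      using nonneg by (simp add: inner_sum_left mult.commute)
  qed
  also have "\<dots> = ennreal (\<Sum>i<n. (norm (x i))\<^sup>2)"
    using e unfolding parseval_def
    by (intro suminf_ennreal_eq sums_sum) (auto intro: sum_nonneg)
  finally show ?thesis .
qed

text \<open>The Gaussian measure is the law of \<open>\<Sum>n. \<omega> n *\<^sub>R R (e n)\<close>; blocks of the series are
  chosen so that the partial sums converge rapidly.\<close>

lemma centered_gaussian_measure_exists:
  fixes R :: "'a::{real_inner,banach,second_countable_topology} \<Rightarrow>\<^sub>L 'a"
  assumes R: "nonneg_selfadjoint R" and e: "parseval e"
    and summable: "summable (\<lambda>n. (norm (R (e n)))\<^sup>2)"
  shows "\<exists>\<mu>. centered_gaussian_measure (R o\<^sub>L R) \<mu>"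
proof -
  interpret G: prob_space std_normal_sequence by (rule prob_space_std_normal_sequence)
  have "\<exists>N. \<forall>m\<ge>N. \<forall>n. norm (\<Sum>i=m..<n. (norm (R (e i)))\<^sup>2) < (1/4) ^ j" for j
    using summable[unfolded summable_Cauchy, rule_format, of "(1/4)^j"] by simp
  then obtain N0 where N0: "\<And>j m n. m \<ge> N0 j \<Longrightarrow> norm (\<Sum>i=m..<n. (norm (R (e i)))\<^sup>2) < (1/4) ^ j"
    by metis
  \<comment> \<open>Summing \<open>N0\<close> makes the block ends monotone and at least
    \<open>N0 j\<close>; adding \<open>j\<close> makes them tend to infinity.\<close>
  define N where "N j = (\<Sum>i\<le>j. N0 i) + j" for j
  have N: "N0 j \<le> N j" "N j \<le> N (Suc j)" "j \<le> N j" for j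
    by (auto simp: N_def intro: trans_le_add1 member_le_sum)
  define X where "X j \<omega> = (\<Sum>i<N j. \<omega> i *\<^sub>R R (e i))" for j and \<omega> :: "nat \<Rightarrow> real"
  have Xm[measurable]: "X j \<in> borel_measurable std_normal_sequence" for j
    unfolding X_def by measurable
  have "(\<integral>\<^sup>+\<omega>. ennreal ((norm (X (Suc j) \<omega> - X j \<omega>))\<^sup>2) \<partial>std_normal_sequence) \<le> ennreal ((1/4) ^ j)" for j
  proof -
    \<comment> \<open>Zeroing the vectors before the block lets the mean square formula for sums
      starting at 0 apply to the increment.\<close>
    define x where "x i = (if i < N j then 0 else R (e i))" for i
    have split: "{..<N (Suc j)} = {..<N j} \<union> {N j..<N (Suc j)}" using N(2)[of j] by auto
    have "X (Suc j) \<omega> - X j \<omega> = (\<Sum>i<N (Suc j). \<omega> i *\<^sub>R x i)" for \<omega>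
      unfolding X_def split by (subst (1 2) sum.union_disjoint) (auto simp: x_def)
    then have "(\<integral>\<^sup>+\<omega>. ennreal ((norm (X (Suc j) \<omega> - X j \<omega>))\<^sup>2) \<partial>std_normal_sequence)
        = ennreal (\<Sum>i<N (Suc j). (norm (x i))\<^sup>2)"
      by (simp add: std_normal_sequence_L2)
    also have "(\<Sum>i<N (Suc j). (norm (x i))\<^sup>2) = (\<Sum>i=N j..<N (Suc j). (norm (R (e i)))\<^sup>2)"
      unfolding split by (subst sum.union_disjoint) (auto simp: x_def)
    also have "\<dots> \<le> (1/4) ^ j" using N0[OF N(1), of j "N (Suc j)"] by simp
    finally show ?thesis by (simp add: ennreal_leI)
  qed
  from rapid_L2_limit[OF prob_space_std_normal_sequence Xm this] obtain F where
    F[measurable]: "F \<in> borel_measurable std_normal_sequence" and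
    lim: "AE \<omega> in std_normal_sequence. (\<lambda>j. X j \<omega>) \<longlonglongrightarrow> F \<omega>" by blast
  have "(\<integral>\<omega>. iexp (inner h (F \<omega>)) \<partial>std_normal_sequence) = exp (- complex_of_real (inner (R (R h)) h) / 2)" for h
  proof (rule LIMSEQ_unique)
    show "(\<lambda>j. \<integral>\<omega>. iexp (inner h (X j \<omega>)) \<partial>std_normal_sequence) \<longlonglongrightarrow> (\<integral>\<omega>. iexp (inner h (F \<omega>)) \<partial>std_normal_sequence)"
    proof (rule integral_dominated_convergence[where w = "\<lambda>_. 1"])
      show "AE \<omega> in std_normal_sequence. (\<lambda>j. iexp (inner h (X j \<omega>))) \<longlonglongrightarrow> iexp (inner h (F \<omega>))"
        using lim by eventually_elim (intro tendsto_intros)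
    qed auto
    have ev: "(\<integral>\<omega>. iexp (inner h (X j \<omega>)) \<partial>std_normal_sequence)
        = exp (- complex_of_real (\<Sum>i<N j. (inner (R h) (e i))\<^sup>2) / 2)" for j
    proof -
      have "inner h (X j \<omega>) = (\<Sum>i<N j. inner (R h) (e i) * \<omega> i)" for \<omega>
        by (simp add: X_def inner_sum_right nonneg_selfadjoint_inner[OF R] mult.commute)
      then show ?thesis using std_normal_sequence_iexp[of _ "N j"] by (simp only:)
    qed
    have "filterlim N at_top sequentially"
      by (rule filterlim_at_top_mono[OF filterlim_ident]) (use N(3) in auto)
    moreover have "(\<lambda>n. \<Sum>i<n. (inner (R h) (e i))\<^sup>2) \<longlonglongrightarrow> (norm (R h))\<^sup>2"
      using e by (simp add: parseval_def sums_def)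
    ultimately have "(\<lambda>j. \<Sum>i<N j. (inner (R h) (e i))\<^sup>2) \<longlonglongrightarrow> (norm (R h))\<^sup>2"
      by (rule filterlim_compose[rotated])
    moreover have "(norm (R h))\<^sup>2 = inner (R (R h)) h"
      by (simp add: power2_norm_eq_inner nonneg_selfadjoint_inner[OF R])
    ultimately show "(\<lambda>j. \<integral>\<omega>. iexp (inner h (X j \<omega>)) \<partial>std_normal_sequence)
        \<longlonglongrightarrow> exp (- complex_of_real (inner (R (R h)) h) / 2)"
      unfolding ev by (intro tendsto_intros) auto
  qed
  then have "centered_gaussian_measure (R o\<^sub>L R) (distr std_normal_sequence borel F)"
    unfolding centered_gaussian_measure_def
    by (auto simp: integral_distr intro!: G.prob_space_distr)
  then show ?thesis by blast
qed

section \<open>The Gaussian shift on the line\<close>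

lemma cauchy_schwarz_integral:
  fixes f g :: "'x \<Rightarrow> real"
  assumes [measurable]: "f \<in> borel_measurable M" "g \<in> borel_measurable M"
    and f: "integrable M (\<lambda>x. (f x)\<^sup>2)" and g: "integrable M (\<lambda>x. (g x)\<^sup>2)"
  shows "integrable M (\<lambda>x. f x * g x)"
    and "\<bar>\<integral>x. f x * g x \<partial>M\<bar> \<le> sqrt (\<integral>x. (f x)\<^sup>2 \<partial>M) * sqrt (\<integral>x. (g x)\<^sup>2 \<partial>M)"
proof -
  have "(\<integral>\<^sup>+x. ennreal \<bar>f x\<bar> * ennreal \<bar>g x\<bar> \<partial>M)\<^sup>2
      \<le> (\<integral>\<^sup>+x. (ennreal \<bar>f x\<bar>)\<^sup>2 \<partial>M) * (\<integral>\<^sup>+x. (ennreal \<bar>g x\<bar>)\<^sup>2 \<partial>M)"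
    by (rule Cauchy_Schwarz_nn_integral) measurable
  also have "\<dots> = ennreal (\<integral>x. (f x)\<^sup>2 \<partial>M) * ennreal (\<integral>x. (g x)\<^sup>2 \<partial>M)"
    using f g by (simp add: ennreal_power nn_integral_eq_integral)
  also have "\<dots> = ennreal ((\<integral>x. (f x)\<^sup>2 \<partial>M) * (\<integral>x. (g x)\<^sup>2 \<partial>M))"
    by (simp add: ennreal_mult)
  finally have le: "(\<integral>\<^sup>+x. ennreal (norm (f x * g x)) \<partial>M)\<^sup>2 \<le> ennreal ((\<integral>x. (f x)\<^sup>2 \<partial>M) * (\<integral>x. (g x)\<^sup>2 \<partial>M))"
    by (simp add: abs_mult ennreal_mult)
  then have "(\<integral>\<^sup>+x. ennreal (norm (f x * g x)) \<partial>M)\<^sup>2 < \<infinity>" by (simp add: order_le_less_trans)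
  then have "(\<integral>\<^sup>+x. ennreal (norm (f x * g x)) \<partial>M) < \<infinity>" by (simp add: power_less_top_ennreal)
  then show int: "integrable M (\<lambda>x. f x * g x)" by (intro integrableI_bounded) auto
  have "ennreal ((\<integral>x. \<bar>f x * g x\<bar> \<partial>M)\<^sup>2) \<le> ennreal ((\<integral>x. (f x)\<^sup>2 \<partial>M) * (\<integral>x. (g x)\<^sup>2 \<partial>M))"
    using le int by (simp add: nn_integral_eq_integral ennreal_power)
  then have "(\<integral>x. \<bar>f x * g x\<bar> \<partial>M)\<^sup>2 \<le> (\<integral>x. (f x)\<^sup>2 \<partial>M) * (\<integral>x. (g x)\<^sup>2 \<partial>M)"
    by (simp add: ennreal_le_iff)
  then have "(\<integral>x. \<bar>f x * g x\<bar> \<partial>M) \<le> sqrt ((\<integral>x. (f x)\<^sup>2 \<partial>M) * (\<integral>x. (g x)\<^sup>2 \<partial>M))"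
    by (rule real_le_rsqrt)
  moreover have "\<bar>\<integral>x. f x * g x \<partial>M\<bar> \<le> (\<integral>x. \<bar>f x * g x\<bar> \<partial>M)" by (rule integral_abs_bound)
  ultimately show "\<bar>\<integral>x. f x * g x \<partial>M\<bar> \<le> sqrt (\<integral>x. (f x)\<^sup>2 \<partial>M) * sqrt (\<integral>x. (g x)\<^sup>2 \<partial>M)"
    unfolding real_sqrt_mult by linarith
qed

lemma std_normal_shift:
  assumes [measurable]: "f \<in> borel_measurable borel"
  shows "(\<integral>\<^sup>+x. f (x + s) \<partial>std_normal_distribution)
    = (\<integral>\<^sup>+x. f x * ennreal (exp (s * x - s\<^sup>2 / 2)) \<partial>std_normal_distribution)"
proof -
  have dens: "std_normal_density (x - s) = std_normal_density x * exp (s * x - s\<^sup>2 / 2)" for x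
  proof -
    have "- (x - s)\<^sup>2 / 2 = - x\<^sup>2 / 2 + (s * x - s\<^sup>2 / 2)"
      by (simp add: power2_eq_square field_simps)
    then show ?thesis by (simp add: std_normal_density_def exp_add[symmetric])
  qed
  have "(\<integral>\<^sup>+x. f (x + s) \<partial>std_normal_distribution) = (\<integral>\<^sup>+x. ennreal (std_normal_density x) * f (x + s) \<partial>lborel)"
    by (rule nn_integral_density) auto
  also have "\<dots> = (\<integral>\<^sup>+x. ennreal (std_normal_density (x - s)) * f x \<partial>lborel)"
    by (subst (2) nn_integral_real_affine[where c = 1 and t = s]) (auto simp: add.commute)
  also have "\<dots> = (\<integral>\<^sup>+x. ennreal (std_normal_density x) * (f x * ennreal (exp (s * x - s\<^sup>2 / 2))) \<partial>lborel)"
    by (simp add: dens ennreal_mult' mult_ac)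
  also have "\<dots> = (\<integral>\<^sup>+x. f x * ennreal (exp (s * x - s\<^sup>2 / 2)) \<partial>std_normal_distribution)"
    by (rule nn_integral_density[symmetric]) auto
  finally show ?thesis .
qed

lemma std_normal_shift_has_bochner_integral:
  fixes g :: "real \<Rightarrow> real"
  assumes [measurable]: "g \<in> borel_measurable borel"
    and "has_bochner_integral std_normal_distribution (\<lambda>x. g (x + s)) v"
  shows "has_bochner_integral std_normal_distribution (\<lambda>x. g x * exp (s * x - s\<^sup>2 / 2)) v"
proof -
  have eq: "distr std_normal_distribution borel (\<lambda>x. x + s)
      = density std_normal_distribution (\<lambda>x. ennreal (exp (s * x - s\<^sup>2 / 2)))"
  proof (rule measure_eqI)
    fix A assume "A \<in> sets (distr std_normal_distribution borel (\<lambda>x. x + s))"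
    then have [measurable]: "A \<in> sets borel" by simp
    have "emeasure (distr std_normal_distribution borel (\<lambda>x. x + s)) A
        = (\<integral>\<^sup>+x. indicator A x \<partial>distr std_normal_distribution borel (\<lambda>x. x + s))" by simp
    also have "\<dots> = (\<integral>\<^sup>+x. indicator A (x + s) \<partial>std_normal_distribution)"
      by (subst nn_integral_distr) auto
    also have "\<dots> = emeasure (density std_normal_distribution (\<lambda>x. ennreal (exp (s * x - s\<^sup>2 / 2)))) A"
      by (subst std_normal_shift, measurable, subst emeasure_density) (auto simp: mult.commute)
    finally show "emeasure (distr std_normal_distribution borel (\<lambda>x. x + s)) A = \<dots>" .
  qed simp
  have "has_bochner_integral (distr std_normal_distribution borel (\<lambda>x. x + s)) g v"
    using assms(2) by (intro has_bochner_integral_distr) auto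
  then have "has_bochner_integral (density std_normal_distribution (\<lambda>x. ennreal (exp (s * x - s\<^sup>2 / 2)))) g v"
    unfolding eq .
  then have i: "integrable (density std_normal_distribution (\<lambda>x. ennreal (exp (s * x - s\<^sup>2 / 2)))) g"
    "(\<integral>x. g x \<partial>density std_normal_distribution (\<lambda>x. ennreal (exp (s * x - s\<^sup>2 / 2)))) = v"
    by (auto simp: has_bochner_integral_iff)
  show ?thesis unfolding has_bochner_integral_iff
    using i by (subst (asm) integrable_density, simp, simp, simp, subst (asm) integral_density)
      (auto simp: mult.commute)
qed

text \<open>With \<open>\<rho> = exp (c x - c\<^sup>2 / 2)\<close> one has \<open>E \<rho>\<^sup>2 = exp c\<^sup>2\<close>, \<open>E \<rho> = 1\<close> and \<open>E (x \<rho>) = c\<close>.\<close>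

lemma std_normal_density_remainder:
  "has_bochner_integral std_normal_distribution (\<lambda>x. (exp (c * x - c\<^sup>2 / 2) - 1 - c * x)\<^sup>2) (exp (c\<^sup>2) - 1 - c\<^sup>2)"
proof -
  interpret prob_space std_normal_distribution by (rule prob_space_std_normal)
  have m0: "has_bochner_integral std_normal_distribution (\<lambda>x. 1::real) 1"
    by (simp add: has_bochner_integral_iff prob_space[simplified])
  have m1: "has_bochner_integral std_normal_distribution (\<lambda>x. x) 0"
    using integrable_std_normal_distribution_moment[of 1] integral_std_normal_distribution_moment_odd[of 1]
    by (simp add: has_bochner_integral_iff)
  have m2: "has_bochner_integral std_normal_distribution (\<lambda>x. x\<^sup>2) 1"
    using integrable_std_normal_distribution_moment[of 2] std_normal_distribution_even_moments(1)[of 1]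
    by (simp add: has_bochner_integral_iff)
  have E0: "has_bochner_integral std_normal_distribution (\<lambda>x. exp (s * x - s\<^sup>2 / 2)) 1" for s
    using std_normal_shift_has_bochner_integral[of "\<lambda>_. 1" s 1] m0 by simp
  have "has_bochner_integral std_normal_distribution (\<lambda>x. x + s) (0 + s * 1)" for s
    using has_bochner_integral_add[OF m1 has_bochner_integral_mult_right[OF m0, of s]] by simp
  then have E1: "has_bochner_integral std_normal_distribution (\<lambda>x. x * exp (s * x - s\<^sup>2 / 2)) s" for s
    using std_normal_shift_has_bochner_integral[of "\<lambda>x. x" s s] by simp
  \<comment> \<open>The square of the density for shift \<open>c\<close> is
    \<open>exp (c\<^sup>2)\<close> times the density for shift \<open>2 * c\<close>, whose integral
    is 1.\<close>
  have sq: "(exp (c * x - c\<^sup>2 / 2))\<^sup>2 = exp (c\<^sup>2) * exp (2 * c * x - (2 * c)\<^sup>2 / 2)" for x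
    by (simp add: power2_eq_square exp_add[symmetric] algebra_simps)
  have "has_bochner_integral std_normal_distribution
     (\<lambda>x. exp (c\<^sup>2) * exp (2 * c * x - (2 * c)\<^sup>2 / 2) + (- 2) * exp (c * x - c\<^sup>2 / 2)
        + (- 2 * c) * (x * exp (c * x - c\<^sup>2 / 2)) + 1 + (2 * c) * x + c\<^sup>2 * x\<^sup>2)
     (exp (c\<^sup>2) * 1 + (- 2) * 1 + (- 2 * c) * c + 1 + (2 * c) * 0 + c\<^sup>2 * 1)"
    by (intro has_bochner_integral_add has_bochner_integral_mult_right E0 E1 m0 m1 m2)
  moreover have "exp (c\<^sup>2) * exp (2 * c * x - (2 * c)\<^sup>2 / 2) + (- 2) * exp (c * x - c\<^sup>2 / 2)
        + (- 2 * c) * (x * exp (c * x - c\<^sup>2 / 2)) + 1 + (2 * c) * x + c\<^sup>2 * x\<^sup>2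
      = (exp (c * x - c\<^sup>2 / 2) - 1 - c * x)\<^sup>2" for x
    unfolding sq[symmetric] by (simp add: power2_eq_square algebra_simps)
  ultimately show ?thesis by (simp add: power2_eq_square)
qed

section \<open>White noise functionals of a Gaussian measure\<close>

locale hilbert_gaussian =
  fixes R :: "'h::{real_inner,banach,second_countable_topology} \<Rightarrow>\<^sub>L 'h" and \<mu> :: "'h measure"
  assumes R: "nonneg_selfadjoint R" and prob: "prob_space \<mu>" and sets_\<mu>: "sets \<mu> = sets borel"
    and char: "\<And>h. (\<integral>y. iexp (inner h y) \<partial>\<mu>) = exp (- complex_of_real ((norm (R h))\<^sup>2) / 2)"
begin

sublocale prob_space \<mu> by (rule prob)

lemmas [measurable_cong] = sets_\<mu>

lemma measurable_\<mu>: "borel_measurable \<mu> = borel_measurable borel"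
  by (rule measurable_cong_sets) (simp_all add: sets_\<mu>)

text \<open>\<open>W\<close> stands for \<open>y \<mapsto> \<langle>h, R\<^sup>-\<^sup>1 y\<rangle>\<close>.\<close>

definition white_noise :: "'h \<Rightarrow> ('h \<Rightarrow> real) \<Rightarrow> bool" where
  "white_noise h W \<longleftrightarrow> W \<in> borel_measurable borel \<and> (\<exists>v :: nat \<Rightarrow> 'h. (\<lambda>n. R (v n)) \<longlonglongrightarrow> h \<and>
     (\<lambda>n. \<integral>\<^sup>+y. ennreal ((inner (v n) y - W y)\<^sup>2) \<partial>\<mu>) \<longlonglongrightarrow> 0)"

lemma white_noise_measurable: "white_noise h W \<Longrightarrow> W \<in> borel_measurable borel"
  by (simp add: white_noise_def)

lemma white_noise_range: "white_noise (R v) (inner v)"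
  unfolding white_noise_def by (intro conjI exI[of _ "\<lambda>_. v"]) auto

lemma white_noise_lincomb:
  assumes "white_noise h W" "white_noise h' W'"
  shows "white_noise (a *\<^sub>R h + b *\<^sub>R h') (\<lambda>y. a * W y + b * W' y)"
proof -
  from assms obtain v v' :: "nat \<Rightarrow> 'h" where [measurable]: "W \<in> borel_measurable borel" "W' \<in> borel_measurable borel"
    and v: "(\<lambda>n. R (v n)) \<longlonglongrightarrow> h" "(\<lambda>n. \<integral>\<^sup>+y. ennreal ((inner (v n) y - W y)\<^sup>2) \<partial>\<mu>) \<longlonglongrightarrow> 0"
    and v': "(\<lambda>n. R (v' n)) \<longlonglongrightarrow> h'" "(\<lambda>n. \<integral>\<^sup>+y. ennreal ((inner (v' n) y - W' y)\<^sup>2) \<partial>\<mu>) \<longlonglongrightarrow> 0"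
    unfolding white_noise_def by blast
  have cm: "(\<integral>\<^sup>+y. ennreal ((norm (c * f y))\<^sup>2) \<partial>\<mu>) = ennreal (c\<^sup>2) * (\<integral>\<^sup>+y. ennreal ((f y)\<^sup>2) \<partial>\<mu>)"
    if [measurable]: "f \<in> borel_measurable borel" for c :: real and f
    by (subst nn_integral_cmult[symmetric]) (auto simp: power_mult_distrib ennreal_mult)
  have le: "(\<integral>\<^sup>+y. ennreal ((inner (a *\<^sub>R v n + b *\<^sub>R v' n) y - (a * W y + b * W' y))\<^sup>2) \<partial>\<mu>)
      \<le> 2 * (ennreal (a\<^sup>2) * (\<integral>\<^sup>+y. ennreal ((inner (v n) y - W y)\<^sup>2) \<partial>\<mu>))
        + 2 * (ennreal (b\<^sup>2) * (\<integral>\<^sup>+y. ennreal ((inner (v' n) y - W' y)\<^sup>2) \<partial>\<mu>))" for n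
  proof -
    have "inner (a *\<^sub>R v n + b *\<^sub>R v' n) y - (a * W y + b * W' y)
        = a * (inner (v n) y - W y) + b * (inner (v' n) y - W' y)" for y
      by (simp add: inner_simps algebra_simps)
    then have "(\<integral>\<^sup>+y. ennreal ((inner (a *\<^sub>R v n + b *\<^sub>R v' n) y - (a * W y + b * W' y))\<^sup>2) \<partial>\<mu>)
        = (\<integral>\<^sup>+y. ennreal ((norm (a * (inner (v n) y - W y) + b * (inner (v' n) y - W' y)))\<^sup>2) \<partial>\<mu>)"
      by simp
    also have "\<dots> \<le> 2 * (\<integral>\<^sup>+y. ennreal ((norm (a * (inner (v n) y - W y)))\<^sup>2) \<partial>\<mu>)
        + 2 * (\<integral>\<^sup>+y. ennreal ((norm (b * (inner (v' n) y - W' y)))\<^sup>2) \<partial>\<mu>)"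
      by (rule nn_integral_power2_norm_add_le) measurable
    finally show ?thesis by (subst (asm) (1 2) cm) auto
  qed
  have "(\<lambda>n. 2 * (ennreal (a\<^sup>2) * (\<integral>\<^sup>+y. ennreal ((inner (v n) y - W y)\<^sup>2) \<partial>\<mu>))
        + 2 * (ennreal (b\<^sup>2) * (\<integral>\<^sup>+y. ennreal ((inner (v' n) y - W' y)\<^sup>2) \<partial>\<mu>)))
      \<longlonglongrightarrow> 2 * (ennreal (a\<^sup>2) * 0) + 2 * (ennreal (b\<^sup>2) * 0)"
    by (intro tendsto_add ennreal_tendsto_cmult v v') auto
  then have lim: "(\<lambda>n. 2 * (ennreal (a\<^sup>2) * (\<integral>\<^sup>+y. ennreal ((inner (v n) y - W y)\<^sup>2) \<partial>\<mu>))
        + 2 * (ennreal (b\<^sup>2) * (\<integral>\<^sup>+y. ennreal ((inner (v' n) y - W' y)\<^sup>2) \<partial>\<mu>))) \<longlonglongrightarrow> 0" by simp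
  have "(\<lambda>n. \<integral>\<^sup>+y. ennreal ((inner (a *\<^sub>R v n + b *\<^sub>R v' n) y - (a * W y + b * W' y))\<^sup>2) \<partial>\<mu>) \<longlonglongrightarrow> 0"
    by (rule tendsto_sandwich[OF _ _ tendsto_const lim]) (intro always_eventually allI zero_le le)+
  moreover have "(\<lambda>n. R (a *\<^sub>R v n + b *\<^sub>R v' n)) \<longlonglongrightarrow> a *\<^sub>R h + b *\<^sub>R h'"
    unfolding blinfun.bilinear_simps by (intro tendsto_intros v v')
  ultimately show ?thesis
    unfolding white_noise_def by (intro conjI exI[of _ "\<lambda>n. a *\<^sub>R v n + b *\<^sub>R v' n"]) auto
qed

lemma white_noise_scale: "white_noise h W \<Longrightarrow> white_noise (a *\<^sub>R h) (\<lambda>y. a * W y)"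
  using white_noise_lincomb[of h W h W a 0] by simp

text \<open>\<open>iexp\<close> is 1-Lipschitz, so the mean square approximation of \<open>W\<close>
  by \<open>inner (v n)\<close> carries over to Fourier transforms. Those are known from
  \<open>char\<close> and converge with \<open>R (v n)\<close>.\<close>

lemma white_noise_char:
  assumes "white_noise h W"
  shows "(\<integral>y. iexp (W y) \<partial>\<mu>) = exp (- complex_of_real ((norm h)\<^sup>2) / 2)"
proof -
  from assms obtain v :: "nat \<Rightarrow> 'h" where [measurable]: "W \<in> borel_measurable borel"
    and v: "(\<lambda>n. R (v n)) \<longlonglongrightarrow> h" "(\<lambda>n. \<integral>\<^sup>+y. ennreal ((inner (v n) y - W y)\<^sup>2) \<partial>\<mu>) \<longlonglongrightarrow> 0"
    unfolding white_noise_def by blast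
  define r where "r n = cmod ((\<integral>y. iexp (inner (v n) y) \<partial>\<mu>) - (\<integral>y. iexp (W y) \<partial>\<mu>))" for n
  have iexp_diff: "cmod (iexp a - iexp b) \<le> \<bar>a - b\<bar>" for a b :: real
  proof -
    have "iexp a - iexp b = iexp b * (iexp (a - b) - 1)"
      by (simp add: algebra_simps exp_add[symmetric])
    then show ?thesis using iexp_approx1[of "a - b" 0] by (simp add: norm_mult)
  qed
  have "ennreal ((r n)\<^sup>2) \<le> (\<integral>\<^sup>+y. ennreal ((inner (v n) y - W y)\<^sup>2) \<partial>\<mu>)" for n
  proof -
    have int: "integrable \<mu> (\<lambda>y. iexp (inner (v n) y))" "integrable \<mu> (\<lambda>y. iexp (W y))"
      by (auto intro!: integrable_iexp)
    have "ennreal (r n) \<le> (\<integral>\<^sup>+y. ennreal (cmod (iexp (inner (v n) y) - iexp (W y))) \<partial>\<mu>)"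
      unfolding r_def Bochner_Integration.integral_diff[OF int, symmetric]
      by (rule integral_norm_bound_ennreal[OF Bochner_Integration.integrable_diff[OF int]])
    also have "\<dots> \<le> (\<integral>\<^sup>+y. ennreal \<bar>inner (v n) y - W y\<bar> * 1 \<partial>\<mu>)"
      by (intro nn_integral_mono) (simp add: iexp_diff ennreal_leI del: of_real_mult)
    finally have "(ennreal (r n))\<^sup>2 \<le> (\<integral>\<^sup>+y. ennreal \<bar>inner (v n) y - W y\<bar> * 1 \<partial>\<mu>)\<^sup>2"
      by (intro power_mono) auto
    also have "\<dots> \<le> (\<integral>\<^sup>+y. (ennreal \<bar>inner (v n) y - W y\<bar>)\<^sup>2 \<partial>\<mu>) * (\<integral>\<^sup>+y. 1\<^sup>2 \<partial>\<mu>)"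
      by (rule Cauchy_Schwarz_nn_integral) measurable
    also have "\<dots> = (\<integral>\<^sup>+y. ennreal ((inner (v n) y - W y)\<^sup>2) \<partial>\<mu>)"
      by (simp add: emeasure_space_1 ennreal_power)
    finally show ?thesis by (simp add: ennreal_power r_def)
  qed
  then have "(\<lambda>n. ennreal ((r n)\<^sup>2)) \<longlonglongrightarrow> 0"
    by (intro tendsto_sandwich[OF _ _ tendsto_const v(2)] always_eventually allI zero_le)
  then have "(\<lambda>n. (r n)\<^sup>2) \<longlonglongrightarrow> 0" by (simp add: ennreal_tendsto_0_iff)
  then have "r \<longlonglongrightarrow> 0" by simp
  then have "(\<lambda>n. (\<integral>y. iexp (inner (v n) y) \<partial>\<mu>)) \<longlonglongrightarrow> (\<integral>y. iexp (W y) \<partial>\<mu>)"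
    unfolding r_def by (simp add: tendsto_norm_zero_iff LIM_zero_iff)
  moreover have "(\<lambda>n. (\<integral>y. iexp (inner (v n) y) \<partial>\<mu>)) \<longlonglongrightarrow> exp (- complex_of_real ((norm h)\<^sup>2) / 2)"
    unfolding char by (intro tendsto_intros v) auto
  ultimately show ?thesis by (rule LIMSEQ_unique)
qed

lemma white_noise_char_scaled:
  "white_noise h W \<Longrightarrow> (\<integral>y. iexp (t * W y) \<partial>\<mu>) = exp (- complex_of_real ((t * norm h)\<^sup>2) / 2)"
  using white_noise_char[OF white_noise_scale, of h W t] by (simp add: power_mult_distrib)

lemma white_noise_law:
  assumes "white_noise h W"
  shows "distr \<mu> borel W = distr std_normal_distribution borel (\<lambda>x. norm h * x)"
  by (rule normal_law[OF prob _ white_noise_char_scaled[OF assms]])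
    (simp add: measurable_\<mu> white_noise_measurable[OF assms])

lemma white_noise_L2:
  assumes "white_noise h W"
  shows "(\<integral>\<^sup>+y. ennreal ((W y)\<^sup>2) \<partial>\<mu>) = ennreal ((norm h)\<^sup>2)"
  by (rule normal_law_L2[OF prob _ white_noise_char_scaled[OF assms]])
    (simp add: measurable_\<mu> white_noise_measurable[OF assms])

lemma white_noise_L2_integral:
  assumes "white_noise h W"
  shows "has_bochner_integral \<mu> (\<lambda>y. (W y)\<^sup>2) ((norm h)\<^sup>2)"
  using white_noise_L2[OF assms] white_noise_measurable[OF assms]
  by (intro has_bochner_integral_nn_integral) (auto simp: measurable_\<mu>)

end

section \<open>The Cameron--Martin formula and moments\<close>

context hilbert_gaussian
begin

text \<open>Resampling the component of \<open>y\<close> in the direction \<open>R u\<close> by an independent standard normal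
  variable \<open>\<xi>\<close> preserves \<open>\<mu>\<close> and turns \<open>W\<close> into \<open>\<xi>\<close>; the Cameron--Martin formula then reduces to the
  one-dimensional one.\<close>

lemma cameron_martin_unit:
  assumes W: "white_noise u W" and u: "norm u = 1" and f[measurable]: "f \<in> borel_measurable borel"
  shows "(\<integral>\<^sup>+y. f (y + s *\<^sub>R R u) \<partial>\<mu>) = (\<integral>\<^sup>+y. f y * ennreal (exp (s * W y - s\<^sup>2 / 2)) \<partial>\<mu>)"
proof -
  interpret G: prob_space std_normal_distribution by (rule prob_space_std_normal)
  interpret P: pair_prob_space \<mu> std_normal_distribution ..
  let ?P = "\<mu> \<Otimes>\<^sub>M std_normal_distribution"
  note white_noise_measurable[OF W, measurable]
  define T where "T = (\<lambda>(y, \<xi>). y - W y *\<^sub>R R u + \<xi> *\<^sub>R R u)"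
  have T[measurable]: "T \<in> borel_measurable ?P" unfolding T_def by measurable
  have inner_T: "inner v (T (y, \<xi>)) = (inner v y - inner (R v) u * W y) + inner (R v) u * \<xi>" for v y \<xi>
    by (simp add: T_def inner_simps nonneg_selfadjoint_inner[OF R])
  have law: "distr ?P borel T = \<mu>"
  proof (rule measure_eqI_char_functional)
    show "prob_space (distr ?P borel T)" by (rule P.prob_space_distr) measurable
    show "prob_space \<mu>" by (rule prob)
    show "sets \<mu> = sets borel" by (rule sets_\<mu>)
    fix k
    \<comment> \<open>\<open>a *\<^sub>R u\<close> is the projection of \<open>R k\<close> to the
      unit vector \<open>u\<close>. Removing the \<open>W\<close> part leaves variance
      \<open>(norm (R k - a *\<^sub>R u))\<^sup>2\<close>, the fresh variable adds
      \<open>a\<^sup>2\<close>, and Pythagoras restores the original variance.\<close>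
    define a where "a = inner (R k) u"
    have "white_noise (1 *\<^sub>R R k + (- a) *\<^sub>R u) (\<lambda>y. 1 * inner k y + (- a) * W y)"
      by (intro white_noise_lincomb white_noise_range W)
    from white_noise_char[OF this]
    have c1: "(\<integral>y. iexp (inner k y - a * W y) \<partial>\<mu>) = exp (- complex_of_real ((norm (R k - a *\<^sub>R u))\<^sup>2) / 2)"
      by (simp del: of_real_diff of_real_mult of_real_power)
    have nrm: "(norm (R k - a *\<^sub>R u))\<^sup>2 + a\<^sup>2 = (norm (R k))\<^sup>2"
      using u unfolding a_def power2_norm_eq_inner inner_diff_left inner_diff_right
      by (simp add: inner_commute power2_eq_square norm_eq_1)
    have "(\<integral>y. iexp (inner k y) \<partial>distr ?P borel T) = (\<integral>p. iexp (inner k (T p)) \<partial>?P)"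
      by (subst integral_distr) auto
    also have "\<dots> = (\<integral>y. (\<integral>\<xi>. iexp (inner k (T (y, \<xi>))) \<partial>std_normal_distribution) \<partial>\<mu>)"
      by (rule P.integral_fst'[symmetric], rule P.integrable_const_bound[where B = 1]) auto
    also have "\<dots> = (\<integral>y. (\<integral>\<xi>. iexp (inner k y - a * W y) * iexp (a * \<xi>) \<partial>std_normal_distribution) \<partial>\<mu>)"
      unfolding inner_T a_def[symmetric] by (simp only: of_real_add distrib_left exp_add)
    also have "\<dots> = (\<integral>y. iexp (inner k y - a * W y) * exp (- complex_of_real (a\<^sup>2) / 2) \<partial>\<mu>)"
      by (simp only: integral_mult_right_zero std_normal_iexp)
    also have "\<dots> = exp (- complex_of_real ((norm (R k - a *\<^sub>R u))\<^sup>2) / 2) * exp (- complex_of_real (a\<^sup>2) / 2)"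
      by (simp only: integral_mult_left_zero c1)
    also have "\<dots> = exp (- complex_of_real ((norm (R k))\<^sup>2) / 2)"
      unfolding exp_add[symmetric] nrm[symmetric] by (simp add: field_simps)
    finally show "(\<integral>y. iexp (inner k y) \<partial>distr ?P borel T) = (\<integral>y. iexp (inner k y) \<partial>\<mu>)"
      by (simp only: char)
  qed simp
  from W obtain v :: "nat \<Rightarrow> 'h" where
    v: "(\<lambda>n. R (v n)) \<longlonglongrightarrow> u" "(\<lambda>n. \<integral>\<^sup>+y. ennreal ((inner (v n) y - W y)\<^sup>2) \<partial>\<mu>) \<longlonglongrightarrow> 0"
    unfolding white_noise_def by blast
  define D where "D n = (\<integral>\<^sup>+y. ennreal ((inner (v n) y - W y)\<^sup>2) \<partial>\<mu>)" for n
  define c where "c n = 1 - inner (R (v n)) u" for n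
  have pair_fst: "(\<integral>\<^sup>+p. g (fst p) \<partial>?P) = (\<integral>\<^sup>+y. g y \<partial>\<mu>)"
    if [measurable]: "g \<in> borel_measurable borel" for g :: "'h \<Rightarrow> ennreal"
    by (subst G.nn_integral_fst[symmetric]) (auto simp: G.emeasure_space_1[simplified])
  have pair_snd: "(\<integral>\<^sup>+p. g (snd p) \<partial>?P) = (\<integral>\<^sup>+x. g x \<partial>std_normal_distribution)"
    if [measurable]: "g \<in> borel_measurable borel" for g :: "real \<Rightarrow> ennreal"
    by (subst G.nn_integral_fst[symmetric]) (auto simp: emeasure_space_1)
  have fin: "(\<integral>\<^sup>+p. ennreal ((norm (W (fst p) - snd p))\<^sup>2) \<partial>?P) \<le> 4"
  proof -
    have "(\<integral>\<^sup>+p. ennreal ((norm (W (fst p) + - snd p))\<^sup>2) \<partial>?P)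
        \<le> 2 * (\<integral>\<^sup>+p. ennreal ((norm (W (fst p)))\<^sup>2) \<partial>?P) + 2 * (\<integral>\<^sup>+p. ennreal ((norm (- snd p))\<^sup>2) \<partial>?P)"
      by (rule nn_integral_power2_norm_add_le) measurable
    also have "(\<integral>\<^sup>+p. ennreal ((norm (W (fst p)))\<^sup>2) \<partial>?P) = 1"
      using white_noise_L2[OF W] u by (simp add: pair_fst[of "\<lambda>y. ennreal ((W y)\<^sup>2)"])
    also have "(\<integral>\<^sup>+p. ennreal ((norm (- snd p))\<^sup>2) \<partial>?P) = 1"
      using std_normal_even_moment[of 1 1] by (simp add: pair_snd[of "\<lambda>y. ennreal (y\<^sup>2)"])
    finally show ?thesis by simp
  qed
  \<comment> \<open>\<open>W\<close> is merely a limit of the functionals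
    \<open>inner (v n)\<close>, so \<open>W (T p)\<close> cannot be computed directly. As
    \<open>T\<close> preserves the measure, \<open>inner (v n) (T p)\<close> approximates it as well
    as before, and linearity shows that this is close to \<open>snd p\<close>: the coefficient
    \<open>c n\<close> tends to \<open>1 - inner u u = 0\<close>.\<close>
  have bound: "(\<integral>\<^sup>+p. ennreal ((W (T p) - snd p)\<^sup>2) \<partial>?P)
      \<le> 2 * D n + 2 * (2 * D n + 2 * (ennreal ((c n)\<^sup>2) * 4))" for n
  proof -
    have "(\<integral>\<^sup>+p. ennreal ((W (T p) - snd p)\<^sup>2) \<partial>?P)
        = (\<integral>\<^sup>+p. ennreal ((norm ((W (T p) - inner (v n) (T p)) + (inner (v n) (T p) - snd p)))\<^sup>2) \<partial>?P)"
      by simp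
    also have "\<dots> \<le> 2 * (\<integral>\<^sup>+p. ennreal ((norm (W (T p) - inner (v n) (T p)))\<^sup>2) \<partial>?P)
        + 2 * (\<integral>\<^sup>+p. ennreal ((norm (inner (v n) (T p) - snd p))\<^sup>2) \<partial>?P)"
      by (rule nn_integral_power2_norm_add_le) measurable
    also have "(\<integral>\<^sup>+p. ennreal ((norm (W (T p) - inner (v n) (T p)))\<^sup>2) \<partial>?P)
        = (\<integral>\<^sup>+y. ennreal ((norm (W y - inner (v n) y))\<^sup>2) \<partial>distr ?P borel T)"
      by (subst nn_integral_distr) auto
    also have "\<dots> = D n"
      unfolding law D_def by (simp add: power2_commute)
    also have "(\<integral>\<^sup>+p. ennreal ((norm (inner (v n) (T p) - snd p))\<^sup>2) \<partial>?P)
        = (\<integral>\<^sup>+p. ennreal ((norm ((inner (v n) (fst p) - W (fst p)) + c n * (W (fst p) - snd p)))\<^sup>2) \<partial>?P)"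
    proof (rule nn_integral_cong)
      fix p
      have "inner (v n) (T p) - snd p = (inner (v n) (fst p) - W (fst p)) + c n * (W (fst p) - snd p)"
        by (cases p) (simp add: inner_T c_def algebra_simps)
      then show "ennreal ((norm (inner (v n) (T p) - snd p))\<^sup>2)
          = ennreal ((norm ((inner (v n) (fst p) - W (fst p)) + c n * (W (fst p) - snd p)))\<^sup>2)" by simp
    qed
    also have "\<dots> \<le> 2 * (\<integral>\<^sup>+p. ennreal ((norm (inner (v n) (fst p) - W (fst p)))\<^sup>2) \<partial>?P)
        + 2 * (\<integral>\<^sup>+p. ennreal ((norm (c n * (W (fst p) - snd p)))\<^sup>2) \<partial>?P)"
      by (rule nn_integral_power2_norm_add_le) measurable
    also have "(\<integral>\<^sup>+p. ennreal ((norm (inner (v n) (fst p) - W (fst p)))\<^sup>2) \<partial>?P) = D n"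
      by (simp add: pair_fst[of "\<lambda>y. ennreal ((inner (v n) y - W y)\<^sup>2)"] D_def)
    also have "(\<integral>\<^sup>+p. ennreal ((norm (c n * (W (fst p) - snd p)))\<^sup>2) \<partial>?P)
        = ennreal ((c n)\<^sup>2) * (\<integral>\<^sup>+p. ennreal ((norm (W (fst p) - snd p))\<^sup>2) \<partial>?P)"
      by (subst nn_integral_cmult[symmetric]) (auto simp: power_mult_distrib ennreal_mult)
    finally show ?thesis
      using fin by (meson add_left_mono mult_left_mono order_trans zero_le)
  qed
  have "c \<longlonglongrightarrow> 1 - inner u u" unfolding c_def by (intro tendsto_intros v)
  then have c0: "c \<longlonglongrightarrow> 0" using u by (simp add: norm_eq_1)
  have "(\<lambda>n. ennreal ((c n)\<^sup>2)) \<longlonglongrightarrow> ennreal (0\<^sup>2)" by (intro tendsto_ennrealI tendsto_intros c0)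
  then have c2: "(\<lambda>n. ennreal ((c n)\<^sup>2)) \<longlonglongrightarrow> 0" by simp
  have c4: "(\<lambda>n. ennreal ((c n)\<^sup>2) * 4) \<longlonglongrightarrow> 0 * 4"
    using ennreal_tendsto_cmult[of 4 _ _ sequentially, OF _ c2] by (simp add: mult.commute)
  have "(\<lambda>n. 2 * D n + 2 * (2 * D n + 2 * (ennreal ((c n)\<^sup>2) * 4))) \<longlonglongrightarrow> 2 * 0 + 2 * (2 * 0 + 2 * (0 * 4))"
    using v(2) unfolding D_def[symmetric] by (intro tendsto_add ennreal_tendsto_cmult c4) simp_all
  then have "(\<integral>\<^sup>+p. ennreal ((W (T p) - snd p)\<^sup>2) \<partial>?P) \<le> 2 * 0 + 2 * (2 * 0 + 2 * (0 * 4))"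
    by (rule LIMSEQ_le_const) (intro exI allI impI bound)
  then have "(\<integral>\<^sup>+p. ennreal ((W (T p) - snd p)\<^sup>2) \<partial>?P) = 0" by simp
  then have "AE p in ?P. ennreal ((W (T p) - snd p)\<^sup>2) = 0"
    by (subst (asm) nn_integral_0_iff_AE) measurable
  then have AE: "AE p in ?P. W (T p) = snd p" by simp
  have "(\<integral>\<^sup>+y. f (y + s *\<^sub>R R u) \<partial>\<mu>) = (\<integral>\<^sup>+y. f (y + s *\<^sub>R R u) \<partial>distr ?P borel T)"
    by (simp only: law)
  also have "\<dots> = (\<integral>\<^sup>+p. f (T p + s *\<^sub>R R u) \<partial>?P)" by (subst nn_integral_distr) auto
  also have "\<dots> = (\<integral>\<^sup>+y. (\<integral>\<^sup>+\<xi>. f (T (y, \<xi>) + s *\<^sub>R R u) \<partial>std_normal_distribution) \<partial>\<mu>)"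
    by (rule G.nn_integral_fst[symmetric]) measurable
  also have "\<dots> = (\<integral>\<^sup>+y. (\<integral>\<^sup>+\<xi>. f (T (y, \<xi>)) * ennreal (exp (s * \<xi> - s\<^sup>2 / 2)) \<partial>std_normal_distribution) \<partial>\<mu>)"
  proof (rule nn_integral_cong)
    fix y
    \<comment> \<open>For fixed \<open>y\<close> the variable \<open>\<xi>\<close> enters
      \<open>T\<close> only through a multiple of \<open>R u\<close>, so the shift by
      \<open>s *\<^sub>R R u\<close> is a translation of \<open>\<xi>\<close> by
      \<open>s\<close>.\<close>
    have "f (T (y, \<xi>) + s *\<^sub>R R u) = (\<lambda>\<xi>. f (T (y, \<xi>))) (\<xi> + s)" for \<xi>
      by (simp add: T_def algebra_simps)
    moreover have "(\<lambda>\<xi>. f (T (y, \<xi>))) \<in> borel_measurable borel"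
      unfolding T_def prod.case by measurable
    ultimately show "(\<integral>\<^sup>+\<xi>. f (T (y, \<xi>) + s *\<^sub>R R u) \<partial>std_normal_distribution)
      = (\<integral>\<^sup>+\<xi>. f (T (y, \<xi>)) * ennreal (exp (s * \<xi> - s\<^sup>2 / 2)) \<partial>std_normal_distribution)"
      using std_normal_shift[of "\<lambda>\<xi>. f (T (y, \<xi>))" s] by simp
  qed
  also have "\<dots> = (\<integral>\<^sup>+y. (\<integral>\<^sup>+\<xi>. (\<lambda>p. f (T p) * ennreal (exp (s * snd p - s\<^sup>2 / 2))) (y, \<xi>) \<partial>std_normal_distribution) \<partial>\<mu>)"
    by simp
  also have "\<dots> = (\<integral>\<^sup>+p. f (T p) * ennreal (exp (s * snd p - s\<^sup>2 / 2)) \<partial>?P)"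
    by (rule G.nn_integral_fst) measurable
  also have "\<dots> = (\<integral>\<^sup>+p. f (T p) * ennreal (exp (s * W (T p) - s\<^sup>2 / 2)) \<partial>?P)"
    by (rule nn_integral_cong_AE) (use AE in eventually_elim, simp)
  also have "\<dots> = (\<integral>\<^sup>+y. f y * ennreal (exp (s * W y - s\<^sup>2 / 2)) \<partial>distr ?P borel T)"
    by (subst nn_integral_distr) auto
  finally show ?thesis by (simp only: law)
qed

text \<open>Rescaling to a unit vector leaves out \<open>u = 0\<close>; there \<open>W\<close> has
  zero variance, so it vanishes almost everywhere and the density is 1.\<close>

lemma cameron_martin:
  assumes W: "white_noise u W" and f[measurable]: "f \<in> borel_measurable borel"
  shows "(\<integral>\<^sup>+y. f (y + R u) \<partial>\<mu>) = (\<integral>\<^sup>+y. f y * ennreal (exp (W y - (norm u)\<^sup>2 / 2)) \<partial>\<mu>)"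
proof (cases "u = 0")
  case True
  note white_noise_measurable[OF W, measurable]
  have "(\<integral>\<^sup>+y. ennreal ((W y)\<^sup>2) \<partial>\<mu>) = 0" using white_noise_L2[OF W] True by simp
  then have "AE y in \<mu>. ennreal ((W y)\<^sup>2) = 0"
    by (subst (asm) nn_integral_0_iff_AE) measurable
  then have "AE y in \<mu>. W y = 0" by simp
  then show ?thesis using True by (intro nn_integral_cong_AE) auto
next
  case False
  have "norm ((1 / norm u) *\<^sub>R u) = 1" using False by simp
  from cameron_martin_unit[OF white_noise_scale[OF W] this f, of "norm u"] False
  show ?thesis by (simp add: blinfun.bilinear_simps)
qed

lemma density_remainder:
  assumes W: "white_noise u W"
  shows "has_bochner_integral \<mu> (\<lambda>y. (exp (W y - (norm u)\<^sup>2 / 2) - 1 - W y)\<^sup>2)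
    (exp ((norm u)\<^sup>2) - 1 - (norm u)\<^sup>2)"
proof -
  note white_noise_measurable[OF W, measurable]
  have "has_bochner_integral (distr std_normal_distribution borel (\<lambda>x. norm u * x))
      (\<lambda>x. (exp (x - (norm u)\<^sup>2 / 2) - 1 - x)\<^sup>2) (exp ((norm u)\<^sup>2) - 1 - (norm u)\<^sup>2)"
    by (intro has_bochner_integral_distr std_normal_density_remainder) auto
  then have "has_bochner_integral (distr \<mu> borel W)
      (\<lambda>x. (exp (x - (norm u)\<^sup>2 / 2) - 1 - x)\<^sup>2) (exp ((norm u)\<^sup>2) - 1 - (norm u)\<^sup>2)"
    unfolding white_noise_law[OF W] .
  then show ?thesis
    by (simp add: has_bochner_integral_iff integrable_distr_eq integral_distr)
qed

text \<open>After the change of measure the remainder is the integral of \<open>g\<close> against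
  \<open>\<rho> - 1 - W\<close>, whose \<open>L\<^sup>2\<close> norm is known exactly. For
  \<open>s *\<^sub>R u\<close> in place of \<open>u\<close> that norm is of order
  \<open>s\<^sup>2\<close>, which survives division by \<open>s\<close>.\<close>

lemma shift_remainder_bound:
  fixes g :: "'h \<Rightarrow> real"
  assumes W: "white_noise u W" and g[measurable]: "g \<in> borel_measurable borel"
    and g2: "integrable \<mu> (\<lambda>y. (g y)\<^sup>2)"
  shows "integrable \<mu> (\<lambda>y. g (y + R u))" "integrable \<mu> g" "integrable \<mu> (\<lambda>y. g y * W y)"
    "\<bar>(\<integral>y. g (y + R u) \<partial>\<mu>) - (\<integral>y. g y \<partial>\<mu>) - (\<integral>y. g y * W y \<partial>\<mu>)\<bar>
      \<le> sqrt (\<integral>y. (g y)\<^sup>2 \<partial>\<mu>) * sqrt (exp ((norm u)\<^sup>2) - 1 - (norm u)\<^sup>2)"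
proof -
  note white_noise_measurable[OF W, measurable]
  define \<rho> where "\<rho> y = exp (W y - (norm u)\<^sup>2 / 2)" for y
  have [measurable]: "\<rho> \<in> borel_measurable borel" unfolding \<rho>_def by measurable
  have eq: "distr \<mu> borel (\<lambda>y. y + R u) = density \<mu> (\<lambda>y. ennreal (\<rho> y))"
  proof (rule measure_eqI)
    fix A assume "A \<in> sets (distr \<mu> borel (\<lambda>y. y + R u))"
    then have [measurable]: "A \<in> sets borel" by simp
    have "emeasure (distr \<mu> borel (\<lambda>y. y + R u)) A
        = (\<integral>\<^sup>+x. indicator A x \<partial>distr \<mu> borel (\<lambda>y. y + R u))" by simp
    also have "\<dots> = (\<integral>\<^sup>+y. indicator A (y + R u) \<partial>\<mu>)"
      by (subst nn_integral_distr) auto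
    also have "\<dots> = (\<integral>\<^sup>+y. indicator A y * ennreal (\<rho> y) \<partial>\<mu>)"
      unfolding \<rho>_def by (rule cameron_martin[OF W]) measurable
    also have "\<dots> = emeasure (density \<mu> (\<lambda>y. ennreal (\<rho> y))) A"
      by (subst emeasure_density) (auto simp: mult.commute)
    finally show "emeasure (distr \<mu> borel (\<lambda>y. y + R u)) A = \<dots>" .
  qed (simp add: sets_\<mu>)
  have rem: "integrable \<mu> (\<lambda>y. (\<rho> y - 1 - W y)\<^sup>2)"
    "(\<integral>y. (\<rho> y - 1 - W y)\<^sup>2 \<partial>\<mu>) = exp ((norm u)\<^sup>2) - 1 - (norm u)\<^sup>2"
    using density_remainder[OF W] unfolding \<rho>_def has_bochner_integral_iff by auto
  have gm: "g \<in> borel_measurable \<mu>" "W \<in> borel_measurable \<mu>" "(\<lambda>y. \<rho> y - 1 - W y) \<in> borel_measurable \<mu>"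
    by measurable
  show int_g: "integrable \<mu> g"
    using cauchy_schwarz_integral(1)[OF gm(1) _ g2, of "\<lambda>_. 1"] by simp
  show int_gW: "integrable \<mu> (\<lambda>y. g y * W y)"
    using white_noise_L2_integral[OF W] by (intro cauchy_schwarz_integral(1) gm g2) (simp add: has_bochner_integral_iff)
  have int_gr: "integrable \<mu> (\<lambda>y. g y * (\<rho> y - 1 - W y))"
    by (intro cauchy_schwarz_integral(1) gm g2 rem)
  have "integrable \<mu> (\<lambda>y. g y * (\<rho> y - 1 - W y) + g y + g y * W y)"
    by (intro Bochner_Integration.integrable_add int_g int_gW int_gr)
  moreover have split: "g y * (\<rho> y - 1 - W y) + g y + g y * W y = \<rho> y * g y" for y
    by (simp add: algebra_simps)
  ultimately have int_rg: "integrable \<mu> (\<lambda>y. \<rho> y * g y)" by simp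
  then have "integrable (distr \<mu> borel (\<lambda>y. y + R u)) g"
    unfolding eq by (subst integrable_density) (auto simp: \<rho>_def)
  then show int_s: "integrable \<mu> (\<lambda>y. g (y + R u))"
    by (subst (asm) integrable_distr_eq) auto
  have "(\<integral>y. g (y + R u) \<partial>\<mu>) = (\<integral>y. g y \<partial>distr \<mu> borel (\<lambda>y. y + R u))"
    by (subst integral_distr) auto
  also have "\<dots> = (\<integral>y. \<rho> y * g y \<partial>\<mu>)"
    unfolding eq by (subst integral_density) (auto simp: \<rho>_def)
  also have "\<dots> = (\<integral>y. g y * (\<rho> y - 1 - W y) \<partial>\<mu>) + (\<integral>y. g y \<partial>\<mu>) + (\<integral>y. g y * W y \<partial>\<mu>)"
    unfolding split[symmetric] by (simp add: int_g int_gW int_gr)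
  finally have "(\<integral>y. g (y + R u) \<partial>\<mu>) - (\<integral>y. g y \<partial>\<mu>) - (\<integral>y. g y * W y \<partial>\<mu>)
      = (\<integral>y. g y * (\<rho> y - 1 - W y) \<partial>\<mu>)" by simp
  then show "\<bar>(\<integral>y. g (y + R u) \<partial>\<mu>) - (\<integral>y. g y \<partial>\<mu>) - (\<integral>y. g y * W y \<partial>\<mu>)\<bar>
      \<le> sqrt (\<integral>y. (g y)\<^sup>2 \<partial>\<mu>) * sqrt (exp ((norm u)\<^sup>2) - 1 - (norm u)\<^sup>2)"
    using cauchy_schwarz_integral(2)[OF gm(1,3) g2 rem(1)] by (simp add: rem(2))
qed

end

section \<open>Moments of the norm under a Gaussian measure\<close>

text \<open>Jensen for \<open>x ^ p\<close> at the points \<open>a i / q i\<close> with weights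
  \<open>q i / S\<close>. The weights will be the coordinate variances: if the \<open>p\<close>-th
  moment of \<open>a i\<close> is proportional to \<open>q i ^ p\<close>, the right side integrates
  to a multiple of the sum of the \<open>q i\<close>, however many terms there are.\<close>

lemma jensen_power:
  fixes a q :: "'i \<Rightarrow> real"
  assumes I: "finite I" and q: "\<And>i. i \<in> I \<Longrightarrow> q i > 0" and a: "\<And>i. i \<in> I \<Longrightarrow> a i \<ge> 0"
    and T: "(\<Sum>i\<in>I. q i) \<le> T" and p: "p \<ge> 1"
  shows "(\<Sum>i\<in>I. a i) ^ p \<le> T ^ (p - 1) * (\<Sum>i\<in>I. a i ^ p / q i ^ (p - 1))"
proof (cases "I = {}")
  case True
  then show ?thesis using p by (simp add: power_0_left)
next
  case False
  define S where "S = (\<Sum>i\<in>I. q i)"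
  have S: "S > 0" unfolding S_def using I False q by (rule sum_pos)
  have conv: "convex_on {0..} (\<lambda>x::real. x ^ p)"
    using convex_power_odd[of p] convex_on_subset[OF convex_power_even[of p]] by (cases "even p") auto
  have "(\<Sum>i\<in>I. (q i / S) *\<^sub>R (a i / q i)) ^ p \<le> (\<Sum>i\<in>I. (q i / S) * (a i / q i) ^ p)"
    using I False conv
  proof (rule convex_on_sum)
    show "(\<Sum>i\<in>I. q i / S) = 1" using S by (simp add: sum_divide_distrib[symmetric] S_def)
    show "0 \<le> q i / S" "a i / q i \<in> {0..}" if "i \<in> I" for i
      using q[OF that] a[OF that] S by auto
  qed
  also have "(\<Sum>i\<in>I. (q i / S) *\<^sub>R (a i / q i)) = (\<Sum>i\<in>I. a i) / S"
    unfolding sum_divide_distrib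
  proof (intro sum.cong refl)
    show "(q i / S) *\<^sub>R (a i / q i) = a i / S" if "i \<in> I" for i using q[OF that] by simp
  qed
  also have "(\<Sum>i\<in>I. (q i / S) * (a i / q i) ^ p) = (\<Sum>i\<in>I. a i ^ p / q i ^ (p - 1)) / S"
    unfolding sum_divide_distrib
  proof (intro sum.cong refl)
    fix i assume "i \<in> I"
    obtain p' where "p = Suc p'" using p by (cases p) auto
    then show "q i / S * (a i / q i) ^ p = a i ^ p / q i ^ (p - 1) / S"
      using q[OF \<open>i \<in> I\<close>] by (simp add: power_divide)
  qed
  finally have "((\<Sum>i\<in>I. a i) / S) ^ p * S ^ p \<le> (\<Sum>i\<in>I. a i ^ p / q i ^ (p - 1)) / S * S ^ p"
    using S by (intro mult_right_mono) auto
  moreover have "S ^ p = S * S ^ (p - 1)" using p by (cases p) auto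
  ultimately have "(\<Sum>i\<in>I. a i) ^ p \<le> S ^ (p - 1) * (\<Sum>i\<in>I. a i ^ p / q i ^ (p - 1))"
    using S by (simp add: power_divide mult.commute)
  also have "\<dots> \<le> T ^ (p - 1) * (\<Sum>i\<in>I. a i ^ p / q i ^ (p - 1))"
    using S T q a by (intro mult_right_mono power_mono sum_nonneg divide_nonneg_nonneg zero_le_power)
      (auto simp: S_def intro: less_imp_le)
  finally show ?thesis .
qed

text \<open>The convention \<open>0\<^sup>0 = 1\<close>, as in \<^const>\<open>weight\<close>.\<close>

definition norm_power :: "real \<Rightarrow> 'a::real_normed_vector \<Rightarrow> real" where
  "norm_power m x = (if m = 0 then 1 else norm x powr m)"

lemma weight_eq: "weight m x = 1 + norm_power m x"
  by (simp add: weight_def norm_power_def)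

lemma norm_power_nonneg: "0 \<le> norm_power m x"
  by (simp add: norm_power_def)

context hilbert_gaussian
begin

text \<open>Each coordinate has \<open>p\<close>-th moment \<open>C * q k ^ p\<close> of its square,
  with \<open>C\<close> the standard normal moment of order \<open>2 * p\<close>. Jensen with
  weights \<open>q k\<close> bounds the partial sums by \<open>C * \<tau> ^ p\<close>, and Fatou's
  lemma passes to the norm. The sequence \<open>e\<close> need not diagonalise
  \<open>R\<close>.\<close>

lemma norm_moment:
  assumes e: "parseval e" and \<tau>: "(\<lambda>k. (norm (R (e k)))\<^sup>2) sums \<tau>" and p: "p \<ge> 1"
  shows "(\<integral>\<^sup>+y. ennreal (norm y ^ (2 * p)) \<partial>\<mu>) \<le> ennreal (fact (2 * p) / (2 ^ p * fact p) * \<tau> ^ p)"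
proof -
  define C :: real where "C = fact (2 * p) / (2 ^ p * fact p)"
  define q where "q k = (norm (R (e k)))\<^sup>2" for k
  define a where "a k y = (inner (e k) y)\<^sup>2" for k y
  have C: "C \<ge> 0" by (simp add: C_def)
  have \<tau>0: "\<tau> \<ge> 0" using sums_le[OF _ sums_zero \<tau>] by simp
  have mom: "(\<integral>\<^sup>+y. ennreal (a k y ^ j) \<partial>\<mu>) = ennreal (fact (2 * j) / (2 ^ j * fact j) * q k ^ j)" for k j
  proof -
    have "(\<integral>\<^sup>+y. ennreal (inner (e k) y ^ (2 * j)) \<partial>\<mu>)
        = (\<integral>\<^sup>+x. ennreal ((norm (R (e k)) * x) ^ (2 * j)) \<partial>std_normal_distribution)"
      by (rule normal_law_nn_integral[OF prob _ white_noise_char_scaled[OF white_noise_range],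
            where f = "\<lambda>x. ennreal (x ^ (2 * j))"]) measurable
    then show ?thesis
      unfolding std_normal_even_moment by (simp add: a_def q_def power_mult)
  qed
  have [measurable]: "a k \<in> borel_measurable borel" for k unfolding a_def by measurable
  have AE: "AE y in \<mu>. \<forall>k. q k = 0 \<longrightarrow> a k y = 0"
  proof (subst AE_all_countable, intro allI)
    fix k
    show "AE y in \<mu>. q k = 0 \<longrightarrow> a k y = 0"
    proof (cases "q k = 0")
      case True
      then have "(\<integral>\<^sup>+y. ennreal (a k y) \<partial>\<mu>) = 0" using mom[of k 1] by simp
      then have "AE y in \<mu>. ennreal (a k y) = 0"
        by (subst (asm) nn_integral_0_iff_AE) measurable
      then show ?thesis by (auto simp: a_def ennreal_eq_0_iff)
    qed auto
  qed
  \<comment> \<open>Jensen divides by the variances, so coordinates of zero variance are dropped;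
    they vanish almost surely.\<close>
  define I where "I n = {k. k < n \<and> q k \<noteq> 0}" for n :: nat
  have I: "finite (I n)" for n by (simp add: I_def)
  have sum_q: "(\<Sum>k\<in>I n. q k) \<le> \<tau>" for n
  proof -
    have "(\<Sum>k\<in>I n. q k) \<le> (\<Sum>k<n. q k)" by (rule sum_mono2) (auto simp: I_def q_def)
    also have "\<dots> \<le> \<tau>"
      using sum_le_suminf[OF sums_summable[OF \<tau>], of "{..<n}"] sums_unique[OF \<tau>] by (simp add: q_def)
    finally show ?thesis .
  qed
  have part: "(\<integral>\<^sup>+y. ennreal ((\<Sum>k<n. a k y) ^ p) \<partial>\<mu>) \<le> ennreal (C * \<tau> ^ p)" for n
  proof -
    have "(\<integral>\<^sup>+y. ennreal ((\<Sum>k<n. a k y) ^ p) \<partial>\<mu>)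
        \<le> (\<integral>\<^sup>+y. (\<Sum>k\<in>I n. ennreal (\<tau> ^ (p - 1) / q k ^ (p - 1)) * ennreal (a k y ^ p)) \<partial>\<mu>)"
    proof (rule nn_integral_mono_AE, use AE in eventually_elim)
      case (elim y)
      have "(\<Sum>k<n. a k y) = (\<Sum>k\<in>I n. a k y)"
        by (rule sum.mono_neutral_right) (use elim in \<open>auto simp: I_def\<close>)
      also have "\<dots> ^ p \<le> \<tau> ^ (p - 1) * (\<Sum>k\<in>I n. a k y ^ p / q k ^ (p - 1))"
        by (rule jensen_power[OF I _ _ sum_q p]) (auto simp: I_def q_def a_def)
      also have "\<dots> = (\<Sum>k\<in>I n. \<tau> ^ (p - 1) / q k ^ (p - 1) * a k y ^ p)"
        by (simp add: sum_distrib_left)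
      finally have "ennreal ((\<Sum>k<n. a k y) ^ p) \<le> ennreal (\<Sum>k\<in>I n. \<tau> ^ (p - 1) / q k ^ (p - 1) * a k y ^ p)"
        by (rule ennreal_leI)
      also have "\<dots> = (\<Sum>k\<in>I n. ennreal (\<tau> ^ (p - 1) / q k ^ (p - 1) * a k y ^ p))"
        using \<tau>0 by (intro sum_ennreal[symmetric]) (auto simp: q_def a_def)
      also have "\<dots> = (\<Sum>k\<in>I n. ennreal (\<tau> ^ (p - 1) / q k ^ (p - 1)) * ennreal (a k y ^ p))"
        using \<tau>0 by (intro sum.cong refl ennreal_mult) (auto simp: q_def a_def)
      finally show ?case .
    qed
    also have "\<dots> = (\<Sum>k\<in>I n. ennreal (\<tau> ^ (p - 1) / q k ^ (p - 1)) * ennreal (C * q k ^ p))"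
      by (subst nn_integral_sum) (auto simp: nn_integral_cmult mom C_def)
    also have "\<dots> = (\<Sum>k\<in>I n. ennreal (C * \<tau> ^ (p - 1) * q k))"
    proof (intro sum.cong refl)
      fix k assume "k \<in> I n"
      then have "q k > 0" by (auto simp: I_def q_def)
      moreover obtain p' where "p = Suc p'" using p by (cases p) auto
      ultimately have "\<tau> ^ (p - 1) / q k ^ (p - 1) * (C * q k ^ p) = C * \<tau> ^ (p - 1) * q k"
        by simp
      then show "ennreal (\<tau> ^ (p - 1) / q k ^ (p - 1)) * ennreal (C * q k ^ p) = ennreal (C * \<tau> ^ (p - 1) * q k)"
        using \<tau>0 C \<open>q k > 0\<close> by (subst ennreal_mult[symmetric]) auto
    qed
    also have "\<dots> = ennreal (\<Sum>k\<in>I n. C * \<tau> ^ (p - 1) * q k)"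
      using \<tau>0 C by (intro sum_ennreal) (auto simp: q_def)
    also have "(\<Sum>k\<in>I n. C * \<tau> ^ (p - 1) * q k) \<le> C * \<tau> ^ (p - 1) * \<tau>"
      unfolding sum_distrib_left[symmetric] using \<tau>0 C sum_q by (intro mult_left_mono) auto
    also have "C * \<tau> ^ (p - 1) * \<tau> = C * \<tau> ^ p" using p by (cases p) auto
    finally show ?thesis by (simp add: ennreal_leI)
  qed
  have "(\<integral>\<^sup>+y. ennreal (norm y ^ (2 * p)) \<partial>\<mu>) = (\<integral>\<^sup>+y. liminf (\<lambda>n. ennreal ((\<Sum>k<n. a k y) ^ p)) \<partial>\<mu>)"
  proof (rule nn_integral_cong)
    fix y
    have "(\<lambda>n. \<Sum>k<n. a k y) \<longlonglongrightarrow> (norm y)\<^sup>2"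
      using e by (simp add: parseval_def sums_def a_def inner_commute)
    then have "(\<lambda>n. ennreal ((\<Sum>k<n. a k y) ^ p)) \<longlonglongrightarrow> ennreal (((norm y)\<^sup>2) ^ p)"
      by (intro tendsto_ennrealI tendsto_intros)
    from lim_imp_Liminf[OF _ this] show "ennreal (norm y ^ (2 * p)) = liminf (\<lambda>n. ennreal ((\<Sum>k<n. a k y) ^ p))"
      by (simp add: power_mult)
  qed
  also have "\<dots> \<le> liminf (\<lambda>n. \<integral>\<^sup>+y. ennreal ((\<Sum>k<n. a k y) ^ p) \<partial>\<mu>)"
    by (rule nn_integral_liminf) measurable
  also have "\<dots> \<le> liminf (\<lambda>n::nat. ennreal (C * \<tau> ^ p))"
    by (intro Liminf_mono always_eventually allI part)
  also have "\<dots> = ennreal (C * \<tau> ^ p)" by (simp add: Liminf_const)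
  finally show ?thesis by (simp add: C_def)
qed

text \<open>The real exponent is reduced to an integer \<open>p \<ge> m\<close> by
  \<open>z powr m \<le> 1 + z ^ p\<close>. Applying this to the normalised
  \<open>z = (norm y)\<^sup>2 / \<tau>\<close> makes both terms scale like
  \<open>\<tau> powr m\<close>, so the constant does not involve \<open>\<tau>\<close>. For
  \<open>\<tau> = 0\<close> and \<open>m > 0\<close> the measure sits at the origin.\<close>

lemma norm_power_moment:
  assumes e: "parseval e" and \<tau>: "(\<lambda>k. (norm (R (e k)))\<^sup>2) sums \<tau>" and m: "m \<ge> 0"
    and p: "p \<ge> 1" "m \<le> real p"
  shows "(\<integral>\<^sup>+y. ennreal ((norm_power m y)\<^sup>2) \<partial>\<mu>)
    \<le> ennreal ((1 + fact (2 * p) / (2 ^ p * fact p)) * norm_power m \<tau>)"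
proof -
  define C :: real where "C = fact (2 * p) / (2 ^ p * fact p)"
  have C: "C \<ge> 0" by (simp add: C_def)
  have \<tau>0: "\<tau> \<ge> 0" using sums_le[OF _ sums_zero \<tau>] by simp
  consider "m = 0" | "m > 0" "\<tau> = 0" | "m > 0" "\<tau> > 0" using m \<tau>0 by linarith
  then show ?thesis
  proof cases
    case 1
    then show ?thesis by (simp add: norm_power_def emeasure_space_1)
  next
    case 2
    have "(\<integral>\<^sup>+y. ennreal (norm y ^ 2) \<partial>\<mu>) = 0" using norm_moment[OF e \<tau>, of 1] 2 by simp
    then have "AE y in \<mu>. ennreal (norm y ^ 2) = 0"
      by (subst (asm) nn_integral_0_iff_AE) measurable
    then have "AE y in \<mu>. y = 0" by (auto simp: ennreal_eq_0_iff)
    then have "(\<integral>\<^sup>+y. ennreal ((norm_power m y)\<^sup>2) \<partial>\<mu>) = (\<integral>\<^sup>+y. 0 \<partial>\<mu>)"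
      using 2 by (intro nn_integral_cong_AE) (auto simp: norm_power_def)
    then show ?thesis by simp
  next
    case 3
    have pw: "(norm_power m y)\<^sup>2 \<le> \<tau> powr m + \<tau> powr m / \<tau> ^ p * norm y ^ (2 * p)" for y :: 'h
    proof -
      define z where "z = (norm y)\<^sup>2 / \<tau>"
      have z: "z \<ge> 0" using 3 by (simp add: z_def)
      have zp: "z powr m \<le> 1 + z ^ p"
      proof (cases "z \<le> 1")
        case True
        then have "z powr m \<le> 1" using z 3 by (intro powr_le1) auto
        then show ?thesis using z by (simp add: add_increasing2)
      next
        case False
        then have "z powr m \<le> z powr real p" using p by (intro powr_mono) auto
        then show ?thesis using False by (simp add: powr_realpow)
      qed
      have "(norm_power m y)\<^sup>2 = \<tau> powr m * z powr m"
        using 3 by (simp add: norm_power_def z_def powr_mult[symmetric] powr_power)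
          (simp add: powr_powr powr_numeral[symmetric] mult.commute del: powr_numeral)
      also have "\<dots> \<le> \<tau> powr m * (1 + z ^ p)" using zp by (intro mult_left_mono) auto
      also have "\<dots> = \<tau> powr m + \<tau> powr m / \<tau> ^ p * norm y ^ (2 * p)"
        by (simp add: z_def power_divide power_mult distrib_left)
      finally show ?thesis .
    qed
    have "(\<integral>\<^sup>+y. ennreal ((norm_power m y)\<^sup>2) \<partial>\<mu>)
        \<le> (\<integral>\<^sup>+y. ennreal (\<tau> powr m) + ennreal (\<tau> powr m / \<tau> ^ p) * ennreal (norm y ^ (2 * p)) \<partial>\<mu>)"
      using pw 3 by (intro nn_integral_mono)
        (simp add: ennreal_plus[symmetric] ennreal_mult'[symmetric] ennreal_leI del: ennreal_plus)
    also have "\<dots> = ennreal (\<tau> powr m) + ennreal (\<tau> powr m / \<tau> ^ p) * (\<integral>\<^sup>+y. ennreal (norm y ^ (2 * p)) \<partial>\<mu>)"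
      by (simp add: nn_integral_add nn_integral_cmult emeasure_space_1)
    also have "\<dots> \<le> ennreal (\<tau> powr m) + ennreal (\<tau> powr m / \<tau> ^ p) * ennreal (C * \<tau> ^ p)"
      unfolding C_def by (intro add_mono mult_left_mono norm_moment[OF e \<tau> p(1)]) auto
    also have "\<dots> = ennreal ((1 + C) * norm_power m \<tau>)"
      using 3 C by (simp add: ennreal_plus[symmetric] ennreal_mult'[symmetric] norm_power_def algebra_simps
          del: ennreal_plus)
    finally show ?thesis by (simp add: C_def)
  qed
qed

end

section \<open>The covariance operators\<close>

lemma ennreal_suminf_commute:
  "(\<Sum>i. \<Sum>j. f i j :: ennreal) = (\<Sum>j. \<Sum>i. f i j)"
proof -
  have "(\<Sum>i. \<Sum>j. f i j) = (\<integral>\<^sup>+i. (\<Sum>j. f i j) \<partial>count_space UNIV)"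
    by (rule nn_integral_count_space_nat[symmetric])
  also have "\<dots> = (\<Sum>j. \<integral>\<^sup>+i. f i j \<partial>count_space UNIV)"
    by (rule nn_integral_suminf) simp
  finally show ?thesis by (simp add: nn_integral_count_space_nat)
qed

text \<open>Tonelli for the squares of the matrix entries. As the sequences \<open>e\<close> and
  \<open>f\<close> sit on different sides, either sum is independent of its sequence.\<close>

lemma hilbert_schmidt_adj:
  fixes T :: "'x::{real_inner,banach} \<Rightarrow>\<^sub>L 'a::{real_inner,banach}"
  assumes e: "parseval e" and f: "parseval f"
  shows "(\<Sum>k. ennreal ((norm (adj T (e k)))\<^sup>2)) = (\<Sum>j. ennreal ((norm (T (f j)))\<^sup>2))"
proof -
  have "(\<Sum>k. ennreal ((norm (adj T (e k)))\<^sup>2)) = (\<Sum>k. \<Sum>j. ennreal ((inner (T (f j)) (e k))\<^sup>2))"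
    unfolding ennreal_parseval[OF f] inner_adj by (simp add: inner_commute)
  also have "\<dots> = (\<Sum>j. \<Sum>k. ennreal ((inner (T (f j)) (e k))\<^sup>2))" by (rule ennreal_suminf_commute)
  finally show ?thesis unfolding ennreal_parseval[OF e] .
qed

lemma bessel_finite:
  fixes x :: "'a::real_inner"
  assumes F: "finite F" "pairwise orthogonal F" "\<And>b. b \<in> F \<Longrightarrow> norm b = 1"
  shows "(\<Sum>b\<in>F. (inner x b)\<^sup>2) \<le> (norm x)\<^sup>2"
proof -
  define P where "P = (\<Sum>b\<in>F. inner x b *\<^sub>R b)"
  have "inner P c = inner x c" if c: "c \<in> F" for c
  proof -
    have "inner P c = (\<Sum>b\<in>F. if b = c then inner x c else 0)"
      unfolding P_def inner_sum_left
    proof (rule sum.cong)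
      fix b assume "b \<in> F"
      then show "inner (inner x b *\<^sub>R b) c = (if b = c then inner x c else 0)"
        using F(2) F(3)[OF c] c by (auto simp: pairwise_def orthogonal_def norm_eq_1)
    qed simp
    then show ?thesis using F(1) c by simp
  qed
  then have "inner (x - P) P = 0"
    by (subst (2) P_def) (simp add: inner_sum_right inner_diff_left)
  moreover have "inner x P = (\<Sum>b\<in>F. (inner x b)\<^sup>2)"
    by (simp add: P_def inner_sum_right power2_eq_square)
  moreover have "0 \<le> inner (x - P) (x - P)" by simp
  ultimately show ?thesis
    by (simp add: inner_diff_left inner_diff_right power2_norm_eq_inner inner_commute)
qed

text \<open>A divergent \<open>infsum\<close> would be 0 by default, so summability over the chosen
  basis has to be shown: the rank one representation together with Bessel's inequality bounds all
  finite diagonal sums.\<close>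

lemma trace_op_sums:
  fixes T :: "'a::{real_inner,banach,second_countable_topology} \<Rightarrow>\<^sub>L 'a"
  assumes T: "trace_class T" and nonneg: "\<And>x. 0 \<le> inner (T x) x"
  obtains e where "parseval e" "(\<lambda>k. inner (T (e k)) (e k)) sums trace_op T"
proof -
  define B :: "'a set" where "B = (SOME B. orthonormal_basis B)"
  have B: "orthonormal_basis B" unfolding B_def using orthonormal_basis_exists by (rule someI_ex)
  obtain a b :: "nat \<Rightarrow> 'a" where ab: "summable (\<lambda>n. norm (a n) * norm (b n))"
    and Tx: "\<And>x. (\<lambda>n. inner (a n) x *\<^sub>R b n) sums T x"
    using T unfolding trace_class_def by blast
  have "(\<lambda>b. inner (T b) b) summable_on B"
  proof (rule nonneg_bdd_above_summable_on)
    show "bdd_above (sum (\<lambda>b. inner (T b) b) ` {F. F \<subseteq> B \<and> finite F})"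
    proof (rule bdd_aboveI2)
      fix F assume "F \<in> {F. F \<subseteq> B \<and> finite F}"
      then have F: "finite F" "pairwise orthogonal F" "\<And>b. b \<in> F \<Longrightarrow> norm b = 1"
        using B pairwise_subset by (auto simp: orthonormal_basis_def)
      have "(\<lambda>n. \<Sum>c\<in>F. inner (a n) c * inner (b n) c) sums (\<Sum>c\<in>F. inner (T c) c)"
      proof (rule sums_sum)
        fix c
        show "(\<lambda>n. inner (a n) c * inner (b n) c) sums inner (T c) c"
          using bounded_linear.sums[OF bounded_linear_inner_left Tx[of c], of c] by simp
      qed
      moreover have "(\<Sum>c\<in>F. inner (a n) c * inner (b n) c) \<le> norm (a n) * norm (b n)" for n
      proof -
        have "(\<Sum>c\<in>F. inner (a n) c * inner (b n) c)\<^sup>2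
            \<le> (\<Sum>c\<in>F. (inner (a n) c)\<^sup>2) * (\<Sum>c\<in>F. (inner (b n) c)\<^sup>2)"
          by (rule Cauchy_Schwarz_ineq_sum)
        also have "\<dots> \<le> (norm (a n))\<^sup>2 * (norm (b n))\<^sup>2"
          by (intro mult_mono bessel_finite F sum_nonneg) auto
        finally have "(\<Sum>c\<in>F. inner (a n) c * inner (b n) c)\<^sup>2 \<le> (norm (a n) * norm (b n))\<^sup>2"
          by (simp add: power_mult_distrib)
        then show ?thesis by (rule power2_le_imp_le) simp
      qed
      ultimately show "(\<Sum>c\<in>F. inner (T c) c) \<le> (\<Sum>n. norm (a n) * norm (b n))"
        using ab by (intro sums_le[OF _ _ summable_sums]) auto
    qed
  qed (rule nonneg)
  then have hs: "((\<lambda>b. inner (T b) b) has_sum trace_op T) B"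
    unfolding trace_op_def B_def[symmetric] by (rule has_sum_infsum)
  from orthonormal_basis_sequence[OF B] obtain e where e: "parseval e"
    "\<And>f s. f 0 = (0::real) \<Longrightarrow> (f has_sum s) B \<Longrightarrow> (\<lambda>n. f (e n)) sums s" by blast
  have "(\<lambda>k. inner (T (e k)) (e k)) sums trace_op T"
    using e(2)[OF _ hs] by simp
  with e(1) show ?thesis by (rule that)
qed

section \<open>The covariance as an integral over time\<close>

locale ornstein_uhlenbeck =
  fixes S :: "real \<Rightarrow> 'h::{real_inner,banach,second_countable_topology} \<Rightarrow>\<^sub>L 'h"
    and \<sigma> :: "'x::{real_inner,banach,second_countable_topology} \<Rightarrow>\<^sub>L 'h"
    and M \<omega> :: real
  assumes C0: "C0_semigroup S" and M: "M \<ge> 1"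
    and S_bound: "\<And>t. t \<ge> 0 \<Longrightarrow> norm (S t) \<le> M * exp (\<omega> * t)"
    and trace_class: "\<And>s. s > 0 \<Longrightarrow> trace_class (cov_density S \<sigma> s)"
    and trace_finite: "\<And>t. t \<ge> 0 \<Longrightarrow>
      (\<integral>\<^sup>+ s\<in>{0..t}. ennreal (trace_op (cov_density S \<sigma> s)) \<partial>lborel) < \<infinity>"
begin

lemma S_add: "s \<ge> 0 \<Longrightarrow> t \<ge> 0 \<Longrightarrow> S (s + t) x = S s (S t x)"
  using C0 by (simp add: C0_semigroup_def)

lemma S_apply_le: "t \<ge> 0 \<Longrightarrow> norm (S t x) \<le> M * exp (\<omega> * t) * norm x"
  by (rule order_trans[OF norm_blinfun]) (intro mult_right_mono S_bound norm_ge_zero)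

text \<open>Only continuity from the right at 0 is given. Factoring out the smaller time,
  \<open>S b x - S a x = S a (S (b - a) x - x)\<close>, reduces continuity from both sides to it.
  The constant \<open>C\<close> bounds \<open>S a\<close> for all \<open>a \<le> s\<close>, whatever
  the sign of \<open>\<omega>\<close>.\<close>

lemma continuous_on_S: "continuous_on {0..} (\<lambda>s. S s x)"
  unfolding continuous_on_iff
proof (intro ballI allI impI)
  fix s e :: real assume s: "s \<in> {0..}" and e: "e > 0"
  define C where "C = M * exp (\<bar>\<omega>\<bar> * s)"
  have C: "C > 0" using M by (simp add: C_def)
  have lim: "((\<lambda>t. S t x) \<longlongrightarrow> x) (at_right 0)" and S0: "S 0 x = x"
    using C0 by (auto simp: C0_semigroup_def)
  from tendstoD[OF lim, of "e / C"] e C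
  obtain d where d: "d > 0" "\<And>h. 0 < h \<Longrightarrow> h < d \<Longrightarrow> dist (S h x) x < e / C"
    by (auto simp: eventually_at_right_field)
  have small: "dist (S h x) x < e / C" if "0 \<le> h" "h < d" for h
    using d(2)[of h] that e C S0 by (cases "h = 0") auto
  have diff: "dist (S b x) (S a x) < e" if "0 \<le> a" "a \<le> b" "a \<le> s" "b - a < d" for a b
  proof -
    have "S b x = S a (S (b - a) x)" using S_add[of a "b - a" x] that by simp
    then have "dist (S b x) (S a x) = norm (S a (S (b - a) x - x))"
      by (simp add: dist_norm blinfun.diff_right)
    also have "\<dots> \<le> M * exp (\<omega> * a) * norm (S (b - a) x - x)"
      using that by (intro S_apply_le)
    also have "\<dots> \<le> C * norm (S (b - a) x - x)"
    proof -
      have "\<omega> * a \<le> \<bar>\<omega>\<bar> * s" using that by (intro mult_mono) auto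
      then show ?thesis unfolding C_def using M by (intro mult_right_mono mult_left_mono) auto
    qed
    also have "\<dots> < C * (e / C)"
      using small[of "b - a"] that C by (intro mult_strict_left_mono) (auto simp: dist_norm)
    finally show ?thesis using C by simp
  qed
  show "\<exists>d>0. \<forall>s'\<in>{0..}. dist s' s < d \<longrightarrow> dist (S s' x) (S s x) < e"
  proof (intro exI[of _ d] conjI ballI impI d(1))
    fix s' assume s': "s' \<in> {0..}" "dist s' s < d"
    show "dist (S s' x) (S s x) < e"
    proof (cases "s \<le> s'")
      case True
      then show ?thesis using diff[of s s'] s s' by (auto simp: dist_real_def)
    next
      case False
      then show ?thesis using diff[of s' s] s s' by (auto simp: dist_real_def dist_commute)
    qed
  qed
qed

text \<open>The factor through which the density is a square: its quadratic form at \<open>h\<close>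
  is \<open>(norm (Z s h))\<^sup>2\<close>, and its trace is a squared Hilbert-Schmidt norm.\<close>

definition Z :: "real \<Rightarrow> 'h \<Rightarrow>\<^sub>L 'x" where "Z s = adj (S s o\<^sub>L \<sigma>)"

lemma inner_Z: "inner (Z s h) y = inner h (S s (\<sigma> y))"
  by (simp add: Z_def inner_adj)

lemma cov_density_Z: "cov_density S \<sigma> s h = S s (\<sigma> (Z s h))"
  by (simp add: cov_density_def Z_def adj_compose_apply)

lemma inner_cov_density: "inner (cov_density S \<sigma> s h) k = inner (Z s h) (Z s k)"
  using inner_Z[of s k "Z s h"] by (simp add: cov_density_Z inner_commute)

definition bnd :: "real \<Rightarrow> real" where "bnd t = M * exp (\<bar>\<omega>\<bar> * t) * norm \<sigma>"

lemma bnd: "0 \<le> s \<Longrightarrow> s \<le> t \<Longrightarrow> norm (S s o\<^sub>L \<sigma>) \<le> bnd t" and bnd_nonneg: "0 \<le> bnd t"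
proof -
  show "0 \<le> bnd t" using M by (simp add: bnd_def)
  assume s: "0 \<le> s" "s \<le> t"
  have "\<omega> * s \<le> \<bar>\<omega>\<bar> * t" using s by (intro mult_mono) auto
  then have "M * exp (\<omega> * s) \<le> M * exp (\<bar>\<omega>\<bar> * t)" using M by (intro mult_left_mono) auto
  with S_bound[OF s(1)] have "norm (S s) \<le> M * exp (\<bar>\<omega>\<bar> * t)" by (rule order_trans)
  then show "norm (S s o\<^sub>L \<sigma>) \<le> bnd t"
    unfolding bnd_def by (rule order_trans[OF norm_blinfun_compose mult_right_mono]) simp
qed

lemma norm_Z_le: "0 \<le> s \<Longrightarrow> s \<le> t \<Longrightarrow> norm (Z s h) \<le> bnd t * norm h"
  unfolding Z_def
  by (rule order_trans[OF norm_blinfun mult_right_mono[OF order_trans[OF norm_adj_le bnd] norm_ge_zero]])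

lemma norm_cov_density_le: "0 \<le> s \<Longrightarrow> s \<le> t \<Longrightarrow> norm (cov_density S \<sigma> s h) \<le> bnd t * (bnd t * norm h)"
proof -
  assume s: "0 \<le> s" "s \<le> t"
  have "norm (cov_density S \<sigma> s h) = norm ((S s o\<^sub>L \<sigma>) (Z s h))" by (simp add: cov_density_Z)
  also have "\<dots> \<le> norm (S s o\<^sub>L \<sigma>) * norm (Z s h)" by (rule norm_blinfun)
  also have "\<dots> \<le> bnd t * (bnd t * norm h)"
    by (intro mult_mono bnd norm_Z_le s bnd_nonneg) auto
  finally show ?thesis .
qed

text \<open>Strong continuity of \<open>S\<close> gives weak continuity for the adjoint family, from
  which Pettis' theorem yields measurability.\<close>

lemma measurable_Z: "(\<lambda>s. indicator {0..} s *\<^sub>R Z s h) \<in> borel_measurable borel"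
proof (rule borel_measurable_hilbertI)
  fix y
  have "(\<lambda>s. indicator {0..} s *\<^sub>R inner h (S s (\<sigma> y))) \<in> borel_measurable borel"
    by (intro borel_measurable_continuous_on_indicator continuous_intros continuous_on_S) auto
  then show "(\<lambda>s. inner (indicator {0..} s *\<^sub>R Z s h) y) \<in> borel_measurable borel"
    by (simp add: inner_Z)
qed

lemma measurable_inner_Z:
  "(\<lambda>s. indicator {0..t} s * inner (Z s h) (Z s k)) \<in> borel_measurable borel"
proof -
  note measurable_Z[measurable]
  have "(\<lambda>s. indicator {0..t} s * inner (indicator {0..} s *\<^sub>R Z s h) (indicator {0..} s *\<^sub>R Z s k))
      \<in> borel_measurable borel" by measurable
  moreover have "indicator {0..t} s * inner (indicator {0..} s *\<^sub>R Z s h) (indicator {0..} s *\<^sub>R Z s k)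
      = indicator {0..t} s * inner (Z s h) (Z s k)" for s :: real
    by (auto simp: indicator_def)
  ultimately show ?thesis by (simp only:)
qed

lemma integrable_cov_density:
  "integrable lborel (\<lambda>s. indicator {0..t} s *\<^sub>R cov_density S \<sigma> s h)"
proof (rule integrableI_bounded_set[where A = "{0..t}" and B = "bnd t * (bnd t * norm h)"])
  show "(\<lambda>s. indicator {0..t} s *\<^sub>R cov_density S \<sigma> s h) \<in> borel_measurable lborel"
    by (rule borel_measurable_hilbertI) (simp add: inner_cov_density measurable_inner_Z)
qed (auto intro: norm_cov_density_le simp: emeasure_lborel_Icc_eq)

lemma cov_op_apply:
  assumes "t \<ge> 0"
  shows "cov_op S \<sigma> t h = (\<integral>s. indicator {0..t} s *\<^sub>R cov_density S \<sigma> s h \<partial>lborel)"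
proof -
  let ?F = "\<lambda>h. (\<integral>s. indicator {0..t} s *\<^sub>R cov_density S \<sigma> s h \<partial>lborel)"
  have "bounded_linear ?F"
  proof (rule bounded_linear_intro[where K = "bnd t * bnd t * t"])
    show "?F (h + k) = ?F h + ?F k" for h k
      by (simp add: blinfun.add_right scaleR_add_right integrable_cov_density)
    show "?F (c *\<^sub>R h) = c *\<^sub>R ?F h" for c h
      by (simp only: blinfun.scaleR_right scaleR_left_commute[of _ c] integral_scaleR_right)
    fix h
    have "norm (?F h) \<le> (\<integral>s. norm (indicator {0..t} s *\<^sub>R cov_density S \<sigma> s h) \<partial>lborel)"
      by (rule integral_norm_bound)
    also have "\<dots> \<le> (\<integral>s. indicator {0..t} s *\<^sub>R (bnd t * (bnd t * norm h)) \<partial>lborel)"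
    proof (rule integral_mono)
      show "integrable lborel (\<lambda>s. norm (indicator {0..t} s *\<^sub>R cov_density S \<sigma> s h))"
        by (intro integrable_norm integrable_cov_density)
      show "integrable lborel (\<lambda>s. indicator {0..t} s *\<^sub>R (bnd t * (bnd t * norm h)))"
        by (intro integrable_scaleR_left integrable_real_indicator) (auto simp: emeasure_lborel_Icc_eq)
      show "norm (indicator {0..t} s *\<^sub>R cov_density S \<sigma> s h) \<le> indicator {0..t} s *\<^sub>R (bnd t * (bnd t * norm h))" for s
        by (auto simp: indicator_def norm_cov_density_le)
    qed
    also have "\<dots> = norm h * (bnd t * bnd t * t)" using assms by simp
    finally show "norm (?F h) \<le> norm h * (bnd t * bnd t * t)" .
  qed
  then show ?thesis
    unfolding cov_op_def set_lebesgue_integral_def by (simp add: bounded_linear_Blinfun_apply)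
qed

lemma inner_cov_op:
  assumes "t \<ge> 0"
  shows "has_bochner_integral lborel (\<lambda>s. indicator {0..t} s * inner (Z s h) (Z s k)) (inner (cov_op S \<sigma> t h) k)"
  using has_bochner_integral_inner_left[OF has_bochner_integral_integrable[OF integrable_cov_density[of t h]], of k]
  by (simp add: cov_op_apply[OF assms] inner_cov_density)

lemma nonneg_selfadjoint_cov_op:
  assumes "t \<ge> 0"
  shows "nonneg_selfadjoint (cov_op S \<sigma> t)"
  unfolding nonneg_selfadjoint_def
proof (intro conjI allI)
  fix h k
  have "inner (cov_op S \<sigma> t h) k = inner (cov_op S \<sigma> t k) h"
    using inner_cov_op[OF assms, of h k] inner_cov_op[OF assms, of k h]
    by (simp add: inner_commute has_bochner_integral_iff)
  then show "inner (cov_op S \<sigma> t h) k = inner h (cov_op S \<sigma> t k)" by (simp add: inner_commute)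
  show "0 \<le> inner (cov_op S \<sigma> t h) h"
    using inner_cov_op[OF assms, of h h]
    by (auto simp: has_bochner_integral_iff dest!: sym[of "integral\<^sup>L _ _"])
qed

abbreviation Q_sqrt :: "real \<Rightarrow> 'h \<Rightarrow>\<^sub>L 'h" where "Q_sqrt t \<equiv> sqrt_op (cov_op S \<sigma> t)"

lemma Q_sqrt:
  assumes "t \<ge> 0"
  shows "nonneg_selfadjoint (Q_sqrt t)" "Q_sqrt t o\<^sub>L Q_sqrt t = cov_op S \<sigma> t"
  using sqrt_op[OF nonneg_selfadjoint_cov_op[OF assms]] by auto

lemma norm_Q_sqrt:
  assumes "t \<ge> 0"
  shows "(norm (Q_sqrt t h))\<^sup>2 = inner (cov_op S \<sigma> t h) h"
  using Q_sqrt(2)[OF assms] nonneg_selfadjoint_inner[OF Q_sqrt(1)[OF assms], of "Q_sqrt t h" h]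
  by (metis blinfun_apply_blinfun_compose power2_norm_eq_inner)

lemma ennreal_norm_Q_sqrt:
  assumes "t \<ge> 0"
  shows "ennreal ((norm (Q_sqrt t h))\<^sup>2) = (\<integral>\<^sup>+s. ennreal ((norm (Z s h))\<^sup>2) * indicator {0..t} s \<partial>lborel)"
proof -
  have "ennreal ((norm (Q_sqrt t h))\<^sup>2) = ennreal (\<integral>s. indicator {0..t} s * inner (Z s h) (Z s h) \<partial>lborel)"
    using inner_cov_op[OF assms, of h h] by (simp add: norm_Q_sqrt[OF assms] has_bochner_integral_iff)
  also have "\<dots> = (\<integral>\<^sup>+s. ennreal (indicator {0..t} s * inner (Z s h) (Z s h)) \<partial>lborel)"
    using inner_cov_op[OF assms, of h h]
    by (intro nn_integral_eq_integral[symmetric]) (auto simp: has_bochner_integral_iff)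
  finally show ?thesis
    by (simp add: power2_norm_eq_inner mult.commute ennreal_mult' ennreal_indicator)
qed

text \<open>The squared Hilbert-Schmidt norm of \<open>Z s\<close>. With values in
  \<open>ennreal\<close> it makes sense at \<open>s = 0\<close> too, where the trace class
  hypothesis says nothing.\<close>

definition theta :: "(nat \<Rightarrow> 'h) \<Rightarrow> real \<Rightarrow> ennreal" where
  "theta e s = (\<Sum>k. ennreal ((norm (Z s (e k)))\<^sup>2))"

lemma measurable_theta: "(\<lambda>s. theta e s * indicator {0..t} s) \<in> borel_measurable borel"
proof -
  have "(\<lambda>s. \<Sum>k. ennreal (indicator {0..t} s * inner (Z s (e k)) (Z s (e k)))) \<in> borel_measurable borel"
    using measurable_inner_Z by measurable
  then show ?thesis
    by (simp add: theta_def power2_norm_eq_inner mult.commute ennreal_mult' ennreal_indicator)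
qed

text \<open>\<open>trace_op\<close> hides a basis of its own. Passing to the adjoint side turns both
  sums into the same one over a Parseval sequence of the noise space.\<close>

lemma theta_trace:
  assumes e: "parseval e" and s: "s > 0"
  shows "theta e s = ennreal (trace_op (cov_density S \<sigma> s))"
proof -
  obtain f :: "nat \<Rightarrow> 'x" where f: "parseval f" using parseval_exists by blast
  have pos: "0 \<le> inner (cov_density S \<sigma> s x) x" for x by (simp add: inner_cov_density)
  obtain e' where e': "parseval e'"
    "(\<lambda>k. inner (cov_density S \<sigma> s (e' k)) (e' k)) sums trace_op (cov_density S \<sigma> s)"
    using trace_op_sums[OF trace_class[OF s] pos] by blast
  have "theta e s = theta e' s"
    unfolding theta_def Z_def hilbert_schmidt_adj[OF e f] hilbert_schmidt_adj[OF e'(1) f] ..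
  also have "\<dots> = ennreal (trace_op (cov_density S \<sigma> s))"
    using e'(2) unfolding theta_def by (intro suminf_ennreal_eq) (auto simp: inner_cov_density power2_norm_eq_inner)
  finally show ?thesis .
qed

text \<open>In \<open>Z (r + s)\<close> the adjoint of \<open>S r\<close> acts first, on the basis
  vectors. On the adjoint side \<open>S r\<close> acts last, so its norm can be pulled out term by
  term.\<close>

lemma theta_add:
  assumes e: "parseval e" and "r \<ge> 0" "s \<ge> 0"
  shows "theta e (r + s) \<le> ennreal ((M * exp (\<omega> * r))\<^sup>2) * theta e s"
proof -
  obtain f :: "nat \<Rightarrow> 'x" where f: "parseval f" using parseval_exists by blast
  have eq: "theta e s = (\<Sum>j. ennreal ((norm (S s (\<sigma> (f j))))\<^sup>2))" for s
    unfolding theta_def Z_def hilbert_schmidt_adj[OF e f] by simp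
  have "theta e (r + s) = (\<Sum>j. ennreal ((norm (S r (S s (\<sigma> (f j)))))\<^sup>2))"
    unfolding eq using assms by (simp add: S_add)
  also have "\<dots> \<le> (\<Sum>j. ennreal ((M * exp (\<omega> * r))\<^sup>2) * ennreal ((norm (S s (\<sigma> (f j))))\<^sup>2))"
  proof (intro suminf_le allI summableI)
    fix j
    have "(norm (S r (S s (\<sigma> (f j)))))\<^sup>2 \<le> (M * exp (\<omega> * r) * norm (S s (\<sigma> (f j))))\<^sup>2"
      using assms by (intro power_mono S_apply_le) auto
    then show "ennreal ((norm (S r (S s (\<sigma> (f j)))))\<^sup>2)
        \<le> ennreal ((M * exp (\<omega> * r))\<^sup>2) * ennreal ((norm (S s (\<sigma> (f j))))\<^sup>2)"
      by (simp add: ennreal_mult[symmetric] power_mult_distrib ennreal_leI)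
  qed
  also have "\<dots> = ennreal ((M * exp (\<omega> * r))\<^sup>2) * theta e s" unfolding eq by simp
  finally show ?thesis .
qed

section \<open>Growth of the trace in time\<close>

definition Tr :: "(nat \<Rightarrow> 'h) \<Rightarrow> real \<Rightarrow> ennreal" where
  "Tr e t = (\<integral>\<^sup>+s. theta e s * indicator {0..t} s \<partial>lborel)"

lemma Tr_eq: "t \<ge> 0 \<Longrightarrow> Tr e t = (\<Sum>k. ennreal ((norm (Q_sqrt t (e k)))\<^sup>2))"
proof -
  assume t: "t \<ge> 0"
  have m: "(\<lambda>s. ennreal ((norm (Z s (e k)))\<^sup>2) * indicator {0..t} s) \<in> borel_measurable lborel" for k
  proof -
    have "(\<lambda>s. ennreal (indicator {0..t} s * inner (Z s (e k)) (Z s (e k)))) \<in> borel_measurable borel"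
      using measurable_inner_Z by measurable
    then show ?thesis by (simp add: power2_norm_eq_inner mult.commute ennreal_mult' ennreal_indicator)
  qed
  have "Tr e t = (\<integral>\<^sup>+s. (\<Sum>k. ennreal ((norm (Z s (e k)))\<^sup>2) * indicator {0..t} s) \<partial>lborel)"
    unfolding Tr_def theta_def by simp
  also have "\<dots> = (\<Sum>k. \<integral>\<^sup>+s. ennreal ((norm (Z s (e k)))\<^sup>2) * indicator {0..t} s \<partial>lborel)"
    by (rule nn_integral_suminf[OF m])
  finally show ?thesis by (simp add: ennreal_norm_Q_sqrt[OF t])
qed

lemma Tr_finite:
  assumes e: "parseval e" and t: "t \<ge> 0"
  shows "Tr e t < \<infinity>"
proof -
  have "Tr e t = (\<integral>\<^sup>+s\<in>{0..t}. ennreal (trace_op (cov_density S \<sigma> s)) \<partial>lborel)"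
    unfolding Tr_def
  proof (rule nn_integral_cong_AE)
    \<comment> \<open>The trace is identified for positive times only; the remaining point is a null
      set.\<close>
    have "AE s in lborel. s \<noteq> (0::real)" by (rule AE_lborel_singleton)
    then show "AE s in lborel. theta e s * indicator {0..t} s
        = ennreal (trace_op (cov_density S \<sigma> s)) * indicator {0..t} s"
      by eventually_elim (auto simp: indicator_def theta_trace[OF e])
  qed
  then show ?thesis using trace_finite[OF t] by simp
qed

lemma Tr_mono: "s \<le> t \<Longrightarrow> Tr e s \<le> Tr e t"
  unfolding Tr_def by (intro nn_integral_mono mult_left_mono) (auto simp: indicator_def)

lemma Tr_Suc:
  assumes e: "parseval e"
  shows "Tr e (real (Suc n)) \<le> Tr e (real n) + ennreal ((M * exp (\<omega> * real n))\<^sup>2) * Tr e 1"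
proof -
  let ?n = "real n"
  have m: "(\<lambda>s. theta e s * indicator {?n..?n + 1} s) \<in> borel_measurable borel"
  proof -
    have "(\<lambda>s. theta e s * indicator {0..?n + 1} s * indicator {?n..?n + 1} s) \<in> borel_measurable borel"
      by (intro borel_measurable_times_ennreal measurable_theta) auto
    moreover have "theta e s * indicator {0..?n + 1} s * indicator {?n..?n + 1} s
        = theta e s * indicator {?n..?n + 1} s" for s :: real by (auto simp: indicator_def)
    ultimately show ?thesis by (simp only:)
  qed
  have "Tr e (real (Suc n)) \<le> (\<integral>\<^sup>+s. theta e s * indicator {0..?n} s + theta e s * indicator {?n..?n + 1} s \<partial>lborel)"
    unfolding Tr_def by (intro nn_integral_mono) (auto simp: indicator_def)
  also have "\<dots> = Tr e ?n + (\<integral>\<^sup>+s. theta e s * indicator {?n..?n + 1} s \<partial>lborel)"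
    unfolding Tr_def using measurable_theta m by (intro nn_integral_add) auto
  also have "(\<integral>\<^sup>+s. theta e s * indicator {?n..?n + 1} s \<partial>lborel)
      = (\<integral>\<^sup>+s. theta e (?n + s) * indicator {?n..?n + 1} (?n + s) \<partial>lborel)"
    using nn_integral_real_affine[OF m, of 1 ?n] by simp
  also have "\<dots> \<le> (\<integral>\<^sup>+s. ennreal ((M * exp (\<omega> * ?n))\<^sup>2) * (theta e s * indicator {0..1} s) \<partial>lborel)"
    using theta_add[OF e, of ?n] by (intro nn_integral_mono) (auto simp: indicator_def)
  also have "\<dots> = ennreal ((M * exp (\<omega> * ?n))\<^sup>2) * Tr e 1"
    unfolding Tr_def using measurable_theta by (intro nn_integral_cmult) auto
  finally show ?thesis by (simp add: add_left_mono)
qed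

text \<open>The order of the geometric sums with ratio \<open>exp (2 * \<omega>)\<close> and about
  \<open>t\<close> terms.\<close>

definition growth :: "real \<Rightarrow> real" where
  "growth t = (if \<omega> > 0 then exp (2 * \<omega> * t) else if \<omega> = 0 then 1 + t else 1)"

lemma trace_growth:
  assumes e: "parseval e"
  obtains \<kappa> where "\<kappa> > 0" "\<And>t. t > 0 \<Longrightarrow>
    \<exists>\<tau>. (\<lambda>k. (norm (Q_sqrt t (e k)))\<^sup>2) sums \<tau> \<and> \<tau> \<le> \<kappa> * growth t"
proof -
  define T1 where "T1 = enn2real (Tr e 1)"
  have T1: "Tr e 1 = ennreal T1" "T1 \<ge> 0"
    using Tr_finite[OF e, of 1] by (auto simp: T1_def)
  define q where "q = exp (2 * \<omega>)"
  have q: "q > 0" "(exp (\<omega> * real n))\<^sup>2 = q ^ n" for n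
    by (auto simp: q_def exp_of_nat_mult[symmetric] exp_double[symmetric] mult_ac)
  have sumT: "Tr e (real n) \<le> ennreal (M\<^sup>2 * T1 * (\<Sum>i<n. q ^ i))" for n
  proof (induction n)
    case 0
    have "Tr e 0 = (\<integral>\<^sup>+s. 0 \<partial>(lborel :: real measure))"
      unfolding Tr_def
    proof (rule nn_integral_cong_AE)
      have "AE s in lborel. s \<noteq> (0::real)" by (rule AE_lborel_singleton)
      then show "AE s in lborel. theta e s * indicator {0..0} s = 0"
        by eventually_elim (auto simp: indicator_def)
    qed
    then show ?case by simp
  next
    case (Suc n)
    have "Tr e (real (Suc n)) \<le> Tr e (real n) + ennreal ((M * exp (\<omega> * real n))\<^sup>2) * Tr e 1"
      by (rule Tr_Suc[OF e])
    also have "\<dots> \<le> ennreal (M\<^sup>2 * T1 * (\<Sum>i<n. q ^ i)) + ennreal (M\<^sup>2 * q ^ n) * ennreal T1"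
      using Suc by (simp add: T1(1) power_mult_distrib q(2) add_right_mono)
    also have "\<dots> = ennreal (M\<^sup>2 * T1 * (\<Sum>i<n. q ^ i) + M\<^sup>2 * q ^ n * T1)"
      using T1(2) q(1) by (simp add: ennreal_plus ennreal_mult sum_nonneg)
    finally show ?case by (simp add: algebra_simps)
  qed
  \<comment> \<open>Rounding \<open>t\<close> up costs at most one unit of time; for
    \<open>\<omega> > 0\<close> this is the factor \<open>q\<close> in the numerator, and for
    \<open>\<omega> < 0\<close> the constant is the full geometric series.\<close>
  define c where "c = (if \<omega> > 0 then q / (q - 1) else if \<omega> = 0 then 1 else 1 / (1 - q))"
  have c: "c > 0" by (auto simp: c_def q_def)
  have geo: "(\<Sum>i<n. q ^ i) \<le> c * growth t" if n: "real n \<le> t + 1" for n t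
  proof -
    consider "\<omega> > 0" | "\<omega> = 0" | "\<omega> < 0" by linarith
    then show ?thesis
    proof cases
      case 1
      then have q1: "q > 1" by (simp add: q_def)
      have "q ^ n = exp (2 * \<omega> * real n)" by (simp add: q_def exp_of_nat_mult[symmetric] mult_ac)
      also have "\<dots> \<le> exp (2 * \<omega> * (t + 1))" using n 1 by simp
      also have "\<dots> = q * exp (2 * \<omega> * t)" by (simp add: q_def exp_add[symmetric] algebra_simps)
      finally have "(q ^ n - 1) / (q - 1) \<le> q * exp (2 * \<omega> * t) / (q - 1)"
        using q1 by (intro divide_right_mono) auto
      then show ?thesis using 1 q1 by (simp add: geometric_sum c_def growth_def)
    next
      case 2
      then show ?thesis unfolding growth_def c_def using n by (simp add: q_def)
    next
      case 3
      then have q1: "q < 1" by (simp add: q_def)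
      have "(\<Sum>i<n. q ^ i) = (1 - q ^ n) / (1 - q)"
        using q1 by (simp add: sum_gp_strict)
      also have "\<dots> \<le> 1 / (1 - q)" using q1 q(1) by (intro divide_right_mono) auto
      finally show ?thesis using 3 by (simp add: c_def growth_def)
    qed
  qed
  \<comment> \<open>The added 1 keeps \<open>\<kappa>\<close> positive when \<open>T1 = 0\<close>,
    that is, without noise.\<close>
  define \<kappa> where "\<kappa> = (M\<^sup>2 * T1 + 1) * c"
  have growth0: "0 \<le> growth t" if "t > 0" for t using that by (simp add: growth_def)
  have "0 \<le> M\<^sup>2 * T1" using T1(2) by simp
  then have "\<kappa> > 0" unfolding \<kappa>_def using c by (intro mult_pos_pos) linarith+
  moreover have "\<exists>\<tau>. (\<lambda>k. (norm (Q_sqrt t (e k)))\<^sup>2) sums \<tau> \<and> \<tau> \<le> \<kappa> * growth t" if t: "t > 0" for t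
  proof -
    have fin: "(\<Sum>k. ennreal ((norm (Q_sqrt t (e k)))\<^sup>2)) < \<infinity>"
      using Tr_finite[OF e less_imp_le[OF t]] unfolding Tr_eq[OF less_imp_le[OF t]] .
    then have sm: "summable (\<lambda>k. (norm (Q_sqrt t (e k)))\<^sup>2)"
      by (intro summable_suminf_not_top zero_le_power2) (metis infinity_ennreal_def less_irrefl)
    define n where "n = nat \<lceil>t\<rceil>"
    have n: "t \<le> real n" "real n \<le> t + 1" using t unfolding n_def by linarith+
    have "ennreal (\<Sum>k. (norm (Q_sqrt t (e k)))\<^sup>2) = Tr e t"
      unfolding Tr_eq[OF less_imp_le[OF t]] using sm by (intro suminf_ennreal2[symmetric]) auto
    also have "\<dots> \<le> Tr e (real n)" by (rule Tr_mono[OF n(1)])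
    also have "\<dots> \<le> ennreal (M\<^sup>2 * T1 * (\<Sum>i<n. q ^ i))" by (rule sumT)
    also have "\<dots> \<le> ennreal (M\<^sup>2 * T1 * (c * growth t))"
      using T1(2) by (intro ennreal_leI mult_left_mono geo n) auto
    finally have "(\<Sum>k. (norm (Q_sqrt t (e k)))\<^sup>2) \<le> M\<^sup>2 * T1 * (c * growth t)"
      using T1(2) c growth0[OF t] by (simp add: ennreal_le_iff)
    also have "\<dots> \<le> \<kappa> * growth t"
      using mult_nonneg_nonneg[OF less_imp_le[OF c] growth0[OF t]] by (simp add: \<kappa>_def algebra_simps)
    finally show ?thesis using summable_sums[OF sm] by blast
  qed
  ultimately show ?thesis by (rule that)
qed

text \<open>Finiteness of the trace provides a Gaussian measure with this covariance, so the choice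
  in \<open>gaussian\<close> has the required property.\<close>

lemma hilbert_gaussian_Q:
  assumes t: "t > 0"
  shows "hilbert_gaussian (Q_sqrt t) (gaussian (cov_op S \<sigma> t))"
proof -
  obtain e :: "nat \<Rightarrow> 'h" where e: "parseval e" using parseval_exists by blast
  have t0: "t \<ge> 0" using t by simp
  obtain \<tau> where "(\<lambda>k. (norm (Q_sqrt t (e k)))\<^sup>2) sums \<tau>" using trace_growth[OF e] t by metis
  then have "summable (\<lambda>k. (norm (Q_sqrt t (e k)))\<^sup>2)" by (rule sums_summable)
  from centered_gaussian_measure_exists[OF Q_sqrt(1)[OF t0] e this]
  have "\<exists>\<mu>. centered_gaussian_measure (cov_op S \<sigma> t) \<mu>" unfolding Q_sqrt(2)[OF t0] .
  then have "centered_gaussian_measure (cov_op S \<sigma> t) (gaussian (cov_op S \<sigma> t))"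
    unfolding gaussian_def by (rule someI_ex)
  then show ?thesis
    unfolding centered_gaussian_measure_def
    by (intro hilbert_gaussian.intro Q_sqrt(1)[OF t0]) (auto simp: norm_Q_sqrt[OF t0] simp del: of_real_power)
qed

end

section \<open>Differentiation along the range of the square root of the covariance\<close>

lemma norm_power_mono: "m \<ge> 0 \<Longrightarrow> norm a \<le> norm b \<Longrightarrow> norm_power m a \<le> norm_power m b"
  by (auto simp: norm_power_def intro: powr_mono2)

lemma norm_power_add_le:
  fixes a b :: "'a::real_normed_vector"
  assumes m: "m \<ge> 0"
  shows "norm_power m (a + b) \<le> 2 powr m * (norm_power m a + norm_power m b)"
proof (cases "m = 0")
  case False
  have "norm (a + b) powr m \<le> (2 * max (norm a) (norm b)) powr m"
    using norm_triangle_ineq[of a b] m by (intro powr_mono2) auto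
  also have "\<dots> = 2 powr m * max (norm a) (norm b) powr m" by (rule powr_mult)
  also have "\<dots> \<le> 2 powr m * (norm a powr m + norm b powr m)"
    by (intro mult_left_mono) (auto simp: max_def)
  finally show ?thesis using False by (simp add: norm_power_def)
qed (simp add: norm_power_def)

lemma weight_ge_1: "1 \<le> weight m x"
  by (simp add: weight_eq norm_power_nonneg)

text \<open>A single majorant for the weight at all shifts of norm at most \<open>\<rho>\<close>.
  Dominated convergence in (iii) and (iv) needs it to be uniform in the shift, and the bound (ii)
  takes \<open>\<rho>\<close> to be the norm of the shift itself.\<close>

definition envelope :: "real \<Rightarrow> real \<Rightarrow> 'a::real_normed_vector \<Rightarrow> real" where
  "envelope m \<rho> y = 1 + 2 powr m * (norm_power m y + norm_power m \<rho>)"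

lemma weight_add_le_envelope:
  assumes "m \<ge> 0" "norm a \<le> \<rho>"
  shows "weight m (y + a) \<le> envelope m \<rho> y"
proof -
  have "norm_power m a \<le> norm_power m \<rho>" 
    using assms by (intro norm_power_mono) auto
  then have "2 powr m * (norm_power m y + norm_power m a) \<le> 2 powr m * (norm_power m y + norm_power m \<rho>)"
    by (intro mult_left_mono) auto
  with norm_power_add_le[OF assms(1), of y a] show ?thesis
    unfolding weight_eq envelope_def by linarith
qed

lemma borel_measurable_norm_power[measurable]:
  "norm_power m \<in> borel_measurable (borel :: 'a::real_normed_vector measure)"
  unfolding norm_power_def[abs_def] by measurable

lemma borel_measurable_envelope[measurable]:
  "envelope m \<rho> \<in> borel_measurable (borel :: 'a::real_normed_vector measure)"
  unfolding envelope_def[abs_def] by measurable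

lemma wnorm_bound:
  assumes "bdd_above (range (\<lambda>x. norm (\<phi> x) / weight m x))"
  shows "norm (\<phi> x) \<le> wnorm m \<phi> * weight m x" "0 \<le> wnorm m \<phi>"
proof -
  have "norm (\<phi> x) / weight m x \<le> wnorm m \<phi>" for x
    unfolding wnorm_def using assms by (rule cSUP_upper[OF UNIV_I])
  then have le: "norm (\<phi> x) \<le> wnorm m \<phi> * weight m x" for x
    using weight_ge_1[of m x] by (simp add: pos_divide_le_eq[symmetric])
  then show "norm (\<phi> x) \<le> wnorm m \<phi> * weight m x" .
  have "0 \<le> wnorm m \<phi> * weight m x" using le[of x] norm_ge_zero order_trans by blast
  then show "0 \<le> wnorm m \<phi>" using weight_ge_1[of m x] by (simp add: zero_le_mult_iff)
qed

lemma G_gradient_eqI: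
  assumes dense: "closure D = UNIV" and d: "has_G_gradient D G f x d"
  shows "G_gradient D G f x = d"
  unfolding G_gradient_def
proof (rule the_equality)
  show "has_G_gradient D G f x d" by fact
  fix d' assume d': "has_G_gradient D G f x d'"
  have "inner d z = inner d' z" if "z \<in> D" for z
    using d d' that unfolding has_G_gradient_def by (blast intro: tendsto_unique[OF trivial_limit_at])
  then have "D \<subseteq> {z. inner d z = inner d' z}" by blast
  moreover have "closed {z. inner d z = inner d' z}"
    by (intro closed_Collect_eq continuous_intros)
  ultimately have "closure D \<subseteq> {z. inner d z = inner d' z}" by (rule closure_minimal)
  with dense have "z \<in> {z. inner d z = inner d' z}" for z by blast
  then have "\<forall>z. inner d' z = inner d z" by simp
  then show "d' = d" by (simp only: vector_eq_rdot)
qed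

lemma gderiv_gradient:
  fixes \<phi> :: "'a::{real_inner,banach} \<Rightarrow> real"
  assumes "\<phi> differentiable at x"
  shows "GDERIV \<phi> x :> gradient \<phi> x"
proof -
  from assms obtain \<phi>' where \<phi>': "(\<phi> has_derivative \<phi>') (at x)" by (auto simp: differentiable_def)
  obtain d where "\<And>h. \<phi>' h = inner d h"
    using riesz_representation[OF has_derivative_bounded_linear[OF \<phi>']] by blast
  then have "\<phi>' = (\<lambda>h. inner h d)" by (auto simp: inner_commute)
  with \<phi>' have d: "GDERIV \<phi> x :> d" by (simp add: gderiv_def)
  have "\<exists>!d. GDERIV \<phi> x :> d"
  proof (rule ex1I)
    show "GDERIV \<phi> x :> d" by fact
    fix d' assume "GDERIV \<phi> x :> d'"
    then have "(\<lambda>h. inner h d') = (\<lambda>h. inner h d)"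
      using d unfolding gderiv_def by (rule has_derivative_unique)
    then show "d' = d" by (metis vector_eq_ldot)
  qed
  then show ?thesis unfolding gradient_def by (rule theI')
qed

context hilbert_gaussian
begin

lemma white_noise_unique:
  assumes "white_noise h W" "white_noise h W'"
  shows "AE y in \<mu>. W y = W' y"
proof -
  note assms[THEN white_noise_measurable, measurable]
  have "white_noise 0 (\<lambda>y. 1 * W y + (- 1) * W' y)"
    using white_noise_lincomb[OF assms, of 1 "- 1"] by simp
  from white_noise_L2[OF this] have "(\<integral>\<^sup>+y. ennreal ((W y - W' y)\<^sup>2) \<partial>\<mu>) = 0" by simp
  then have "AE y in \<mu>. ennreal ((W y - W' y)\<^sup>2) = 0"
    by (subst (asm) nn_integral_0_iff_AE) measurable
  then show ?thesis by (auto simp: ennreal_eq_0_iff)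
qed

lemma white_noise_integral_bound:
  assumes W: "white_noise u W" and g: "g \<in> borel_measurable borel" "integrable \<mu> (\<lambda>y. (g y)\<^sup>2)"
  shows "\<bar>\<integral>y. g y * W y \<partial>\<mu>\<bar> \<le> sqrt (\<integral>y. (g y)\<^sup>2 \<partial>\<mu>) * norm u"
  using cauchy_schwarz_integral(2)[of g \<mu> W] g white_noise_measurable[OF W] white_noise_L2_integral[OF W]
  by (simp add: measurable_\<mu> has_bochner_integral_iff)

text \<open>With \<open>q = (norm (s *\<^sub>R u))\<^sup>2 \<le> 1\<close> one has
  \<open>exp q - 1 - q \<le> q\<^sup>2\<close>, so the remainder before division is of order
  \<open>q\<close>; dividing by \<open>s\<close> leaves one power of \<open>s\<close>. The bound
  sees the direction only through \<open>norm u\<close>.\<close>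

lemma difference_quotient_bound:
  fixes g :: "'h \<Rightarrow> real"
  assumes W: "white_noise u W" and g: "g \<in> borel_measurable borel" "integrable \<mu> (\<lambda>y. (g y)\<^sup>2)"
    and s: "s \<noteq> 0" "\<bar>s\<bar> * norm u \<le> 1"
  shows "\<bar>((\<integral>y. g (y + R (s *\<^sub>R u)) \<partial>\<mu>) - (\<integral>y. g y \<partial>\<mu>)) / s - (\<integral>y. g y * W y \<partial>\<mu>)\<bar>
    \<le> \<bar>s\<bar> * (norm u)\<^sup>2 * sqrt (\<integral>y. (g y)\<^sup>2 \<partial>\<mu>)"
proof -
  define q where "q = (norm (s *\<^sub>R u))\<^sup>2"
  define I where "I = (\<integral>y. g (y + R (s *\<^sub>R u)) \<partial>\<mu>) - (\<integral>y. g y \<partial>\<mu>)"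
  define J where "J = (\<integral>y. g y * W y \<partial>\<mu>)"
  have q: "0 \<le> q" "q \<le> 1" using s by (auto simp: q_def power_le_one)
  then have "exp q - 1 - q \<le> q\<^sup>2" using exp_bound[of q] by simp
  then have rem: "sqrt (exp q - 1 - q) \<le> q" using q by (intro real_le_lsqrt) auto
  have "(\<integral>y. g y * (s * W y) \<partial>\<mu>) = s * J"
    unfolding J_def by (simp add: mult.left_commute[of _ s])
  with shift_remainder_bound(4)[OF white_noise_scale[OF W] g, of s]
  have "\<bar>I - s * J\<bar> \<le> sqrt (\<integral>y. (g y)\<^sup>2 \<partial>\<mu>) * sqrt (exp q - 1 - q)"
    by (simp add: I_def q_def)
  also have "\<dots> \<le> sqrt (\<integral>y. (g y)\<^sup>2 \<partial>\<mu>) * q" using rem by (intro mult_left_mono) auto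
  finally have le: "\<bar>I - s * J\<bar> / \<bar>s\<bar> \<le> sqrt (\<integral>y. (g y)\<^sup>2 \<partial>\<mu>) * q / \<bar>s\<bar>"
    by (rule divide_right_mono) simp
  have "I / s - J = (I - s * J) / s" using s by (simp add: field_simps)
  then have "\<bar>I / s - J\<bar> = \<bar>I - s * J\<bar> / \<bar>s\<bar>" by (simp only: abs_divide)
  also note le
  also have "sqrt (\<integral>y. (g y)\<^sup>2 \<partial>\<mu>) * q / \<bar>s\<bar> = \<bar>s\<bar> * (norm u)\<^sup>2 * sqrt (\<integral>y. (g y)\<^sup>2 \<partial>\<mu>)"
    using s by (simp add: q_def power_mult_distrib power2_eq_square field_simps)
  finally show ?thesis unfolding I_def J_def .
qed

text \<open>The squared envelope has three terms, hence the factor 3; the other constants depend on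
  \<open>m\<close> and \<open>p\<close> alone, and the covariance enters through
  \<open>norm_power m \<tau>\<close>.\<close>

lemma envelope_L2:
  assumes e: "parseval e" and \<tau>: "(\<lambda>k. (norm (R (e k)))\<^sup>2) sums \<tau>" and m: "m \<ge> 0"
    and p: "p \<ge> 1" "m \<le> real p"
  shows "integrable \<mu> (\<lambda>y. (envelope m \<rho> y)\<^sup>2)"
    "sqrt (\<integral>y. (envelope m \<rho> y)\<^sup>2 \<partial>\<mu>) \<le> sqrt (3 * (2 powr m)\<^sup>2 * (1 + fact (2 * p) / (2 ^ p * fact p)))
      * (1 + sqrt (norm_power m \<tau>) + norm_power m \<rho>)"
proof -
  define C :: real where "C = 1 + fact (2 * p) / (2 ^ p * fact p)"
  define a :: real where "a = (2 powr m)\<^sup>2"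
  have C: "C \<ge> 1" by (simp add: C_def)
  have a: "a \<ge> 1" using m by (simp add: a_def ge_one_powr_ge_zero)
  define P where "P = norm_power m \<rho>"
  define T where "T = norm_power m \<tau>"
  have P: "P \<ge> 0" and T: "T \<ge> 0" by (simp_all add: P_def T_def norm_power_nonneg)
  have sq3: "(x + y + z)\<^sup>2 \<le> 3 * (x\<^sup>2 + y\<^sup>2 + z\<^sup>2)" for x y z :: real
    using sum_squares_bound[of x y] sum_squares_bound[of y z] sum_squares_bound[of x z]
    by (simp add: power2_eq_square algebra_simps)
  have pt: "(envelope m \<rho> y)\<^sup>2 \<le> 3 * (1 + a * P\<^sup>2) + 3 * a * (norm_power m y)\<^sup>2" for y :: 'h
    using sq3[of 1 "2 powr m * norm_power m y" "2 powr m * P"]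
    by (simp add: envelope_def P_def a_def power_mult_distrib algebra_simps)
  have "(\<integral>\<^sup>+y. ennreal ((envelope m \<rho> y)\<^sup>2) \<partial>\<mu>)
      \<le> (\<integral>\<^sup>+y. ennreal (3 * (1 + a * P\<^sup>2)) + ennreal (3 * a) * ennreal ((norm_power m y)\<^sup>2) \<partial>\<mu>)"
    using pt a by (intro nn_integral_mono)
      (simp add: ennreal_plus[symmetric] ennreal_mult'[symmetric] ennreal_leI del: ennreal_plus)
  also have "\<dots> = ennreal (3 * (1 + a * P\<^sup>2)) + ennreal (3 * a) * (\<integral>\<^sup>+y. ennreal ((norm_power m y)\<^sup>2) \<partial>\<mu>)"
    by (simp add: nn_integral_add nn_integral_cmult emeasure_space_1)
  also have "\<dots> \<le> ennreal (3 * (1 + a * P\<^sup>2)) + ennreal (3 * a) * ennreal (C * T)"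
    unfolding C_def T_def by (intro add_mono mult_left_mono norm_power_moment[OF e \<tau> m p]) auto
  also have "\<dots> = ennreal (3 * (1 + a * P\<^sup>2) + 3 * a * (C * T))"
    using a C T by (simp add: ennreal_plus[symmetric] ennreal_mult'[symmetric] del: ennreal_plus)
  also have "3 * (1 + a * P\<^sup>2) + 3 * a * (C * T) \<le> 3 * a * C * (1 + sqrt T + P)\<^sup>2"
  proof -
    have "1 \<le> a * C" using a C mult_mono[of 1 a 1 C] by simp
    moreover have "a * P\<^sup>2 * 1 \<le> a * P\<^sup>2 * C" using a C by (intro mult_left_mono) auto
    ultimately have "3 * (1 + a * P\<^sup>2) + 3 * a * (C * T) \<le> 3 * a * C * (1 + T + P\<^sup>2)"
      by (simp add: algebra_simps)
    also have "\<dots> \<le> 3 * a * C * (1 + sqrt T + P)\<^sup>2"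
    proof (rule mult_left_mono)
      have "0 \<le> 2 * sqrt T + 2 * P + 2 * (sqrt T * P)" using P T by simp
      then show "1 + T + P\<^sup>2 \<le> (1 + sqrt T + P)\<^sup>2"
        using T by (simp add: power2_eq_square algebra_simps)
    qed (use a C in simp)
    finally show ?thesis .
  qed
  finally have le: "(\<integral>\<^sup>+y. ennreal ((envelope m \<rho> y)\<^sup>2) \<partial>\<mu>) \<le> ennreal (3 * a * C * (1 + sqrt T + P)\<^sup>2)"
    by (simp add: ennreal_leI)
  then show int: "integrable \<mu> (\<lambda>y. (envelope m \<rho> y)\<^sup>2)"
    by (intro integrableI_bounded) (auto simp: measurable_\<mu> intro: order_le_less_trans)
  have "(\<integral>y. (envelope m \<rho> y)\<^sup>2 \<partial>\<mu>) \<le> 3 * a * C * (1 + sqrt T + P)\<^sup>2"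
    using le int a C by (simp add: nn_integral_eq_integral)
  then have "sqrt (\<integral>y. (envelope m \<rho> y)\<^sup>2 \<partial>\<mu>) \<le> sqrt (3 * a * C * (1 + sqrt T + P)\<^sup>2)" by simp
  also have "\<dots> = sqrt (3 * a * C) * (1 + sqrt T + P)"
    using P T by (simp add: real_sqrt_mult)
  finally show "sqrt (\<integral>y. (envelope m \<rho> y)\<^sup>2 \<partial>\<mu>) \<le> sqrt (3 * (2 powr m)\<^sup>2 * (1 + fact (2 * p) / (2 ^ p * fact p)))
      * (1 + sqrt (norm_power m \<tau>) + norm_power m \<rho>)"
    unfolding a_def C_def T_def P_def .
qed

end

text \<open>Approximants \<open>g n\<close> within \<open>(1/2) ^ Suc n\<close> of \<open>h\<close>
  have increments at most \<open>(1/2) ^ n\<close>. The isometry turns these into mean squares at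
  most \<open>(1/4) ^ n\<close>, the rate \<open>rapid_L2_limit\<close> asks for, and the limit is a
  witness for the choice in \<open>gaussian_functional\<close>.\<close>

lemma white_noise_gaussian_functional:
  assumes "hilbert_gaussian (sqrt_op Q) (gaussian Q)" and h: "h \<in> closure (range (sqrt_op Q))"
  shows "hilbert_gaussian.white_noise (sqrt_op Q) (gaussian Q) h (gaussian_functional Q h)"
proof -
  interpret hilbert_gaussian "sqrt_op Q" "gaussian Q" by fact
  let ?v = "\<lambda>g. pinv (sqrt_op Q) g"
  let ?P = "\<lambda>W. W \<in> borel_measurable (gaussian Q) \<and> integrable (gaussian Q) (\<lambda>y. (W y)\<^sup>2) \<and>
     (\<exists>g :: nat \<Rightarrow> 'a. range g \<subseteq> range (sqrt_op Q) \<and> g \<longlonglongrightarrow> h \<and>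
        (\<lambda>n. \<integral>\<^sup>+ y. ennreal ((inner (pinv (sqrt_op Q) (g n)) y - W y)\<^sup>2) \<partial>gaussian Q) \<longlonglongrightarrow> 0)"
  have noise: "white_noise h W" if W: "?P W" for W
  proof -
    from W obtain g where g: "range g \<subseteq> range (sqrt_op Q)" "g \<longlonglongrightarrow> h"
      "(\<lambda>n. \<integral>\<^sup>+ y. ennreal ((inner (?v (g n)) y - W y)\<^sup>2) \<partial>gaussian Q) \<longlonglongrightarrow> 0" by blast
    have "sqrt_op Q (?v (g n)) = g n" for n using g(1) by (intro pinv(1)) blast
    then have "(\<lambda>n. sqrt_op Q (?v (g n))) \<longlonglongrightarrow> h" using g(2) by simp
    with g(3) W show ?thesis
      unfolding white_noise_def measurable_\<mu> by (intro conjI exI[of _ "\<lambda>n. ?v (g n)"]) simp_all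
  qed
  have "\<exists>W. ?P W"
  proof -
    have "\<exists>g\<in>range (sqrt_op Q). dist g h < (1/2) ^ Suc n" for n
      using h[unfolded closure_approachable, rule_format, of "(1/2) ^ Suc n"] by (simp only: zero_less_power half_gt_zero_iff zero_less_one)
    then obtain g where g: "\<And>n. g n \<in> range (sqrt_op Q)" "\<And>n. dist (g n) h < (1/2) ^ Suc n" by metis
    have Rv: "sqrt_op Q (?v (g n)) = g n" for n using g(1) by (rule pinv(1))
    have gh: "g \<longlonglongrightarrow> h"
    proof (rule metric_LIMSEQ_I)
      fix r :: real assume "r > 0"
      then obtain N where N: "(1/2) ^ N < r" using real_arch_pow_inv[of r "1/2"] by auto
      have "dist (g n) h < r" if "n \<ge> N" for n
      proof -
        have "(1/2::real) ^ Suc n \<le> (1/2) ^ N" using that by (intro power_decreasing) auto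
        with N g(2)[of n] show ?thesis by linarith
      qed
      then show "\<exists>N. \<forall>n\<ge>N. dist (g n) h < r" by blast
    qed
    have "(\<integral>\<^sup>+y. ennreal ((norm (inner (?v (g (Suc n))) y - inner (?v (g n)) y))\<^sup>2) \<partial>gaussian Q)
        \<le> ennreal ((1/4) ^ n)" for n
    proof -
      have "(\<integral>\<^sup>+y. ennreal ((norm (inner (?v (g (Suc n))) y - inner (?v (g n)) y))\<^sup>2) \<partial>gaussian Q)
          = ennreal ((norm (g (Suc n) - g n))\<^sup>2)"
        using white_noise_L2[OF white_noise_range, of "?v (g (Suc n)) - ?v (g n)"]
        by (simp add: inner_diff_left blinfun.diff_right Rv)
      also have "(norm (g (Suc n) - g n))\<^sup>2 \<le> ((1/2) ^ n)\<^sup>2"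
      proof (rule power_mono)
        have "norm (g (Suc n) - g n) \<le> dist (g (Suc n)) h + dist (g n) h"
          using dist_triangle2[of "g (Suc n)" "g n" h] by (simp add: dist_norm)
        also have "\<dots> \<le> (1/2) ^ Suc (Suc n) + (1/2) ^ Suc n" using g(2)[of n] g(2)[of "Suc n"] by linarith
        also have "\<dots> \<le> (1/2) ^ n" by simp
        finally show "norm (g (Suc n) - g n) \<le> (1/2) ^ n" .
      qed simp
      also have "((1/2) ^ n)\<^sup>2 = (1/4 :: real) ^ n" by (simp add: power2_eq_square power_mult_distrib[symmetric])
      finally show ?thesis by (simp add: ennreal_leI)
    qed
    from rapid_L2_limit[OF prob _ this] obtain W where W: "W \<in> borel_measurable (gaussian Q)"
      "(\<lambda>n. \<integral>\<^sup>+y. ennreal ((norm (inner (?v (g n)) y - W y))\<^sup>2) \<partial>gaussian Q) \<longlonglongrightarrow> 0" by auto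
    have "white_noise h W"
      unfolding white_noise_def measurable_\<mu>[symmetric] using W gh
      by (intro conjI exI[of _ "\<lambda>n. ?v (g n)"]) (simp_all add: Rv)
    from white_noise_L2_integral[OF this] have "integrable (gaussian Q) (\<lambda>y. (W y)\<^sup>2)"
      by (simp add: has_bochner_integral_iff)
    with W g(1) gh show ?thesis by (intro exI[of _ W] conjI exI[of _ g]) auto
  qed
  then have "?P (gaussian_functional Q h)" unfolding gaussian_functional_def by (rule someI_ex)
  then show ?thesis by (rule noise)
qed


section \<open>Gradients as Riesz vectors and limits of difference quotients\<close>

locale gaussian_direction = hilbert_gaussian R \<mu>
  for R :: "'h::{real_inner,banach,second_countable_topology} \<Rightarrow>\<^sub>L 'h" and \<mu> +
  fixes \<Gamma> :: "'k::{real_inner,banach} \<Rightarrow>\<^sub>L 'h" and W :: "'k \<Rightarrow> 'h \<Rightarrow> real"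
  assumes noise: "\<And>k. white_noise (\<Gamma> k) (W k)"
begin

definition L2 :: "('h \<Rightarrow> real) \<Rightarrow> bool" where
  "L2 g \<longleftrightarrow> g \<in> borel_measurable borel \<and> integrable \<mu> (\<lambda>y. (g y)\<^sup>2)"

definition L2norm :: "('h \<Rightarrow> real) \<Rightarrow> real" where
  "L2norm g = sqrt (\<integral>y. (g y)\<^sup>2 \<partial>\<mu>)"

lemma integrable_noise: "L2 g \<Longrightarrow> integrable \<mu> (\<lambda>y. g y * W k y)"
  unfolding L2_def using shift_remainder_bound(3)[OF noise] by blast

text \<open>The functionals \<open>W k\<close> are chosen separately for each \<open>k\<close>, so
  linearity in \<open>k\<close> holds only almost surely for each combination; this is enough under
  the integral.\<close>

lemma integral_noise_add:
  assumes g: "L2 g"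
  shows "(\<integral>y. g y * W (a *\<^sub>R k + b *\<^sub>R l) y \<partial>\<mu>) = a * (\<integral>y. g y * W k y \<partial>\<mu>) + b * (\<integral>y. g y * W l y \<partial>\<mu>)"
proof -
  have [measurable]: "W k \<in> borel_measurable borel" "g \<in> borel_measurable borel" for k
    using white_noise_measurable[OF noise] g by (auto simp: L2_def)
  have "white_noise (a *\<^sub>R \<Gamma> k + b *\<^sub>R \<Gamma> l) (W (a *\<^sub>R k + b *\<^sub>R l))"
    using noise[of "a *\<^sub>R k + b *\<^sub>R l"] by (simp add: blinfun.bilinear_simps)
  from white_noise_unique[OF this white_noise_lincomb[OF noise noise]]
  have "(\<integral>y. g y * W (a *\<^sub>R k + b *\<^sub>R l) y \<partial>\<mu>) = (\<integral>y. a * (g y * W k y) + b * (g y * W l y) \<partial>\<mu>)"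
    by (intro integral_cong_AE) (auto simp: algebra_simps)
  also have "\<dots> = a * (\<integral>y. g y * W k y \<partial>\<mu>) + b * (\<integral>y. g y * W l y \<partial>\<mu>)"
    using integrable_noise[OF g] by simp
  finally show ?thesis .
qed

text \<open>The adjoint of \<open>k \<mapsto> W k\<close>, regarded as an operator into
  \<open>L\<^sup>2\<close>, applied to \<open>g\<close>. For \<open>g\<close> a translate of
  \<open>\<phi>\<close> this is the gradient sought.\<close>

definition dual :: "('h \<Rightarrow> real) \<Rightarrow> 'k" where
  "dual g = (SOME d. \<forall>k. (\<integral>y. g y * W k y \<partial>\<mu>) = inner d k)"

lemma dual:
  assumes g: "L2 g"
  shows "(\<integral>y. g y * W k y \<partial>\<mu>) = inner (dual g) k" "norm (dual g) \<le> L2norm g * norm \<Gamma>"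
proof -
  have bound: "\<bar>\<integral>y. g y * W k y \<partial>\<mu>\<bar> \<le> L2norm g * norm \<Gamma> * norm k" for k
  proof -
    have "\<bar>\<integral>y. g y * W k y \<partial>\<mu>\<bar> \<le> L2norm g * norm (\<Gamma> k)"
      using white_noise_integral_bound[OF noise] g by (simp add: L2_def L2norm_def)
    also have "\<dots> \<le> L2norm g * (norm \<Gamma> * norm k)"
      by (intro mult_left_mono norm_blinfun) (simp add: L2norm_def)
    finally show ?thesis by (simp add: mult.assoc)
  qed
  have "bounded_linear (\<lambda>k. \<integral>y. g y * W k y \<partial>\<mu>)"
  proof (rule bounded_linear_intro[where K = "L2norm g * norm \<Gamma>"])
    show "(\<integral>y. g y * W (k + l) y \<partial>\<mu>) = (\<integral>y. g y * W k y \<partial>\<mu>) + (\<integral>y. g y * W l y \<partial>\<mu>)" for k l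
      using integral_noise_add[OF g, of 1 k 1 l] by simp
    show "(\<integral>y. g y * W (r *\<^sub>R k) y \<partial>\<mu>) = r *\<^sub>R (\<integral>y. g y * W k y \<partial>\<mu>)" for r k
      using integral_noise_add[OF g, of r k 0 k] by simp
    show "norm (\<integral>y. g y * W k y \<partial>\<mu>) \<le> norm k * (L2norm g * norm \<Gamma>)" for k
      using bound[of k] by (simp add: mult.commute)
  qed
  then have "\<exists>d. \<forall>k. (\<integral>y. g y * W k y \<partial>\<mu>) = inner d k" by (rule riesz_representation) blast
  then have d: "\<forall>k. (\<integral>y. g y * W k y \<partial>\<mu>) = inner (dual g) k" unfolding dual_def by (rule someI_ex)
  then show "(\<integral>y. g y * W k y \<partial>\<mu>) = inner (dual g) k" by blast
  have "norm (dual g) * norm (dual g) \<le> norm (dual g) * (L2norm g * norm \<Gamma>)"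
    using bound[of "dual g"] d by (simp add: power2_norm_eq_inner[symmetric] power2_eq_square mult.commute)
  then show "norm (dual g) \<le> L2norm g * norm \<Gamma>"
    by (rule square_le_mult_imp_le) (simp add: L2norm_def)
qed

lemma dual_diff_bound:
  assumes f: "L2 f" and g: "L2 g" and fg: "L2 (\<lambda>y. f y - g y)"
  shows "norm (dual f - dual g) \<le> L2norm (\<lambda>y. f y - g y) * norm \<Gamma>"
proof -
  have "inner (dual f - dual g) k = inner (dual (\<lambda>y. f y - g y)) k" for k
    unfolding inner_diff_left dual(1)[OF f, symmetric] dual(1)[OF g, symmetric] dual(1)[OF fg, symmetric]
    using integrable_noise[OF f] integrable_noise[OF g] by (simp add: left_diff_distrib)
  then have "dual f - dual g = dual (\<lambda>y. f y - g y)" by (metis vector_eq_rdot)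
  then show ?thesis using dual(2)[OF fg] by simp
qed

lemma quotient_bound:
  assumes g: "L2 g" and s: "s \<noteq> 0" "\<bar>s\<bar> * (norm \<Gamma> * norm k) \<le> 1"
  shows "\<bar>((\<integral>y. g (y + R (\<Gamma> (s *\<^sub>R k))) \<partial>\<mu>) - (\<integral>y. g y \<partial>\<mu>)) / s - inner (dual g) k\<bar>
    \<le> \<bar>s\<bar> * ((norm \<Gamma> * norm k)\<^sup>2 * L2norm g)"
proof -
  have le: "norm (\<Gamma> k) \<le> norm \<Gamma> * norm k" by (rule norm_blinfun)
  have "\<bar>s\<bar> * norm (\<Gamma> k) \<le> 1" using s(2) mult_left_mono[OF le, of "\<bar>s\<bar>"] by simp
  from difference_quotient_bound[OF noise _ _ s(1) this, of g] g
  have "\<bar>((\<integral>y. g (y + R (\<Gamma> (s *\<^sub>R k))) \<partial>\<mu>) - (\<integral>y. g y \<partial>\<mu>)) / s - inner (dual g) k\<bar>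
      \<le> \<bar>s\<bar> * (norm (\<Gamma> k))\<^sup>2 * L2norm g"
    by (simp add: L2_def L2norm_def dual(1)[OF g, symmetric] blinfun.scaleR_right)
  also have "\<dots> \<le> \<bar>s\<bar> * (norm \<Gamma> * norm k)\<^sup>2 * L2norm g"
    by (intro mult_right_mono mult_left_mono power_mono le) (auto simp: L2norm_def)
  finally show ?thesis by (simp add: mult.assoc)
qed

lemma uniform_limit_quotient:
  assumes g: "L2 g" and \<rho>: "\<rho> \<ge> 0"
  shows "uniform_limit {k. norm k \<le> \<rho>}
    (\<lambda>s k. ((\<integral>y. g (y + R (\<Gamma> (s *\<^sub>R k))) \<partial>\<mu>) - (\<integral>y. g y \<partial>\<mu>)) / s) (\<lambda>k. inner (dual g) k) (at 0)"
proof (rule uniform_limitI)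
  fix e :: real assume e: "e > 0"
  define a where "a = norm \<Gamma> * \<rho>"
  define C where "C = a\<^sup>2 * L2norm g"
  have a: "a \<ge> 0" and C: "C \<ge> 0" using \<rho> by (auto simp: a_def C_def L2norm_def)
  \<comment> \<open>The first bound makes \<open>quotient_bound\<close> applicable for every
    \<open>k\<close> in the ball, the second pushes its error below \<open>e\<close>; the summands 1
    avoid division by 0.\<close>
  define d where "d = min (1 / (a + 1)) (e / (C + 1))"
  have d: "d > 0" using a C e by (simp add: d_def)
  have "\<bar>((\<integral>y. g (y + R (\<Gamma> (s *\<^sub>R k))) \<partial>\<mu>) - (\<integral>y. g y \<partial>\<mu>)) / s - inner (dual g) k\<bar> < e"
    if s: "s \<noteq> 0" "\<bar>s\<bar> < d" and k: "norm k \<le> \<rho>" for s k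
  proof -
    have ka: "norm \<Gamma> * norm k \<le> a" unfolding a_def using k by (intro mult_left_mono) auto
    have "\<bar>s\<bar> * (a + 1) < 1" using s(2) a by (simp add: d_def field_simps)
    moreover have "\<bar>s\<bar> * (norm \<Gamma> * norm k) \<le> \<bar>s\<bar> * (a + 1)" using ka by (intro mult_left_mono) auto
    ultimately have "\<bar>s\<bar> * (norm \<Gamma> * norm k) \<le> 1" by linarith
    from quotient_bound[OF g s(1) this]
    have "\<bar>((\<integral>y. g (y + R (\<Gamma> (s *\<^sub>R k))) \<partial>\<mu>) - (\<integral>y. g y \<partial>\<mu>)) / s - inner (dual g) k\<bar>
        \<le> \<bar>s\<bar> * ((norm \<Gamma> * norm k)\<^sup>2 * L2norm g)" .
    also have "\<dots> \<le> \<bar>s\<bar> * (C + 1)"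
    proof (rule mult_left_mono)
      have "(norm \<Gamma> * norm k)\<^sup>2 * L2norm g \<le> C"
        unfolding C_def using ka by (intro mult_right_mono power_mono) (auto simp: L2norm_def)
      then show "(norm \<Gamma> * norm k)\<^sup>2 * L2norm g \<le> C + 1" by simp
    qed simp
    also have "\<dots> < e" using s(2) C by (simp add: d_def field_simps)
    finally show ?thesis .
  qed
  then show "\<forall>\<^sub>F s in at 0. \<forall>k\<in>{k. norm k \<le> \<rho>}.
      dist (((\<integral>y. g (y + R (\<Gamma> (s *\<^sub>R k))) \<partial>\<mu>) - (\<integral>y. g y \<partial>\<mu>)) / s) (inner (dual g) k) < e"
    unfolding eventually_at using d by (intro exI[of _ d]) (auto simp: dist_real_def)
qed

lemma L2_dominated:
  assumes "f \<in> borel_measurable borel" "L2 g" "\<And>y. \<bar>f y\<bar> \<le> g y"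
  shows "L2 f" "L2norm f \<le> L2norm g"
proof -
  have le: "(f y)\<^sup>2 \<le> (g y)\<^sup>2" for y using assms(3)[of y] by (simp add: abs_le_square_iff[symmetric])
  have g: "integrable \<mu> (\<lambda>y. (g y)\<^sup>2)" using assms(2) by (simp add: L2_def)
  have f: "integrable \<mu> (\<lambda>y. (f y)\<^sup>2)"
    by (rule Bochner_Integration.integrable_bound[OF g]) (use assms(1) le in \<open>auto simp: measurable_\<mu>\<close>)
  then show "L2 f" using assms(1) by (simp add: L2_def)
  show "L2norm f \<le> L2norm g"
    unfolding L2norm_def by (intro real_sqrt_le_mono integral_mono f g le)
qed

lemma L2_cmult:
  assumes "L2 g" "c \<ge> 0"
  shows "L2 (\<lambda>y. c * g y)" "L2norm (\<lambda>y. c * g y) = c * L2norm g"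
  using assms by (auto simp: L2_def L2norm_def power_mult_distrib real_sqrt_mult)

text \<open>Gaussian integration by parts: both sides are the limit of the same difference quotients.\<close>

lemma dual_eq_gradient_integral:
  fixes \<phi> :: "'h \<Rightarrow> real" and m :: real
  assumes \<phi>: "L2 (\<lambda>y. \<phi> (y + z))" and diff: "\<And>x. GDERIV \<phi> x :> \<phi>' x"
    and cont: "continuous_on UNIV \<phi>'" and N: "\<And>x. norm (\<phi>' x) \<le> N * weight m x" "0 \<le> N" and m: "m \<ge> 0"
    and env: "\<And>\<rho>. integrable \<mu> (\<lambda>y. envelope m \<rho> y)"
  shows "has_bochner_integral \<mu> (\<lambda>y. inner (\<phi>' (y + z)) (R (\<Gamma> k))) (inner (dual (\<lambda>y. \<phi> (y + z))) k)"
proof -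
  define h where "h = R (\<Gamma> k)"
  \<comment> \<open>Covers \<open>z\<close> plus any vector no longer than \<open>h\<close>, hence
    the segments joining \<open>z\<close> to \<open>z + s n *\<^sub>R h\<close> for steps at most
    1.\<close>
  define \<rho> where "\<rho> = norm z + norm h"
  define w where "w y = N * envelope m \<rho> y * norm h" for y :: 'h
  have [measurable]: "\<phi>' \<in> borel_measurable borel" using cont by (rule borel_measurable_continuous_onI)
  have "continuous_on UNIV \<phi>"
    using diff unfolding gderiv_def
    by (meson continuous_at_imp_continuous_on has_derivative_continuous)
  then have [measurable]: "\<phi> \<in> borel_measurable borel" by (rule borel_measurable_continuous_onI)
  have bound: "norm (\<phi>' (y + z + a)) \<le> N * envelope m \<rho> y" if "norm a \<le> norm h" for y a
  proof -
    have "norm (z + a) \<le> \<rho>" unfolding \<rho>_def using that norm_triangle_ineq[of z a] by linarith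
    from weight_add_le_envelope[OF m this, of y]
    have "N * weight m (y + z + a) \<le> N * envelope m \<rho> y"
      using N(2) by (intro mult_left_mono) (simp_all add: add.assoc)
    with N(1)[of "y + z + a"] show ?thesis by linarith
  qed
  have int: "integrable \<mu> w" unfolding w_def using env by simp
  have int': "integrable \<mu> (\<lambda>y. inner (\<phi>' (y + z)) h)"
  proof (rule Bochner_Integration.integrable_bound[OF int])
    show "AE y in \<mu>. norm (inner (\<phi>' (y + z)) h) \<le> norm (w y)"
    proof (rule AE_I2)
      fix y
      have "norm (inner (\<phi>' (y + z)) h) \<le> norm (\<phi>' (y + z)) * norm h"
        using Cauchy_Schwarz_ineq2 by simp
      also have "\<dots> \<le> w y" unfolding w_def using bound[of 0 y] by (intro mult_right_mono) auto
      finally show "norm (inner (\<phi>' (y + z)) h) \<le> norm (w y)" by simp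
    qed
  qed measurable
  define s where "s n = 1 / real (Suc n)" for n
  have s: "s n > 0" "s n \<le> 1" for n by (auto simp: s_def)
  have s0: "s \<longlonglongrightarrow> 0" unfolding s_def by (rule LIMSEQ_Suc[OF lim_1_over_n])
  have s_at: "filterlim s (at 0) sequentially"
    unfolding filterlim_at using s0 s(1) by (simp add: less_imp_neq[OF s(1), symmetric])
  have quot: "(\<lambda>n. ((\<integral>y. \<phi> (y + R (\<Gamma> (s n *\<^sub>R k)) + z) \<partial>\<mu>) - (\<integral>y. \<phi> (y + z) \<partial>\<mu>)) / s n)
      \<longlonglongrightarrow> inner (dual (\<lambda>y. \<phi> (y + z))) k"
    using filterlim_compose[OF tendsto_uniform_limitI[OF uniform_limit_quotient[OF \<phi>, of "norm k"]] s_at, of k]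
    by simp
  have eq: "((\<integral>y. \<phi> (y + R (\<Gamma> (s n *\<^sub>R k)) + z) \<partial>\<mu>) - (\<integral>y. \<phi> (y + z) \<partial>\<mu>)) / s n
      = (\<integral>y. (\<phi> (y + z + s n *\<^sub>R h) - \<phi> (y + z)) / s n \<partial>\<mu>)" for n
  proof -
    have sq: "(\<lambda>y. \<phi> (y + z)) \<in> borel_measurable borel" "integrable \<mu> (\<lambda>y. (\<phi> (y + z))\<^sup>2)"
      using \<phi> unfolding L2_def by blast+
    have "integrable \<mu> (\<lambda>y. \<phi> (y + R (\<Gamma> (s n *\<^sub>R k)) + z))" "integrable \<mu> (\<lambda>y. \<phi> (y + z))"
      using shift_remainder_bound(1)[OF noise sq] shift_remainder_bound(2)[OF noise sq] .
    then have "((\<integral>y. \<phi> (y + R (\<Gamma> (s n *\<^sub>R k)) + z) \<partial>\<mu>) - (\<integral>y. \<phi> (y + z) \<partial>\<mu>)) / s n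
      = (\<integral>y. (\<phi> (y + R (\<Gamma> (s n *\<^sub>R k)) + z) - \<phi> (y + z)) / s n \<partial>\<mu>)" by simp
    then show ?thesis by (simp add: h_def blinfun.scaleR_right add_ac)
  qed
  have quot': "(\<lambda>n. (\<integral>y. (\<phi> (y + z + s n *\<^sub>R h) - \<phi> (y + z)) / s n \<partial>\<mu>))
      \<longlonglongrightarrow> inner (dual (\<lambda>y. \<phi> (y + z))) k"
    using quot unfolding eq .
  have "(\<lambda>n. (\<integral>y. (\<phi> (y + z + s n *\<^sub>R h) - \<phi> (y + z)) / s n \<partial>\<mu>)) \<longlonglongrightarrow> (\<integral>y. inner (\<phi>' (y + z)) h \<partial>\<mu>)"
  proof (rule integral_dominated_convergence[OF _ _ int])
    show "AE y in \<mu>. (\<lambda>n. (\<phi> (y + z + s n *\<^sub>R h) - \<phi> (y + z)) / s n) \<longlonglongrightarrow> inner (\<phi>' (y + z)) h"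
    proof (rule AE_I2)
      fix y
      have "((\<lambda>r. \<phi> (y + z + r *\<^sub>R h)) has_derivative (\<lambda>r. inner (r *\<^sub>R h) (\<phi>' (y + z)))) (at 0)"
      proof (rule has_derivative_compose[where f = "\<lambda>r. y + z + r *\<^sub>R h" and g = \<phi>])
        show "((\<lambda>r. y + z + r *\<^sub>R h) has_derivative (\<lambda>r. r *\<^sub>R h)) (at 0)"
          by (auto intro!: derivative_eq_intros)
        show "(\<phi> has_derivative (\<lambda>h. inner h (\<phi>' (y + z)))) (at (y + z + 0 *\<^sub>R h))"
          using diff[of "y + z"] by (simp add: gderiv_def)
      qed
      then have "((\<lambda>r. \<phi> (y + z + r *\<^sub>R h)) has_field_derivative inner (\<phi>' (y + z)) h) (at 0)"
        by (simp add: has_field_derivative_def inner_commute mult_commute_abs)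
      then have "((\<lambda>r. (\<phi> (y + z + r *\<^sub>R h) - \<phi> (y + z)) / r) \<longlongrightarrow> inner (\<phi>' (y + z)) h) (at 0)"
        by (simp add: DERIV_def)
      from filterlim_compose[OF this s_at]
      show "(\<lambda>n. (\<phi> (y + z + s n *\<^sub>R h) - \<phi> (y + z)) / s n) \<longlonglongrightarrow> inner (\<phi>' (y + z)) h" .
    qed
    fix n
    show "AE y in \<mu>. norm ((\<phi> (y + z + s n *\<^sub>R h) - \<phi> (y + z)) / s n) \<le> w y"
    proof (rule AE_I2)
      fix y
      \<comment> \<open>The mean value inequality on the ball around \<open>y + z\<close> gives a
        majorant of the quotients that does not depend on \<open>n\<close>.\<close>
      have "norm (\<phi> (y + z + s n *\<^sub>R h) - \<phi> (y + z)) \<le> (N * envelope m \<rho> y) * norm (y + z + s n *\<^sub>R h - (y + z))"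
      proof (rule differentiable_bound[where S = "cball (y + z) (norm h)" and f' = "\<lambda>x h. inner h (\<phi>' x)"])
        show "(\<phi> has_derivative (\<lambda>h. inner h (\<phi>' x))) (at x within cball (y + z) (norm h))" for x
          using diff[of x] unfolding gderiv_def by (rule has_derivative_at_withinI)
        show "y + z \<in> cball (y + z) (norm h)" by simp
        have "s n * norm h \<le> 1 * norm h" using s[of n] by (intro mult_right_mono) auto
        then show "y + z + s n *\<^sub>R h \<in> cball (y + z) (norm h)"
          using s[of n] by (simp add: dist_norm)
        fix x assume "x \<in> cball (y + z) (norm h)"
        then have "norm (\<phi>' (y + z + (x - (y + z)))) \<le> N * envelope m \<rho> y"
          by (intro bound) (simp add: dist_norm norm_minus_commute)
        then have le: "norm (\<phi>' x) \<le> N * envelope m \<rho> y" by simp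
        show "onorm (\<lambda>h. inner h (\<phi>' x)) \<le> N * envelope m \<rho> y"
        proof (rule onorm_bound)
          show "0 \<le> N * envelope m \<rho> y" using le norm_ge_zero order_trans by blast
          fix v
          have "norm (inner v (\<phi>' x)) \<le> norm v * norm (\<phi>' x)" using Cauchy_Schwarz_ineq2 by simp
          also have "\<dots> \<le> norm v * (N * envelope m \<rho> y)" using le by (intro mult_left_mono) auto
          finally show "norm (inner v (\<phi>' x)) \<le> (N * envelope m \<rho> y) * norm v" by (simp add: mult_ac)
        qed
      qed simp
      also have "\<dots> = s n * w y" using s[of n] by (simp add: w_def)
      finally show "norm ((\<phi> (y + z + s n *\<^sub>R h) - \<phi> (y + z)) / s n) \<le> w y"
        using s[of n] by (simp add: abs_divide pos_divide_le_eq mult.commute)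
    qed
  qed measurable
  from LIMSEQ_unique[OF this quot'] int' show ?thesis
    by (simp add: has_bochner_integral_iff h_def)
qed

end

section \<open>The Ornstein--Uhlenbeck semigroup\<close>

locale ornstein_uhlenbeck_G = ornstein_uhlenbeck S \<sigma> M \<omega>
  for S :: "real \<Rightarrow> 'h::{real_inner,banach,second_countable_topology} \<Rightarrow>\<^sub>L 'h"
    and \<sigma> :: "'x::{real_inner,banach,second_countable_topology} \<Rightarrow>\<^sub>L 'h" and M \<omega> +
  fixes D :: "'k::{real_inner,banach,second_countable_topology} set" and G :: "'k \<Rightarrow> 'h"
    and E :: "real \<Rightarrow> 'k \<Rightarrow>\<^sub>L 'h" and m :: real
  assumes dense: "closure D = UNIV"
    and E_G: "\<And>t z. t > 0 \<Longrightarrow> z \<in> D \<Longrightarrow> E t z = S t (G z)"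
    and range_E: "\<And>t. t > 0 \<Longrightarrow> range (E t) \<subseteq> range (sqrt_op (cov_op S \<sigma> t))"
    and m: "m \<ge> 0"
begin

abbreviation \<Gamma> :: "real \<Rightarrow> 'k \<Rightarrow>\<^sub>L 'h" where "\<Gamma> t \<equiv> Gamma_op S \<sigma> E t"

abbreviation \<mu> :: "real \<Rightarrow> 'h measure" where "\<mu> t \<equiv> gaussian (cov_op S \<sigma> t)"

abbreviation noise :: "real \<Rightarrow> 'k \<Rightarrow> 'h \<Rightarrow> real" where
  "noise t k \<equiv> gaussian_functional (cov_op S \<sigma> t) (\<Gamma> t k)"

lemma \<Gamma>:
  assumes t: "t > 0"
  shows "Q_sqrt t (\<Gamma> t k) = E t k" "\<Gamma> t k \<in> closure (range (Q_sqrt t))"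
proof -
  have R: "nonneg_selfadjoint (Q_sqrt t)" using t by (intro Q_sqrt) simp
  have "\<Gamma> t k = pinv (Q_sqrt t) (E t k)"
    unfolding Gamma_op_def
    using bounded_linear_pinv_compose[OF R range_E[OF t]] by (simp add: bounded_linear_Blinfun_apply)
  moreover have "E t k \<in> range (Q_sqrt t)" using range_E[OF t] by blast
  ultimately show "Q_sqrt t (\<Gamma> t k) = E t k" "\<Gamma> t k \<in> closure (range (Q_sqrt t))"
    using pinv(1) pinv_in_closure_range[OF R] by simp_all
qed

lemma gaussian_direction_OU:
  assumes t: "t > 0"
  shows "gaussian_direction (Q_sqrt t) (\<mu> t) (\<Gamma> t) (noise t)"
  by (intro gaussian_direction.intro gaussian_direction_axioms.intro hilbert_gaussian_Q
      white_noise_gaussian_functional \<Gamma> t)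

abbreviation L2_OU where "L2_OU t \<equiv> gaussian_direction.L2 (\<mu> t)"
abbreviation L2norm_OU where "L2norm_OU t \<equiv> gaussian_direction.L2norm (\<mu> t)"
abbreviation dual_OU where "dual_OU t \<equiv> gaussian_direction.dual (\<mu> t) (noise t)"

text \<open>For \<open>z\<close> in the domain, \<open>S t (x + s *\<^sub>R G z) = S t x + Q_sqrt t
  (\<Gamma> t (s *\<^sub>R z))\<close>: the semigroup carries the unbounded displacement into the
  range of the root, where the difference quotients for shifts of the measure apply.\<close>

lemma has_G_gradient_OU:
  assumes t: "t > 0" and g: "L2_OU t (\<lambda>y. \<phi> (y + S t x))"
  shows "has_G_gradient D G (OU S \<sigma> t \<phi>) x (dual_OU t (\<lambda>y. \<phi> (y + S t x)))"
proof -
  interpret gaussian_direction "Q_sqrt t" "\<mu> t" "\<Gamma> t" "noise t" by (rule gaussian_direction_OU[OF t])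
  let ?d = "dual_OU t (\<lambda>y. \<phi> (y + S t x))"
  have quot: "G_quotient G (OU S \<sigma> t \<phi>) x s z =
      ((\<integral>y. \<phi> (y + Q_sqrt t (\<Gamma> t (s *\<^sub>R z)) + S t x) \<partial>\<mu> t) - (\<integral>y. \<phi> (y + S t x) \<partial>\<mu> t)) / s"
    if "z \<in> D" for s z
    by (simp add: G_quotient_def OU_def blinfun.bilinear_simps \<Gamma>(1)[OF t] E_G[OF t that] add_ac)
  have unif: "uniform_limit {z \<in> D. norm z \<le> \<rho>} (G_quotient G (OU S \<sigma> t \<phi>) x) (\<lambda>z. inner ?d z) (at 0)"
    if "\<rho> \<ge> 0" for \<rho>
  proof (rule uniform_limit_cong'[THEN iffD1])
    show "uniform_limit {z \<in> D. norm z \<le> \<rho>}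
       (\<lambda>s z. ((\<integral>y. \<phi> (y + Q_sqrt t (\<Gamma> t (s *\<^sub>R z)) + S t x) \<partial>\<mu> t) - (\<integral>y. \<phi> (y + S t x) \<partial>\<mu> t)) / s)
       (\<lambda>z. inner ?d z) (at 0)"
      by (rule uniform_limit_on_subset[OF uniform_limit_quotient[OF g that]]) auto
  qed (auto simp: quot)
  \<comment> \<open>The pointwise limit is required for \<open>z\<close> of any norm, so uniformity
    is used on the ball of radius \<open>norm z\<close>; the unit ball serves the second
    requirement.\<close>
  have "((\<lambda>s. G_quotient G (OU S \<sigma> t \<phi>) x s z) \<longlongrightarrow> inner ?d z) (at 0)" if "z \<in> D" for z
    by (rule tendsto_uniform_limitI[OF unif[of "norm z"]]) (use that in auto)
  then show ?thesis unfolding has_G_gradient_def using unif[of 1] by simp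
qed

lemma G_gradient_OU:
  assumes t: "t > 0" and g: "L2_OU t (\<lambda>y. \<phi> (y + S t x))"
  shows "G_gradient D G (OU S \<sigma> t \<phi>) x = dual_OU t (\<lambda>y. \<phi> (y + S t x))"
  by (rule G_gradient_eqI[OF dense has_G_gradient_OU[OF t g]])

text \<open>The order of the quantifiers is the point: \<open>K\<close> and \<open>\<kappa>\<close>
  precede \<open>t\<close>, and only \<open>\<tau>\<close>, the trace at time \<open>t\<close>,
  depends on it.\<close>

lemma envelope_L2_bound:
  "\<exists>K>0. \<exists>\<kappa>>0. \<forall>t>0. \<exists>\<tau>\<ge>0. \<tau> \<le> \<kappa> * growth t \<and> (\<forall>\<rho>. L2_OU t (envelope m \<rho>) \<and>
      L2norm_OU t (envelope m \<rho>) \<le> K * (1 + sqrt (norm_power m \<tau>) + norm_power m \<rho>))"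
proof -
  obtain e :: "nat \<Rightarrow> 'h" where e: "parseval e" using parseval_exists by blast
  obtain \<kappa> where \<kappa>: "\<kappa> > 0" "\<And>t. t > 0 \<Longrightarrow>
    \<exists>\<tau>. (\<lambda>k. (norm (Q_sqrt t (e k)))\<^sup>2) sums \<tau> \<and> \<tau> \<le> \<kappa> * growth t"
    by (rule trace_growth[OF e], rule that, assumption, blast)
  \<comment> \<open>The successor ensures \<open>p \<ge> 1\<close> also for
    \<open>m = 0\<close>.\<close>
  define p where "p = Suc (nat \<lceil>m\<rceil>)"
  have p: "p \<ge> 1" "m \<le> real p" unfolding p_def using m by linarith+
  define K where "K = sqrt (3 * (2 powr m)\<^sup>2 * (1 + fact (2 * p) / (2 ^ p * fact p)))"
  have K: "K > 0" unfolding K_def by (intro real_sqrt_gt_zero mult_pos_pos add_pos_nonneg) auto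
  have ex: "\<exists>\<tau>\<ge>0. \<tau> \<le> \<kappa> * growth t \<and> (\<forall>\<rho>. L2_OU t (envelope m \<rho>) \<and>
      L2norm_OU t (envelope m \<rho>) \<le> K * (1 + sqrt (norm_power m \<tau>) + norm_power m \<rho>))" if t: "t > 0" for t
  proof -
    interpret gaussian_direction "Q_sqrt t" "\<mu> t" "\<Gamma> t" "noise t" by (rule gaussian_direction_OU[OF t])
    obtain \<tau> where \<tau>: "(\<lambda>k. (norm (Q_sqrt t (e k)))\<^sup>2) sums \<tau>" "\<tau> \<le> \<kappa> * growth t" using \<kappa>(2)[OF t] by blast
    have "\<tau> \<ge> 0" using sums_le[OF _ sums_zero \<tau>(1)] by simp
    moreover have "L2_OU t (envelope m \<rho>)" "L2norm_OU t (envelope m \<rho>) \<le> K * (1 + sqrt (norm_power m \<tau>) + norm_power m \<rho>)" for \<rho>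
      using envelope_L2[OF e \<tau>(1) m p, of \<rho>] by (simp_all add: L2_def L2norm_def K_def)
    ultimately show ?thesis using \<tau>(2) by (intro exI[of _ \<tau>] conjI allI)
  qed
  show ?thesis by (rule exI[of _ K], rule conjI[OF K], rule exI[of _ \<kappa>], rule conjI[OF \<kappa>(1)]) (intro allI impI ex)
qed

lemma L2_envelope: "t > 0 \<Longrightarrow> L2_OU t (envelope m \<rho>)"
  using envelope_L2_bound by blast

lemma Bm_bound:
  assumes "\<phi> \<in> Bm m" "norm a \<le> \<rho>"
  shows "\<bar>\<phi> (y + a)\<bar> \<le> wnorm m \<phi> * envelope m \<rho> y"
proof -
  have b: "bdd_above (range (\<lambda>x. norm (\<phi> x) / weight m x))" using assms(1) by (simp add: Bm_def)
  have "\<bar>\<phi> (y + a)\<bar> \<le> wnorm m \<phi> * weight m (y + a)" using wnorm_bound(1)[OF b, of "y + a"] by simp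
  also have "\<dots> \<le> wnorm m \<phi> * envelope m \<rho> y"
    by (intro mult_left_mono weight_add_le_envelope m assms(2) wnorm_bound(2)[OF b])
  finally show ?thesis .
qed

lemma Bm_measurable: "(\<phi> :: 'h \<Rightarrow> real) \<in> Bm m \<Longrightarrow> (\<lambda>y. \<phi> (y + a)) \<in> borel_measurable borel"
proof -
  assume "\<phi> \<in> Bm m"
  then have [measurable]: "\<phi> \<in> borel_measurable borel" by (simp add: Bm_def)
  show ?thesis by measurable
qed

lemma wnorm_nonneg: "\<phi> \<in> Bm m \<Longrightarrow> 0 \<le> wnorm m \<phi>"
  by (rule wnorm_bound(2)) (simp add: Bm_def)

lemma L2_Bm:
  assumes \<phi>: "\<phi> \<in> Bm m" and t: "t > 0"
  shows "L2_OU t (\<lambda>y. \<phi> (y + a))" "L2norm_OU t (\<lambda>y. \<phi> (y + a)) \<le> wnorm m \<phi> * L2norm_OU t (envelope m (norm a))"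
proof -
  interpret gaussian_direction "Q_sqrt t" "\<mu> t" "\<Gamma> t" "noise t" by (rule gaussian_direction_OU[OF t])
  note w = L2_cmult[OF L2_envelope[OF t] wnorm_nonneg[OF \<phi>]]
  show "L2_OU t (\<lambda>y. \<phi> (y + a))" "L2norm_OU t (\<lambda>y. \<phi> (y + a)) \<le> wnorm m \<phi> * L2norm_OU t (envelope m (norm a))"
    using L2_dominated[OF Bm_measurable[OF \<phi>] w(1) Bm_bound[OF \<phi> order_refl]] by (simp_all add: w(2))
qed

lemma norm_G_gradient_le:
  assumes \<phi>: "\<phi> \<in> Bm m" and t: "t > 0"
  shows "norm (G_gradient D G (OU S \<sigma> t \<phi>) x) \<le> wnorm m \<phi> * L2norm_OU t (envelope m (norm (S t x))) * norm (\<Gamma> t)"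
proof -
  interpret gaussian_direction "Q_sqrt t" "\<mu> t" "\<Gamma> t" "noise t" by (rule gaussian_direction_OU[OF t])
  have "norm (dual_OU t (\<lambda>y. \<phi> (y + S t x))) \<le> L2norm_OU t (\<lambda>y. \<phi> (y + S t x)) * norm (\<Gamma> t)"
    by (rule dual(2)[OF L2_Bm(1)[OF \<phi> t]])
  also have "\<dots> \<le> wnorm m \<phi> * L2norm_OU t (envelope m (norm (S t x))) * norm (\<Gamma> t)"
    by (intro mult_right_mono L2_Bm(2)[OF \<phi> t]) simp
  finally show ?thesis by (simp only: G_gradient_OU[OF t L2_Bm(1)[OF \<phi> t]])
qed

text \<open>Comparable to \<open>growth t powr (m / 2)\<close>, which the moments produce, and at
  least \<open>exp (m * \<omega> * t)\<close>, which comes from the norm of \<open>S t x\<close>;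
  one factor thus serves both contributions.\<close>

definition growth_factor :: "real \<Rightarrow> real" where
  "growth_factor t = (if \<omega> > 0 then exp (m * \<omega> * t) else if \<omega> = 0 then 1 + t powr (m / 2) else 1)"

lemma growth_factor_ge_1: "t > 0 \<Longrightarrow> 1 \<le> growth_factor t"
  using m by (auto simp: growth_factor_def)

lemma sqrt_growth_le:
  assumes \<kappa>: "\<kappa> > 0" and t: "t > 0" and \<tau>: "0 \<le> \<tau>" "\<tau> \<le> \<kappa> * growth t"
  shows "sqrt (norm_power m \<tau>) \<le> (1 + (2 * \<kappa>) powr (m / 2)) * growth_factor t"
proof (cases "m = 0")
  case True
  then have "(1 + (2 * \<kappa>) powr (m / 2)) * growth_factor t \<ge> 2 * 1"
    using \<kappa> growth_factor_ge_1[OF t] by (intro mult_mono) auto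
  then show ?thesis using True by (simp add: norm_power_def)
next
  case False
  have g: "growth t > 0" using t by (simp add: growth_def add_pos_pos)
  have gf: "growth_factor t > 0" using growth_factor_ge_1[OF t] by simp
  have gr: "growth t powr (m / 2) \<le> 2 powr (m / 2) * growth_factor t"
  proof -
    have two: "1 \<le> 2 powr (m / 2)" using m by (intro ge_one_powr_ge_zero) auto
    consider "\<omega> > 0" | "\<omega> = 0" | "\<omega> < 0" by linarith
    then show ?thesis
    proof cases
      case 1
      then have "growth t powr (m / 2) = growth_factor t"
        by (simp add: growth_def growth_factor_def powr_def mult_ac)
      then show ?thesis using two gf by simp
    next
      case 2
      have "(1 + t) powr (m / 2) \<le> (2 * max 1 t) powr (m / 2)" using m t by (intro powr_mono2) auto
      also have "\<dots> = 2 powr (m / 2) * max 1 t powr (m / 2)" by (rule powr_mult)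
      also have "\<dots> \<le> 2 powr (m / 2) * (1 + t powr (m / 2))"
        by (intro mult_left_mono) (auto simp: max_def)
      finally show ?thesis unfolding growth_def growth_factor_def using 2 by simp
    next
      case 3
      then show ?thesis using two by (simp add: growth_def growth_factor_def)
    qed
  qed
  have "sqrt (norm_power m \<tau>) = \<tau> powr (m / 2)"
    using False \<tau>(1) by (simp add: norm_power_def powr_half_sqrt[symmetric] powr_powr)
  also have "\<dots> \<le> (\<kappa> * growth t) powr (m / 2)" using m \<tau> by (intro powr_mono2) auto
  also have "\<dots> = \<kappa> powr (m / 2) * growth t powr (m / 2)" by (rule powr_mult)
  also have "\<dots> \<le> \<kappa> powr (m / 2) * (2 powr (m / 2) * growth_factor t)"
    by (intro mult_left_mono gr) simp
  also have "\<dots> = (2 * \<kappa>) powr (m / 2) * growth_factor t" by (simp add: powr_mult mult_ac)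
  also have "\<dots> \<le> (1 + (2 * \<kappa>) powr (m / 2)) * growth_factor t"
    using gf by (intro mult_right_mono) auto
  finally show ?thesis .
qed

lemma norm_power_S_le:
  assumes t: "t > 0"
  shows "norm_power m (norm (S t x)) \<le> M powr m * growth_factor t * norm_power m x"
proof (cases "m = 0")
  case True
  then show ?thesis using M growth_factor_ge_1[OF t] by (simp add: norm_power_def)
next
  case False
  have "norm (S t x) powr m \<le> (M * exp (\<omega> * t) * norm x) powr m"
    using m t by (intro powr_mono2 S_apply_le) auto
  also have "\<dots> = M powr m * exp (m * \<omega> * t) * norm x powr m"
    by (simp add: powr_mult) (simp add: powr_def mult_ac)
  also have "\<dots> \<le> M powr m * growth_factor t * norm x powr m"
  proof (intro mult_right_mono mult_left_mono)
    show "exp (m * \<omega> * t) \<le> growth_factor t"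
      using m t by (auto simp: growth_factor_def mult_nonneg_nonpos mult_nonpos_nonneg not_less)
  qed auto
  finally show ?thesis using False by (simp add: norm_power_def)
qed

lemma norm_G_gradient_growth:
  "\<exists>\<kappa>>0. \<forall>\<phi>\<in>Bm m. \<forall>t>0. \<forall>x. norm (G_gradient D G (OU S \<sigma> t \<phi>) x) \<le> \<kappa> * norm (\<Gamma> t) * weight m x * growth_factor t * wnorm m \<phi>"
proof -
  obtain K \<kappa>\<^sub>0 where K: "K > 0" and \<kappa>\<^sub>0: "\<kappa>\<^sub>0 > 0" and env: "\<forall>t>0. \<exists>\<tau>\<ge>0. \<tau> \<le> \<kappa>\<^sub>0 * growth t \<and> (\<forall>\<rho>. L2_OU t (envelope m \<rho>) \<and>
      L2norm_OU t (envelope m \<rho>) \<le> K * (1 + sqrt (norm_power m \<tau>) + norm_power m \<rho>))"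
    using envelope_L2_bound by (elim exE conjE)
  define A where "A = 1 + (2 * \<kappa>\<^sub>0) powr (m / 2)"
  \<comment> \<open>One summand for each term of the envelope bound: the constant, the trace and the
    shift by \<open>S t x\<close>.\<close>
  define \<kappa> where "\<kappa> = K * (1 + A + M powr m)"
  have A: "A \<ge> 0" by (simp add: A_def)
  have "\<kappa> > 0" using K A by (auto simp: \<kappa>_def intro!: mult_pos_pos add_pos_nonneg)
  moreover have "norm (G_gradient D G (OU S \<sigma> t \<phi>) x) \<le> \<kappa> * norm (\<Gamma> t) * weight m x * growth_factor t * wnorm m \<phi>"
    if \<phi>: "\<phi> \<in> Bm m" and t: "t > 0" for \<phi> t x
  proof -
    obtain \<tau> where \<tau>: "0 \<le> \<tau>" "\<tau> \<le> \<kappa>\<^sub>0 * growth t"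
      "\<And>\<rho>. L2norm_OU t (envelope m \<rho>) \<le> K * (1 + sqrt (norm_power m \<tau>) + norm_power m \<rho>)"
      using env[rule_format, OF t] by blast
    define gf where "gf = growth_factor t"
    define w where "w = weight m x"
    have gf: "gf \<ge> 1" unfolding gf_def by (rule growth_factor_ge_1[OF t])
    have w: "w \<ge> 1" "norm_power m x \<le> w" by (auto simp: w_def weight_eq norm_power_nonneg)
    have gw: "gf \<le> gf * w" "1 \<le> gf * w" using gf w mult_left_mono[of 1 w gf] mult_mono[of 1 gf 1 w] by auto
    have 1: "sqrt (norm_power m \<tau>) \<le> A * (gf * w)"
    proof -
      have "sqrt (norm_power m \<tau>) \<le> A * gf"
        unfolding A_def gf_def by (rule sqrt_growth_le[OF \<kappa>\<^sub>0 t \<tau>(1,2)])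
      also have "\<dots> \<le> A * (gf * w)" using A gw by (intro mult_left_mono) auto
      finally show ?thesis .
    qed
    have 2: "norm_power m (norm (S t x)) \<le> M powr m * (gf * w)"
    proof -
      have "norm_power m (norm (S t x)) \<le> M powr m * gf * norm_power m x"
        unfolding gf_def by (rule norm_power_S_le[OF t])
      also have "\<dots> \<le> M powr m * gf * w" using gf w(2) by (intro mult_left_mono) auto
      finally show ?thesis by (simp add: mult.assoc)
    qed
    have "L2norm_OU t (envelope m (norm (S t x))) \<le> K * (1 + sqrt (norm_power m \<tau>) + norm_power m (norm (S t x)))"
      by (rule \<tau>(3))
    also have "\<dots> \<le> K * (gf * w + A * (gf * w) + M powr m * (gf * w))"
      using K 1 2 gw by (intro mult_left_mono add_mono) auto
    also have "\<dots> = \<kappa> * (gf * w)" by (simp add: \<kappa>_def algebra_simps)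
    finally have le: "L2norm_OU t (envelope m (norm (S t x))) \<le> \<kappa> * (gf * w)" .
    have "norm (G_gradient D G (OU S \<sigma> t \<phi>) x) \<le> wnorm m \<phi> * L2norm_OU t (envelope m (norm (S t x))) * norm (\<Gamma> t)"
      by (rule norm_G_gradient_le[OF \<phi> t])
    also have "\<dots> \<le> wnorm m \<phi> * (\<kappa> * (gf * w)) * norm (\<Gamma> t)"
      by (intro mult_right_mono mult_left_mono le wnorm_nonneg[OF \<phi>]) simp
    finally show ?thesis by (simp add: gf_def w_def mult_ac)
  qed
  ultimately show ?thesis by (intro exI[of _ \<kappa>] conjI ballI allI impI)
qed

lemma Cm_Bm: "(\<phi> :: 'h \<Rightarrow> real) \<in> Cm m \<Longrightarrow> \<phi> \<in> Bm m"
  by (simp add: Cm_def Bm_def borel_measurable_continuous_onI)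

text \<open>The gradient depends on the translate of \<open>\<phi>\<close> in a Lipschitz way for
  the \<open>L\<^sup>2\<close> norm. Along a convergent sequence the shifts stay bounded, so one
  envelope dominates all translates, and continuity of \<open>\<phi>\<close> makes them converge in
  mean square.\<close>

lemma G_gradient_Cm:
  assumes \<phi>: "\<phi> \<in> Cm m" and t: "t > 0"
  shows "G_gradient D G (OU S \<sigma> t \<phi>) \<in> Cm m"
proof -
  interpret gaussian_direction "Q_sqrt t" "\<mu> t" "\<Gamma> t" "noise t" by (rule gaussian_direction_OU[OF t])
  have \<phi>B: "\<phi> \<in> Bm m" by (rule Cm_Bm[OF \<phi>])
  have cont: "continuous_on UNIV \<phi>" using \<phi> by (simp add: Cm_def)
  obtain \<kappa> where \<kappa>: "\<forall>\<phi>\<in>Bm m. \<forall>t>0. \<forall>x.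
    norm (G_gradient D G (OU S \<sigma> t \<phi>) x) \<le> \<kappa> * norm (\<Gamma> t) * weight m x * growth_factor t * wnorm m \<phi>"
    using norm_G_gradient_growth by (elim exE conjE)
  have "norm (G_gradient D G (OU S \<sigma> t \<phi>) x) / weight m x \<le> \<kappa> * norm (\<Gamma> t) * growth_factor t * wnorm m \<phi>" for x
    using \<kappa>[rule_format, OF \<phi>B t, of x] weight_ge_1[of m x] by (simp add: pos_divide_le_eq mult_ac)
  then have "bdd_above (range (\<lambda>x. norm (G_gradient D G (OU S \<sigma> t \<phi>) x) / weight m x))"
    by (intro bdd_aboveI2)
  moreover have "continuous_on UNIV (G_gradient D G (OU S \<sigma> t \<phi>))"
  proof (rule continuous_at_imp_continuous_on, rule ballI)
    fix x
    show "isCont (G_gradient D G (OU S \<sigma> t \<phi>)) x"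
      unfolding continuous_at_sequentially
    proof (intro allI impI)
      fix X :: "nat \<Rightarrow> 'h" assume X: "X \<longlonglongrightarrow> x"
      then have SX: "(\<lambda>n. S t (X n)) \<longlonglongrightarrow> S t x" by (intro tendsto_intros)
      then obtain \<rho> where \<rho>: "\<And>n. norm (S t (X n)) \<le> \<rho>"
        using convergent_imp_Bseq[of "\<lambda>n. S t (X n)"] by (auto simp: convergent_def Bseq_def)
      have \<rho>x: "norm (S t x) \<le> \<rho>"
        by (rule LIMSEQ_le_const2[OF tendsto_norm[OF SX]]) (use \<rho> in blast)
      define f where "f n y = \<phi> (y + S t (X n)) - \<phi> (y + S t x)" for n y
      define w where "w y = 2 * wnorm m \<phi> * envelope m \<rho> y" for y :: 'h
      have fm: "f n \<in> borel_measurable borel" for n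
        unfolding f_def using Bm_measurable[OF \<phi>B] by (intro borel_measurable_diff)
      have fw: "\<bar>f n y\<bar> \<le> w y" for n y
        using Bm_bound[OF \<phi>B \<rho>[of n], of y] Bm_bound[OF \<phi>B \<rho>x, of y] by (simp add: f_def w_def)
      have wL2: "L2_OU t w"
        unfolding w_def using L2_cmult(1)[OF L2_envelope[OF t], of "2 * wnorm m \<phi>" \<rho>] wnorm_nonneg[OF \<phi>B] by simp
      have fL2: "L2_OU t (f n)" for n by (rule L2_dominated(1)[OF fm wL2 fw])
      have "(\<lambda>n. \<integral>y. (f n y)\<^sup>2 \<partial>\<mu> t) \<longlonglongrightarrow> (\<integral>y. 0 \<partial>\<mu> t)"
      proof (rule integral_dominated_convergence[where w = "\<lambda>y. (w y)\<^sup>2"])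
        show "integrable (\<mu> t) (\<lambda>y. (w y)\<^sup>2)" using wL2 by (simp add: L2_def)
        show "(\<lambda>y. (f n y)\<^sup>2) \<in> borel_measurable (\<mu> t)" for n
          unfolding measurable_\<mu> using fm by measurable
        show "AE y in \<mu> t. norm ((f n y)\<^sup>2) \<le> (w y)\<^sup>2" for n
        proof (rule AE_I2)
          fix y
          have "\<bar>f n y\<bar>\<^sup>2 \<le> (w y)\<^sup>2" by (intro power_mono fw) simp
          then show "norm ((f n y)\<^sup>2) \<le> (w y)\<^sup>2" by simp
        qed
        show "AE y in \<mu> t. (\<lambda>n. (f n y)\<^sup>2) \<longlonglongrightarrow> 0"
        proof (rule AE_I2)
          fix y
          have "(\<lambda>n. \<phi> (y + S t (X n))) \<longlonglongrightarrow> \<phi> (y + S t x)"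
            by (rule continuous_on_tendsto_compose[OF cont tendsto_add[OF tendsto_const SX]]) auto
          then have "(\<lambda>n. (f n y)\<^sup>2) \<longlonglongrightarrow> (\<phi> (y + S t x) - \<phi> (y + S t x))\<^sup>2"
            unfolding f_def by (intro tendsto_intros)
          then show "(\<lambda>n. (f n y)\<^sup>2) \<longlonglongrightarrow> 0" by simp
        qed
      qed simp
      then have "(\<lambda>n. L2norm_OU t (f n) * norm (\<Gamma> t)) \<longlonglongrightarrow> sqrt 0 * norm (\<Gamma> t)"
        unfolding L2norm_def by (intro tendsto_intros) simp
      then have lim: "(\<lambda>n. L2norm_OU t (f n) * norm (\<Gamma> t)) \<longlonglongrightarrow> 0" by simp
      have "norm (G_gradient D G (OU S \<sigma> t \<phi>) (X n) - G_gradient D G (OU S \<sigma> t \<phi>) x)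
          \<le> L2norm_OU t (f n) * norm (\<Gamma> t)" for n
        unfolding G_gradient_OU[OF t L2_Bm(1)[OF \<phi>B t]] f_def
        by (rule dual_diff_bound[OF L2_Bm(1)[OF \<phi>B t] L2_Bm(1)[OF \<phi>B t] fL2[unfolded f_def]])
      then have "(\<lambda>n. G_gradient D G (OU S \<sigma> t \<phi>) (X n) - G_gradient D G (OU S \<sigma> t \<phi>) x) \<longlonglongrightarrow> 0"
        by (intro Lim_null_comparison[OF _ lim] always_eventually allI)
      then show "((G_gradient D G (OU S \<sigma> t \<phi>)) \<circ> X) \<longlonglongrightarrow> G_gradient D G (OU S \<sigma> t \<phi>) x"
        by (simp add: LIM_zero_iff o_def)
    qed
  qed
  ultimately show ?thesis by (simp add: Cm_def)
qed

lemma G_gradient_C1m: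
  assumes \<phi>: "\<phi> \<in> C1m m" and t: "t > 0"
  shows "has_bochner_integral (\<mu> t) (\<lambda>y. inner (gradient \<phi> (y + S t x)) (E t k))
    (inner (G_gradient D G (OU S \<sigma> t \<phi>) x) k)"
proof -
  interpret gaussian_direction "Q_sqrt t" "\<mu> t" "\<Gamma> t" "noise t" by (rule gaussian_direction_OU[OF t])
  have \<phi>B: "\<phi> \<in> Bm m" using \<phi> by (intro Cm_Bm) (simp add: C1m_def)
  have b: "bdd_above (range (\<lambda>x. norm (gradient \<phi> x) / weight m x))"
    and cont: "continuous_on UNIV (gradient \<phi>)"
    using \<phi> by (auto simp: C1m_def Cm_def)
  have diff: "GDERIV \<phi> x :> gradient \<phi> x" for x
    using \<phi> by (intro gderiv_gradient) (simp add: C1m_def)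
  have env: "integrable (\<mu> t) (envelope m \<rho>)" for \<rho>
    using L2_envelope[OF t, of \<rho>] unfolding L2_def by (elim conjE) (rule shift_remainder_bound(2)[OF noise])
  have "has_bochner_integral (\<mu> t) (\<lambda>y. inner (gradient \<phi> (y + S t x)) (Q_sqrt t (\<Gamma> t k)))
      (inner (dual_OU t (\<lambda>y. \<phi> (y + S t x))) k)"
    by (rule dual_eq_gradient_integral[OF L2_Bm(1)[OF \<phi>B t] diff cont wnorm_bound(1)[OF b] wnorm_bound(2)[OF b] m env])
  then show ?thesis by (simp only: \<Gamma>(1)[OF t] G_gradient_OU[OF t L2_Bm(1)[OF \<phi>B t]])
qed

end

theorem theorem4p11:
  fixes DA :: "'h::{real_inner, banach, second_countable_topology} set"
    and A :: "'h \<Rightarrow> 'h"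
    and S :: "real \<Rightarrow> 'h \<Rightarrow>\<^sub>L 'h"
    and M \<omega> m :: real
    and \<sigma> :: "'x::{real_inner, banach, second_countable_topology} \<Rightarrow>\<^sub>L 'h"
    and DG :: "'k::{real_inner, banach, second_countable_topology} set"
    and G :: "'k \<Rightarrow> 'h"
    and E :: "real \<Rightarrow> 'k \<Rightarrow>\<^sub>L 'h"
  assumes "generates_C0_semigroup DA A S"
    and "M \<ge> 1"
    and "\<And>t. t \<ge> 0 \<Longrightarrow> norm (S t) \<le> M * exp (\<omega> * t)"
    and "\<And>s. s > 0 \<Longrightarrow> trace_class (cov_density S \<sigma> s)"
    and "\<And>t. t \<ge> 0 \<Longrightarrow>
           (\<integral>\<^sup>+ s\<in>{0..t}. ennreal (trace_op (cov_density S \<sigma> s)) \<partial>lborel) < \<infinity>"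
    and "closed_densely_defined DG G"
    and "\<And>t z. t > 0 \<Longrightarrow> z \<in> DG \<Longrightarrow> E t z = S t (G z)"
    and "\<And>t. t > 0 \<Longrightarrow> range (E t) \<subseteq> range (sqrt_op (cov_op S \<sigma> t))"
    and "m \<ge> 0"
  shows "(\<forall>\<phi>\<in>Bm m. \<forall>t>0. \<forall>x.
            G_differentiable DG G (OU S \<sigma> t \<phi>) x \<and>
            (\<forall>k. has_bochner_integral (gaussian (cov_op S \<sigma> t))
                   (\<lambda>y. \<phi> (y + S t x) *
                      gaussian_functional (cov_op S \<sigma> t) (Gamma_op S \<sigma> E t k) y)
                   (inner (G_gradient DG G (OU S \<sigma> t \<phi>) x) k)))
       \<and> (\<exists>\<kappa>>0. \<forall>\<phi>\<in>Bm m. \<forall>t>0. \<forall>x.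
            (\<omega> > 0 \<longrightarrow> norm (G_gradient DG G (OU S \<sigma> t \<phi>) x)
               \<le> \<kappa> * norm (Gamma_op S \<sigma> E t) * weight m x * exp (m * \<omega> * t) * wnorm m \<phi>) \<and>
            (\<omega> = 0 \<longrightarrow> norm (G_gradient DG G (OU S \<sigma> t \<phi>) x)
               \<le> \<kappa> * norm (Gamma_op S \<sigma> E t) * weight m x * (1 + t powr (m / 2)) * wnorm m \<phi>) \<and>
            (\<omega> < 0 \<longrightarrow> norm (G_gradient DG G (OU S \<sigma> t \<phi>) x)
               \<le> \<kappa> * norm (Gamma_op S \<sigma> E t) * weight m x * wnorm m \<phi>))
       \<and> (\<forall>\<phi>\<in>Cm m. \<forall>t>0. G_gradient DG G (OU S \<sigma> t \<phi>) \<in> Cm m)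
       \<and> (\<forall>\<phi>\<in>C1m m. \<forall>t>0. \<forall>x k.
            has_bochner_integral (gaussian (cov_op S \<sigma> t))
              (\<lambda>y. inner (gradient \<phi> (y + S t x)) (E t k))
              (inner (G_gradient DG G (OU S \<sigma> t \<phi>) x) k))"
proof -
  interpret ornstein_uhlenbeck_G S \<sigma> M \<omega> DG G E m
  proof
    show "C0_semigroup S" using assms(1) by (simp add: generates_C0_semigroup_def)
    show "closure DG = UNIV" using assms(6) by (simp add: closed_densely_defined_def)
  qed (fact assms)+
  obtain \<kappa> where \<kappa>: "\<kappa> > 0" "\<forall>\<phi>\<in>Bm m. \<forall>t>0. \<forall>x.
    norm (G_gradient DG G (OU S \<sigma> t \<phi>) x) \<le> \<kappa> * norm (\<Gamma> t) * weight m x * growth_factor t * wnorm m \<phi>"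
    using norm_G_gradient_growth by (elim exE conjE)
  show ?thesis
  proof (intro conjI ballI allI impI)
    fix \<phi> :: "'h \<Rightarrow> real" and t :: real and x :: 'h
    assume \<phi>: "\<phi> \<in> Bm m" and t: "t > 0"
    interpret gaussian_direction "Q_sqrt t" "\<mu> t" "\<Gamma> t" "noise t" by (rule gaussian_direction_OU[OF t])
    note g = L2_Bm(1)[OF \<phi> t, of "S t x"]
    show "G_differentiable DG G (OU S \<sigma> t \<phi>) x"
      unfolding G_differentiable_def using has_G_gradient_OU[OF t g] by blast
    fix k
    show "has_bochner_integral (\<mu> t) (\<lambda>y. \<phi> (y + S t x) * noise t k y)
        (inner (G_gradient DG G (OU S \<sigma> t \<phi>) x) k)"
      unfolding has_bochner_integral_iff G_gradient_OU[OF t g] using integrable_noise[OF g] dual(1)[OF g] by simp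
  next
    show "\<exists>\<kappa>>0. \<forall>\<phi>\<in>Bm m. \<forall>t>0. \<forall>x.
            (\<omega> > 0 \<longrightarrow> norm (G_gradient DG G (OU S \<sigma> t \<phi>) x)
               \<le> \<kappa> * norm (\<Gamma> t) * weight m x * exp (m * \<omega> * t) * wnorm m \<phi>) \<and>
            (\<omega> = 0 \<longrightarrow> norm (G_gradient DG G (OU S \<sigma> t \<phi>) x)
               \<le> \<kappa> * norm (\<Gamma> t) * weight m x * (1 + t powr (m / 2)) * wnorm m \<phi>) \<and>
            (\<omega> < 0 \<longrightarrow> norm (G_gradient DG G (OU S \<sigma> t \<phi>) x)
               \<le> \<kappa> * norm (\<Gamma> t) * weight m x * wnorm m \<phi>)"
    proof (intro exI[of _ \<kappa>] conjI ballI allI impI \<kappa>(1))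
      fix \<phi> :: "'h \<Rightarrow> real" and t :: real and x :: 'h
      assume "\<phi> \<in> Bm m" "t > 0"
      note le = \<kappa>(2)[rule_format, OF this, of x, unfolded growth_factor_def]
      show "norm (G_gradient DG G (OU S \<sigma> t \<phi>) x)
          \<le> \<kappa> * norm (\<Gamma> t) * weight m x * exp (m * \<omega> * t) * wnorm m \<phi>" if "\<omega> > 0"
        using le that by simp
      show "norm (G_gradient DG G (OU S \<sigma> t \<phi>) x)
          \<le> \<kappa> * norm (\<Gamma> t) * weight m x * (1 + t powr (m / 2)) * wnorm m \<phi>" if "\<omega> = 0"
        using le that by simp
      show "norm (G_gradient DG G (OU S \<sigma> t \<phi>) x)
          \<le> \<kappa> * norm (\<Gamma> t) * weight m x * wnorm m \<phi>" if "\<omega> < 0"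
        using le that by simp
    qed
  qed (auto intro: G_gradient_Cm G_gradient_C1m)
qed

end
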